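(* Let $p>2$ be a prime, $\mathbf{F}$ a field of characteristic $p$, and $M\in\mathbf{F}^{2\times4}$. If $\gamma_{1234}(M)=0$, $\gamma_{1235}(M)\neq0$ and $\gamma_{1357}(M)\neq0$, then, with $h_1,h_2,h_3$ and $N_M(z)$ as defined in the context, the set $\mathcal B:=\{x,h_1,h_2,h_3,N_M(z)\}$ is a SAGBI basis, and hence a generating set, for $\mathbf{F}[V_M]^E$. Furthermore, $\mathbf{F}[V_M]^E$ is a complete intersection with generating relations coming from the subduction of the têtes-à-têtes $(h_2^2,h_1^{p^2})$ and $(h_3^p,h_1h_2^p)$.
   Context: For $M=(c_{ij})\in\mathbf{F}^{2\times4}$, $E=\langle e_1,e_2,e_3,e_4\rangle\cong(\mathbf{Z}/p)^4$ acts on $\mathbf{F}[V_M]=\mathbf{F}[x,y,z]$ (on the right, by algebra automorphisms) by $x\cdot e_j=x$, $y\cdot e_j=y+c_{1j}x$, $z\cdot e_j=z+2c_{1j}y+(c_{1j}^2+c_{2j})x$; $\mathbf{F}[V_M]^E$ is the ring of invariants. $N_M(z)$ is the product of the distinct elements of the $E$-orbit of $z$. Minors: $\Gamma(M)$ is the $10\times4$ matrix whose row $2k+1$ is $(c_{11}^{p^k},\dots,c_{14}^{p^k})$ and whose row $2k+2$ is $(c_{21}^{p^k},\dots,c_{24}^{p^k})$, $k=0,\dots,4$; $\gamma_{ijk\ell}(M)$ is its $4\times4$ minor with rows $i,j,k,\ell$, written $\bar\gamma_{ijk\ell}$. Put $\delta:=y^2-xz$ and (when $\bar\gamma_{1234}=0$,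 $\bar\gamma_{1235}\ne0$, $\bar\gamma_{1357}\neq 0$) $$h_1:=\delta^p+\frac{\bar\gamma_{1245}}{\bar\gamma_{1235}}y^px^{p}+\frac{\bar\gamma_{1345}}{\bar\gamma_{1235}}\delta x^{2p-2}+\frac{\bar\gamma_{2345}}{\bar\gamma_{1235}}yx^{2p-1},$$ $$h_2:=y^{p^3}-\frac{\bar\gamma_{1237}}{\bar\gamma_{1235}}y^{p^2}x^{p^3-p^2}+\frac{\bar\gamma_{1257}}{\bar\gamma_{1235}}y^{p}x^{p^3-p}+\frac{\bar\gamma_{1357}}{\bar\gamma_{1235}}\delta x^{p^3-2}+\frac{\bar\gamma_{2357}}{\bar\gamma_{1235}}yx^{p^3-1},$$ $$\widetilde{h_3}:=h_2^2-h_1^{p^2}+2\frac{\bar\gamma_{1237}}{\bar\gamma_{1235}}h_1^{p(p+1)/2}x^{p^3-p^2}-2\frac{\bar\gamma_{1257}}{\bar\gamma_{1235}}h_1^{(p^2+1)/2}x^{p^3-p},\qquad h_3:=\frac{\bar\gamma_{1235}\,\widetilde{h_3}}{2\bar\gamma_{1357}x^{p^3-2}}.$$ These are elements of $\mathbf{F}[V_M]^E$ with lead terms $y^{2p}$, $y^{p^3}$, $y^{p^3+2}$ for $h_1,h_2,h_3$ respectively. Conventions: graded reverse lexicographic order with $x<y<z$; $\mathrm{LM}$, $\mathrm{LT}$ denote lead monomial and lead term (with coefficient). A finite subset $\mathcal B=\{b_1,\dots,b_m\}$ of a subalgebra $A$ of a polynomial ring is a SAGBI basis for $A$ if the monomials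 $\mathrm{LM}(b_i)$ generate the algebra spanned by the lead monomials of the elements of $A$. A tête-à-tête is a pair $(b^I,b^J)$ of products of elements of $\mathcal B$ with $\mathrm{LM}(b^I)=\mathrm{LM}(b^J)$. Its subduction: choose a scalar $c$ with $\mathrm{LT}(b^I)=\mathrm{LT}(cb^J)$ and repeatedly cancel the lead term of $b^I-cb^J$ by scalar multiples of products of elements of $\mathcal B$; if this ends at zero, it expresses $b^I-cb^J$ as a polynomial in $\mathcal B$, giving a relation. "Generating relations coming from the subduction of" given têtes-à-têtes means that the kernel of the surjection from the polynomial ring on $m$ variables sending the variables to $b_1,\dots,b_m$ is generated by the relations so obtained. A complete intersection is an algebra having a presentation whose ideal of relations is generated by a regular sequence. *)

theory Defs
  imports
    "HOL-Analysis.Determinants"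
    "HOL-Library.Poly_Mapping"
    "HOL-Algebra.Group_Action"
    "HOL-Algebra.Product_Groups"
    "HOL-Computational_Algebra.Primes"
begin

section \<open>Polynomials in finitely many variables\<close>

text \<open>
  A monomial is a finitely supported exponent function on variable indices, a polynomial a
  finitely supported function from monomials to coefficients; the ring structure is the
  convolution product of \<^theory>\<open>HOL-Library.Poly_Mapping\<close>. The polynomial ring in \<open>n\<close> variables
  is the subring \<open>polys n\<close> of polynomials in the variables with index below \<open>n\<close>.
\<close>

type_synonym monomial = "nat \<Rightarrow>\<^sub>0 nat"
type_synonym 'a mpoly = "monomial \<Rightarrow>\<^sub>0 'a"

definition Const :: "'a::field \<Rightarrow> 'a mpoly" where
  "Const c = Poly_Mapping.single 0 c"

definition Monom :: "monomial \<Rightarrow> 'a::field mpoly" where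
  "Monom m = Poly_Mapping.single m 1"

definition Var :: "nat \<Rightarrow> 'a::field mpoly" where
  "Var i = Monom (Poly_Mapping.single i 1)"

definition polys :: "nat \<Rightarrow> 'a::field mpoly set" where
  "polys n = {f. \<forall>m\<in>Poly_Mapping.keys f. Poly_Mapping.keys m \<subseteq> {..<n}}"

text \<open>The algebra homomorphism sending the variable with index \<open>i\<close> to \<open>\<sigma> i\<close>.\<close>

definition subst :: "(nat \<Rightarrow> 'a::field mpoly) \<Rightarrow> 'a mpoly \<Rightarrow> 'a mpoly" where
  "subst \<sigma> f = (\<Sum>m\<in>Poly_Mapping.keys f. Const (Poly_Mapping.lookup f m) *
     (\<Prod>i\<in>Poly_Mapping.keys m. \<sigma> i ^ Poly_Mapping.lookup m i))"

definition subalgebra :: "'a::field mpoly set \<Rightarrow> bool" where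
  "subalgebra A \<longleftrightarrow> (\<forall>c. Const c \<in> A) \<and> (\<forall>f\<in>A. \<forall>g\<in>A. f + g \<in> A \<and> f * g \<in> A)"

abbreviation generated_algebra :: "'a::field mpoly set \<Rightarrow> 'a mpoly set" where
  "generated_algebra S \<equiv> subalgebra hull S"

definition linear_span :: "'a::field mpoly set \<Rightarrow> 'a mpoly set" where
  "linear_span = module.span (\<lambda>(c::'a) f. Const c * f)"

section \<open>Lead terms and SAGBI bases\<close>

text \<open>Graded reverse lexicographic order for which variables with smaller index are smaller.\<close>

definition total_deg :: "monomial \<Rightarrow> nat" where
  "total_deg m = (\<Sum>i\<in>Poly_Mapping.keys m. Poly_Mapping.lookup m i)"

definition grevlex_less :: "monomial \<Rightarrow> monomial \<Rightarrow> bool" where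
  "grevlex_less s t \<longleftrightarrow> total_deg s < total_deg t \<or>
     (total_deg s = total_deg t \<and>
      (\<exists>i. Poly_Mapping.lookup s i > Poly_Mapping.lookup t i \<and>
           (\<forall>j<i. Poly_Mapping.lookup s j = Poly_Mapping.lookup t j)))"

text \<open>\<open>LM\<close>, \<open>LC\<close> and \<open>LT\<close> are meaningful for nonzero polynomials only.\<close>

definition LM :: "'a::field mpoly \<Rightarrow> monomial" where
  "LM f = (THE m. m \<in> Poly_Mapping.keys f \<and>
     (\<forall>t\<in>Poly_Mapping.keys f. t \<noteq> m \<longrightarrow> grevlex_less t m))"

definition LC :: "'a::field mpoly \<Rightarrow> 'a" where
  "LC f = Poly_Mapping.lookup f (LM f)"

definition LT :: "'a::field mpoly \<Rightarrow> 'a mpoly" where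
  "LT f = Const (LC f) * Monom (LM f)"

text \<open>The lead monomial as an element of the polynomial ring.\<close>

definition lead_monom :: "'a::field mpoly \<Rightarrow> 'a mpoly" where
  "lead_monom f = Monom (LM f)"

definition sagbi_basis :: "'a::field mpoly set \<Rightarrow> 'a mpoly set \<Rightarrow> bool" where
  "sagbi_basis B A \<longleftrightarrow> subalgebra A \<and> finite B \<and> B \<subseteq> A \<and> 0 \<notin> B \<and>
     generated_algebra (lead_monom ` B) = linear_span (lead_monom ` (A - {0}))"

section \<open>Presentations and complete intersections\<close>

text \<open>
  A list \<open>b\<close> of length \<open>m\<close> gives the homomorphism from \<open>polys m\<close> that sends the variable with
  index \<open>i\<close> to \<open>b ! i\<close>.
\<close>

definition eval_at :: "'a::field mpoly list \<Rightarrow> 'a mpoly \<Rightarrow> 'a mpoly" where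
  "eval_at b = subst (\<lambda>i. b ! i)"

definition relation_ideal :: "'a::field mpoly list \<Rightarrow> 'a mpoly set" where
  "relation_ideal b = {f \<in> polys (length b). eval_at b f = 0}"

definition generated_ideal :: "nat \<Rightarrow> 'a::field mpoly list \<Rightarrow> 'a mpoly set" where
  "generated_ideal n rs =
     {(\<Sum>i<length rs. q i * rs ! i) | q. \<forall>i<length rs. q i \<in> polys n}"

definition regular_sequence :: "nat \<Rightarrow> 'a::field mpoly list \<Rightarrow> bool" where
  "regular_sequence n rs \<longleftrightarrow> set rs \<subseteq> polys n \<and> 1 \<notin> generated_ideal n rs \<and>
     (\<forall>i<length rs. \<forall>q\<in>polys n.
        q * rs ! i \<in> generated_ideal n (take i rs) \<longrightarrow> q \<in> generated_ideal n (take i rs))"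

definition complete_intersection :: "'a::field mpoly set \<Rightarrow> bool" where
  "complete_intersection A \<longleftrightarrow> (\<exists>b rs. eval_at b ` polys (length b) = A \<and>
     regular_sequence (length b) rs \<and> relation_ideal b = generated_ideal (length b) rs)"

section \<open>Tete-a-tetes and subduction\<close>

text \<open>
  Products of elements of the family \<open>b\<close> are given by exponent functions \<open>I\<close>; the product
  \<open>b\<^sup>I\<close> is the value of the monomial with exponents \<open>I\<close>.
\<close>

definition prod_of :: "'a::field mpoly list \<Rightarrow> monomial \<Rightarrow> 'a mpoly" where
  "prod_of b I = eval_at b (Monom I)"

definition exps :: "nat \<Rightarrow> monomial set" where
  "exps m = {I. Poly_Mapping.keys I \<subseteq> {..<m}}"

definition tete_a_tete :: "'a::field mpoly list \<Rightarrow> monomial \<Rightarrow> monomial \<Rightarrow> bool" where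
  "tete_a_tete b I J \<longleftrightarrow> I \<in> exps (length b) \<and> J \<in> exps (length b) \<and>
     LM (prod_of b I) = LM (prod_of b J)"

text \<open>
  \<open>subducts b f P\<close>: some sequence of cancellations of lead terms of \<open>f\<close> by scalar multiples of
  products of elements of \<open>b\<close> ends at zero, and \<open>P\<close> is the formal sum of the products used,
  so that \<open>f\<close> is the value of \<open>P\<close> at \<open>b\<close>.
\<close>

inductive subducts :: "'a::field mpoly list \<Rightarrow> 'a mpoly \<Rightarrow> 'a mpoly \<Rightarrow> bool"
  for b :: "'a::field mpoly list" where
  zero: "subducts b 0 0"
| cancel: "f \<noteq> 0 \<Longrightarrow> K \<in> exps (length b) \<Longrightarrow> LT f = LT (Const c * prod_of b K) \<Longrightarrow>
    subducts b (f - Const c * prod_of b K) P \<Longrightarrow> subducts b f (Const c * Monom K + P)"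

text \<open>\<open>R\<close> is a relation obtained by subducting the pair of products with exponents \<open>I\<close>, \<open>J\<close>.\<close>

definition subduction_relation ::
  "'a::field mpoly list \<Rightarrow> monomial \<Rightarrow> monomial \<Rightarrow> 'a mpoly \<Rightarrow> bool" where
  "subduction_relation b I J R \<longleftrightarrow> tete_a_tete b I J \<and>
     (\<exists>c P. LT (prod_of b I) = LT (Const c * prod_of b J) \<and>
        subducts b (prod_of b I - Const c * prod_of b J) P \<and>
        R = Monom I - Const c * Monom J - P)"

section \<open>The representation and its invariants\<close>

abbreviation X :: "'a::field mpoly" where "X \<equiv> Var 0"
abbreviation Y :: "'a::field mpoly" where "Y \<equiv> Var 1"
abbreviation Z :: "'a::field mpoly" where "Z \<equiv> Var 2"

text \<open>
  The index type \<open>4\<close> has the elements \<open>1, 2, 3, 4\<close> with \<open>4 = 0\<close>, and similarly for \<open>2\<close>. So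
  \<open>M $ i $ j\<close> is the entry of \<open>M\<close> in row \<open>i\<close> and column \<open>j\<close>, counted from 1.
\<close>

definition E_group :: "nat \<Rightarrow> (4 \<Rightarrow> int) monoid" where
  "E_group p = product_group (UNIV :: 4 set) (\<lambda>_. integer_mod_group p)"

definition act_gen :: "'a::field^4^2 \<Rightarrow> 4 \<Rightarrow> 'a mpoly \<Rightarrow> 'a mpoly" where
  "act_gen M j = subst (Var
     (1 := Y + Const (M $ 1 $ j) * X,
      2 := Z + Const (2 * M $ 1 $ j) * Y + Const ((M $ 1 $ j)\<^sup>2 + M $ 2 $ j) * X))"

text \<open>
  The element with coordinates \<open>g\<close> is the product of the powers of the generators \<open>e\<^sub>j\<close> with
  exponents \<open>g j\<close>. The actions of the generators commute, and in characteristic \<open>p\<close> each has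
  \<open>p\<close>-th power the identity, so this is an action of the group.
\<close>

definition act :: "'a::field^4^2 \<Rightarrow> (4 \<Rightarrow> int) \<Rightarrow> 'a mpoly \<Rightarrow> 'a mpoly" where
  "act M g f = (act_gen M 4 ^^ nat (g 4)) ((act_gen M 3 ^^ nat (g 3))
     ((act_gen M 2 ^^ nat (g 2)) ((act_gen M 1 ^^ nat (g 1)) f)))"

definition invariant_ring :: "nat \<Rightarrow> 'a::field^4^2 \<Rightarrow> 'a mpoly set" where
  "invariant_ring p M = {f \<in> polys 3. \<forall>g\<in>carrier (E_group p). act M g f = f}"

definition N_z :: "nat \<Rightarrow> 'a::field^4^2 \<Rightarrow> 'a mpoly" where
  "N_z p M = \<Prod>(orbit (E_group p) (act M) Z)"

section \<open>Minors and the special invariants\<close>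

text \<open>Row \<open>r\<close> (for \<open>1 \<le> r \<le> 10\<close>) of the matrix \<open>\<Gamma>(M)\<close>.\<close>

definition Gamma_row :: "nat \<Rightarrow> 'a::field^4^2 \<Rightarrow> nat \<Rightarrow> 'a^4" where
  "Gamma_row p M r = (\<chi> j. (if odd r then M $ 1 $ j else M $ 2 $ j) ^ (p ^ ((r - 1) div 2)))"

definition minor :: "nat \<Rightarrow> 'a::field^4^2 \<Rightarrow> nat \<Rightarrow> nat \<Rightarrow> nat \<Rightarrow> nat \<Rightarrow> 'a" where
  "minor p M i j k l =
     det (vector [Gamma_row p M i, Gamma_row p M j, Gamma_row p M k, Gamma_row p M l] :: 'a^4^4)"

definition delta :: "'a::field mpoly" where
  "delta = Y\<^sup>2 - X * Z"

definition h1 :: "nat \<Rightarrow> 'a::field^4^2 \<Rightarrow> 'a mpoly" where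
  "h1 p M = delta ^ p
     + Const (minor p M 1 2 4 5 / minor p M 1 2 3 5) * Y ^ p * X ^ p
     + Const (minor p M 1 3 4 5 / minor p M 1 2 3 5) * delta * X ^ (2 * p - 2)
     + Const (minor p M 2 3 4 5 / minor p M 1 2 3 5) * Y * X ^ (2 * p - 1)"

definition h2 :: "nat \<Rightarrow> 'a::field^4^2 \<Rightarrow> 'a mpoly" where
  "h2 p M = Y ^ (p ^ 3)
     - Const (minor p M 1 2 3 7 / minor p M 1 2 3 5) * Y ^ (p\<^sup>2) * X ^ (p ^ 3 - p\<^sup>2)
     + Const (minor p M 1 2 5 7 / minor p M 1 2 3 5) * Y ^ p * X ^ (p ^ 3 - p)
     + Const (minor p M 1 3 5 7 / minor p M 1 2 3 5) * delta * X ^ (p ^ 3 - 2)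
     + Const (minor p M 2 3 5 7 / minor p M 1 2 3 5) * Y * X ^ (p ^ 3 - 1)"

definition h3_tilde :: "nat \<Rightarrow> 'a::field^4^2 \<Rightarrow> 'a mpoly" where
  "h3_tilde p M = (h2 p M)\<^sup>2 - h1 p M ^ (p\<^sup>2)
     + Const (2 * (minor p M 1 2 3 7 / minor p M 1 2 3 5))
         * h1 p M ^ (p * (p + 1) div 2) * X ^ (p ^ 3 - p\<^sup>2)
     - Const (2 * (minor p M 1 2 5 7 / minor p M 1 2 3 5))
         * h1 p M ^ ((p\<^sup>2 + 1) div 2) * X ^ (p ^ 3 - p)"

text \<open>
  The quotient is exact: \<open>h3_tilde\<close> is divisible by the power of \<open>X\<close> below, and the quotient is
  unique because polynomials form an integral domain.
\<close>

definition h3 :: "nat \<Rightarrow> 'a::field^4^2 \<Rightarrow> 'a mpoly" where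
  "h3 p M = (THE q. Const (2 * minor p M 1 3 5 7) * X ^ (p ^ 3 - 2) * q
                  = Const (minor p M 1 2 3 5) * h3_tilde p M)"

end

theory Submission
  imports Defs "Jordan_Normal_Form.Char_Poly"
begin

text \<open>
  The group element with coordinates \<open>(\<alpha>, \<beta>)\<close>, an \<open>F\<^sub>p\<close>-combination of the columns of \<open>M\<close>, acts by
  the shear \<open>y \<mapsto> y + \<alpha>x\<close>, \<open>z \<mapsto> z + 2\<alpha>y + (\<alpha>\<^sup>2 + \<beta>)x\<close>, so that \<open>\<delta> \<mapsto> \<delta> - \<beta>x\<^sup>2\<close>. By the linear
  relations between five rows of \<open>\<Gamma>(M)\<close> with minors as coefficients, \<open>\<beta>^p\<close> is a combination of
  \<open>\<alpha>^p, \<beta>, \<alpha>\<close>, because \<open>\<gamma>\<^sub>1\<^sub>2\<^sub>3\<^sub>4 = 0\<close>, and \<open>\<alpha>^(p^3)\<close> is a combination of \<open>\<alpha>^(p^2), \<alpha>^p, \<beta>, \<alpha>\<close>; this is the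
  invariance of \<open>h\<^sub>1\<close> and \<open>h\<^sub>2\<close>.
  The condition \<open>\<gamma>\<^sub>1\<^sub>3\<^sub>5\<^sub>7 \<noteq> 0\<close> makes the \<open>p\<^sup>4\<close> values of \<open>\<alpha>\<close> distinct and makes \<open>h\<^sub>2\<close> of degree
  one in \<open>z\<close>.

  Write \<open>R\<close> for the invariants and call a product \<open>x\<^sup>l h\<^sub>1\<^sup>i h\<^sub>2\<^sup>e h\<^sub>3\<^sup>j N\<^sup>k\<close> normal if \<open>e < 2\<close> and
  \<open>j < p\<close>. The lead monomial of a normal product is \<open>x\<^sup>l y\<^sup>n z\<^sup>m\<close> with \<open>n = 2pi + p\<^sup>3e + (p\<^sup>3 + 2)j\<close>
  and \<open>m = p\<^sup>4k\<close>; since \<open>n\<close> modulo \<open>p\<close> determines \<open>j\<close> and then the parity of \<open>n\<close> determines \<open>e\<close>,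
  distinct normal products have distinct lead monomials (\<open>exponent_unique\<close>, \<open>inj_\<phi>\<close>). So everything
  follows once the normal products span \<open>R\<close> (\<open>R_normal_combinations\<close>). That has three ingredients.

  First, up to a power of \<open>x\<close> every invariant lies in \<open>S = F[x, h\<^sub>1, h\<^sub>2]\<close> (\<open>R_localized\<close>). Solving
  \<open>h\<^sub>2\<close> for \<open>z\<close> and then eliminating \<open>\<delta>\<close> between \<open>h\<^sub>1\<close> and \<open>h\<^sub>2\<close> makes \<open>y\<close> integral of degree
  \<open>p\<^sup>4\<close> over \<open>S\<close>, so that \<open>x\<^sup>m f = \<Sum> s\<^sub>i y\<^sup>i\<close> with \<open>i < p\<^sup>4\<close>; for invariant \<open>f\<close> the right-hand side is a
  polynomial of degree less than \<open>p\<^sup>4\<close> that takes the same value at the \<open>p\<^sup>4\<close> points \<open>y + \<alpha>x\<close>, so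
  only \<open>s\<^sub>0\<close> survives.

  Second, one restricts to the plane \<open>z = 0\<close>. There \<open>y\<close> is integral of degree \<open>2p\<close> over
  \<open>C = F[x, h\<^sub>1]\<close>, so the characteristic polynomial of multiplication by \<open>h\<^sub>2\<close> gives a monic
  equation of degree \<open>2p\<close> for \<open>h\<^sub>2\<close> over \<open>C\<close>, and the defining equation of \<open>h\<^sub>3\<close> turns the powers
  of \<open>h\<^sub>2\<close> below \<open>2p\<close> into the products \<open>h\<^sub>2\<^sup>e h\<^sub>3\<^sup>j\<close> with \<open>e < 2\<close> and \<open>j < p\<close>. Modulo \<open>x\<close> the
  normal products without \<open>x\<close> and \<open>N\<close> are distinct powers of \<open>y\<close>; hence powers of \<open>x\<close> can be cancelled in
  combinations of normal products, and the restriction of every invariant is such a combination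
  (\<open>R_at_0\<close>).

  Third, an invariant that vanishes on \<open>z = 0\<close> is divisible by \<open>z\<close>, hence by all conjugates of \<open>z\<close>,
  hence by \<open>N\<close> (\<open>N_dvd\<close>). Subtracting a combination of normal products and dividing by \<open>N\<close> lowers the
  degree, and induction finishes.

  Since lead monomials of invariants are lead monomials of products of generators, every invariant
  subducts to zero, in particular the difference of either pair. For the relations, order the
  monomials in five variables by the lead monomial of their value, ties being broken by the exponents
  of \<open>h\<^sub>3\<close> and \<open>h\<^sub>2\<close>. Whatever choices the subductions make, the two relations then have the lead monomials of \<open>h\<^sub>2\<^sup>2\<close> and \<open>h\<^sub>3\<^sup>p\<close>. These are coprime, so the
  relations form a regular sequence (\<open>regular_sequence_coprime_leads\<close>), and reduction modulo them
  leaves combinations of normal products, whose values are linearly independent; so they generate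
  all relations.
\<close>

section \<open>Polynomials and substitution\<close>

abbreviation "keys \<equiv> Poly_Mapping.keys"
abbreviation "lookup \<equiv> Poly_Mapping.lookup"
abbreviation "single \<equiv> Poly_Mapping.single"

lemma Const_0 [simp]: "Const 0 = 0"
  and Const_1 [simp]: "Const 1 = 1"
  by (simp_all add: Const_def)

lemma Const_add: "Const (a + b) = Const a + Const b"
  and Const_mult: "Const (a * b) = Const a * Const b"
  and Const_uminus: "Const (- a) = - Const a"
  and Const_diff: "Const (a - b) = Const a - Const b"
  by (simp_all add: Const_def single_add mult_single single_uminus single_diff)

lemma Const_power: "Const (a ^ n) = Const a ^ n"
  by (induction n) (simp_all add: Const_mult)

lemma Const_of_nat: "Const (of_nat n) = of_nat n"
  by (induction n) (simp_all add: Const_add)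

lemma Const_numeral: "Const (numeral n) = numeral n"
  using Const_of_nat[of "numeral n"] by simp

lemma Const_eq_0_iff [simp]: "Const c = 0 \<longleftrightarrow> c = 0"
  by (metis Const_def Const_0 lookup_single_eq)

lemma Const_eq_iff: "Const r = Const s \<longleftrightarrow> r = s"
  using Const_eq_0_iff[of "r - s"] by (simp add: Const_diff)

lemma Const_inverse: "c \<noteq> 0 \<Longrightarrow> Const (inverse c) * Const c = 1"
  by (simp flip: Const_mult)

lemma CHAR_mpoly: "CHAR('a::field mpoly) = CHAR('a)"
proof (rule CHAR_eqI)
  show "of_nat CHAR('a) = (0 :: 'a mpoly)"
    by (simp flip: Const_of_nat)
  show "CHAR('a) dvd x" if "of_nat x = (0 :: 'a mpoly)" for x
    using that by (simp add: of_nat_eq_0_iff_char_dvd flip: Const_of_nat)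
qed

lemma Monom_0 [simp]: "Monom 0 = 1"
  by (simp add: Monom_def)

lemma Monom_add: "Monom (s + t) = Monom s * Monom t"
  by (simp add: Monom_def mult_single)

lemma Monom_nonzero [simp]: "Monom m \<noteq> 0"
  by (metis Monom_def lookup_single_eq lookup_zero zero_neq_one)

lemma Monom_sum: "Monom (sum f A) = prod (\<lambda>i. Monom (f i)) A"
  by (induction A rule: infinite_finite_induct) (simp_all add: Monom_add)

lemma Const_mult_Monom: "Const c * Monom m = single m c"
  by (simp add: Const_def Monom_def mult_single)

lemma Var_power: "Var i ^ n = Monom (single i n)"
  by (induction n) (simp_all add: Var_def flip: Monom_add single_add)

lemma Var_nonzero [simp]: "Var i \<noteq> 0"
  by (simp add: Var_def)

lemma single_one_eq_iff: "single i (Suc 0) = single j (Suc 0) \<longleftrightarrow> i = j"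
proof
  assume "single i (Suc 0) = single j (Suc 0)"
  hence "keys (single i (Suc 0)) = keys (single j (Suc 0))"
    by simp
  thus "i = j" by simp
qed simp

lemma mpoly_expand: "(f :: 'a::field mpoly) =
    (\<Sum>m\<in>keys f. Const (lookup f m) * Monom m)"
  by (rule poly_mapping_eqI)
     (simp add: Const_mult_Monom lookup_sum lookup_single when_def in_keys_iff)

lemma monomial_expand: "(m :: monomial) =
    (\<Sum>i\<in>keys m. single i (lookup m i))"
  by (rule poly_mapping_eqI) (simp add: lookup_sum lookup_single when_def in_keys_iff)

lemma keys_monomial_add: "keys (s + t :: monomial) = keys s \<union> keys t"
  by (auto simp: in_keys_iff lookup_add)

lemma Monom_expand: "Monom m = (\<Prod>i\<in>keys m. Var i ^ lookup m i)"
  by (subst monomial_expand) (simp add: Monom_sum Var_power)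

lemma lookup_Const_mult: "lookup (Const c * f) m = c * lookup f m"
proof -
  have "Const c * f = Poly_Mapping.map ((*) c) f"
    by (simp add: Const_def mult_map_scale_conv_mult)
  thus ?thesis
    by (simp add: map.rep_eq when_def)
qed

lemma lookup_Monom: "lookup (Monom m) k = (1 when m = k)"
  by (simp add: Monom_def lookup_single)

lemma keys_Const_mult: "c \<noteq> 0 \<Longrightarrow> keys (Const c * f) = keys f"
  by (auto simp: in_keys_iff lookup_Const_mult)

lemma keys_Monom [simp]: "keys (Monom m :: 'a::field mpoly) = {m}"
  by (simp add: Monom_def)

lemma lookup_Monom_mult: "lookup (Monom m * (f :: 'a::field mpoly)) (m + k) = lookup f k"
proof -
  have "Monom m * (Const c * Monom t) = single (m + t) c" for t and c :: 'a
    by (simp add: Const_def Monom_def mult_single)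
  hence "Monom m * f = (\<Sum>t\<in>keys f. single (m + t) (lookup f t))"
    by (subst mpoly_expand[of f]) (simp add: sum_distrib_left)
  thus ?thesis
    by (simp add: lookup_sum lookup_single when_def in_keys_iff)
qed

lemma keys_Monom_mult: "keys (Monom m * f) = (+) m ` keys f"
proof
  show "keys (Monom m * f) \<subseteq> (+) m ` keys f"
    using keys_mult[of "Monom m" f] by auto
  show "(+) m ` keys f \<subseteq> keys (Monom m * f)"
    by (auto simp: in_keys_iff lookup_Monom_mult)
qed

text \<open>
  Compositions of substitutions have this property as well; most arguments about the group
  action and about restrictions use nothing else.
\<close>

definition alg_hom :: "('a::field mpoly \<Rightarrow> 'a mpoly) \<Rightarrow> bool" where
  "alg_hom h \<longleftrightarrow> (\<forall>c. h (Const c) = Const c) \<and>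
     (\<forall>f g. h (f + g) = h f + h g) \<and> (\<forall>f g. h (f * g) = h f * h g)"

context
  fixes h :: "'a::field mpoly \<Rightarrow> 'a mpoly"
  assumes h: "alg_hom h"
begin

lemma alg_hom_Const: "h (Const c) = Const c"
  and alg_hom_add: "h (f + g) = h f + h g"
  and alg_hom_mult: "h (f * g) = h f * h g"
  using h by (simp_all add: alg_hom_def)

lemma alg_hom_0: "h 0 = 0"
  and alg_hom_1: "h 1 = 1"
  using alg_hom_Const[of 0] alg_hom_Const[of 1] by simp_all

lemma alg_hom_uminus: "h (- f) = - h f"
  by (metis alg_hom_0 alg_hom_add add.right_inverse minus_unique)

lemma alg_hom_diff: "h (f - g) = h f - h g"
  using alg_hom_add[of f "- g"] by (simp add: alg_hom_uminus)

lemma alg_hom_power: "h (f ^ n) = h f ^ n"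
  by (induction n) (simp_all add: alg_hom_1 alg_hom_mult)

lemma alg_hom_sum: "h (sum f A) = (\<Sum>i\<in>A. h (f i))"
  by (induction A rule: infinite_finite_induct) (simp_all add: alg_hom_0 alg_hom_add)

lemma alg_hom_prod: "h (prod f A) = (\<Prod>i\<in>A. h (f i))"
  by (induction A rule: infinite_finite_induct) (simp_all add: alg_hom_1 alg_hom_mult)

lemmas alg_hom_simps = alg_hom_Const alg_hom_add alg_hom_mult alg_hom_0 alg_hom_1 alg_hom_uminus
  alg_hom_diff alg_hom_power alg_hom_sum alg_hom_prod

lemma alg_hom_Monom: "h (Monom m) = (\<Prod>i\<in>keys m. h (Var i) ^ lookup m i)"
  by (simp add: Monom_expand alg_hom_simps)

lemma alg_hom_expand: "h f = (\<Sum>m\<in>keys f. Const (lookup f m) * h (Monom m))"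
  by (subst (1) mpoly_expand[of f]) (simp add: alg_hom_simps)

end

lemma alg_hom_comp: "alg_hom h \<Longrightarrow> alg_hom k \<Longrightarrow> alg_hom (\<lambda>f. h (k f))"
  by (simp add: alg_hom_def)

lemma alg_hom_ident: "alg_hom (\<lambda>f. f)"
  by (simp add: alg_hom_def)

lemma alg_hom_eq_on_polys:
  assumes "alg_hom h" "alg_hom k" "\<And>i. i < n \<Longrightarrow> h (Var i) = k (Var i)" "f \<in> polys n"
  shows "h f = k f"
proof -
  have "h (Monom m) = k (Monom m)" if "m \<in> keys f" for m
    unfolding alg_hom_Monom[OF assms(1)] alg_hom_Monom[OF assms(2)]
  proof (intro prod.cong refl)
    fix i assume "i \<in> keys m"
    hence "i < n" using that assms(4) by (auto simp: polys_def)
    thus "h (Var i) ^ lookup m i = k (Var i) ^ lookup m i"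
      using assms(3) by simp
  qed
  thus ?thesis
    by (simp add: alg_hom_expand[OF assms(1), of f] alg_hom_expand[OF assms(2), of f])
qed

lemma subst_superset:
  assumes "finite A" "keys f \<subseteq> A"
  shows "subst \<sigma> f = (\<Sum>m\<in>A. Const (lookup f m) *
     (\<Prod>i\<in>keys m. \<sigma> i ^ lookup m i))"
  unfolding subst_def using assms
  by (intro sum.mono_neutral_left) (auto simp: in_keys_iff)

lemma subst_add: "subst \<sigma> (f + g) = subst \<sigma> f + subst \<sigma> g"
proof -
  let ?A = "keys f \<union> keys g"
  have "keys (f + g) \<subseteq> ?A" by (rule keys_add)
  thus ?thesis
    by (simp add: subst_superset[of ?A] lookup_add Const_add distrib_right sum.distrib)
qed

lemma subst_0: "subst \<sigma> 0 = 0"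
  by (simp add: subst_def)

lemma subst_sum: "subst \<sigma> (sum f A) = (\<Sum>i\<in>A. subst \<sigma> (f i))"
  by (induction A rule: infinite_finite_induct) (simp_all add: subst_0 subst_add)

lemma subst_single: "subst \<sigma> (single m c) =
    Const c * (\<Prod>i\<in>keys m. \<sigma> i ^ lookup m i)"
  by (cases "c = 0") (simp_all add: subst_def)

lemma prod_powers_superset:
  assumes "finite A" "keys (m::monomial) \<subseteq> A"
  shows "(\<Prod>i\<in>keys m. \<sigma> i ^ lookup m i) =
         (\<Prod>i\<in>A. (\<sigma> i :: 'a::field mpoly) ^ lookup m i)"
  using assms by (intro prod.mono_neutral_left) (auto simp: in_keys_iff)

lemma subst_mult: "subst \<sigma> (f * g) = subst \<sigma> f * subst \<sigma> g"
proof -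
  have mono: "subst \<sigma> (single m c * single k d) =
      subst \<sigma> (single m c) * subst \<sigma> (single k d)" for m k c d
  proof -
    let ?A = "keys m \<union> keys k"
    have "finite ?A" by simp
    then show ?thesis
      by (simp add: mult_single subst_single Const_mult prod_powers_superset[of ?A]
          keys_monomial_add lookup_add power_add prod.distrib)
  qed
  have "f * g = (\<Sum>m\<in>keys f. \<Sum>k\<in>keys g.
      single m (lookup f m) * single k (lookup g k))"
    by (subst mpoly_expand[of f], subst mpoly_expand[of g])
       (simp add: Const_mult_Monom sum_product)
  hence "subst \<sigma> (f * g) = (\<Sum>m\<in>keys f. \<Sum>k\<in>keys g.
      subst \<sigma> (single m (lookup f m)) *
      subst \<sigma> (single k (lookup g k)))"
    by (simp add: subst_sum mono)
  thus ?thesis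
    unfolding subst_single by (simp add: subst_def[of _ f] subst_def[of _ g] sum_product)
qed

lemma subst_Const: "subst \<sigma> (Const c) = Const c"
  by (simp add: Const_def[of c] subst_single)

lemma subst_Monom: "subst \<sigma> (Monom m) = (\<Prod>i\<in>keys m. \<sigma> i ^ lookup m i)"
  by (simp add: Monom_def subst_single)

lemma subst_Var [simp]: "subst \<sigma> (Var i) = \<sigma> i"
  by (simp add: Var_def subst_Monom)

lemma alg_hom_subst: "alg_hom (subst \<sigma>)"
  by (simp add: alg_hom_def subst_Const subst_add subst_mult)

section \<open>Subalgebras\<close>

context
  fixes A :: "'a::field mpoly set"
  assumes A: "subalgebra A"
begin

lemma subalgebra_Const: "Const c \<in> A"
  and subalgebra_add: "f \<in> A \<Longrightarrow> g \<in> A \<Longrightarrow> f + g \<in> A"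
  and subalgebra_mult: "f \<in> A \<Longrightarrow> g \<in> A \<Longrightarrow> f * g \<in> A"
  using A by (auto simp: subalgebra_def)

lemma subalgebra_0: "0 \<in> A"
  and subalgebra_1: "1 \<in> A"
  using subalgebra_Const[of 0] subalgebra_Const[of 1] by simp_all

lemma subalgebra_uminus: "f \<in> A \<Longrightarrow> - f \<in> A"
  using subalgebra_mult[of "Const (- 1)" f] subalgebra_Const[of "- 1"]
  by (simp add: Const_uminus)

lemma subalgebra_diff: "f \<in> A \<Longrightarrow> g \<in> A \<Longrightarrow> f - g \<in> A"
  using subalgebra_add[of f "- g"] subalgebra_uminus[of g] by simp

lemma subalgebra_power: "f \<in> A \<Longrightarrow> f ^ n \<in> A"
  by (induction n) (auto intro: subalgebra_1 subalgebra_mult)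

lemma subalgebra_sum: "(\<And>i. i \<in> I \<Longrightarrow> f i \<in> A) \<Longrightarrow> sum f I \<in> A"
  by (induction I rule: infinite_finite_induct) (auto intro: subalgebra_0 subalgebra_add)

lemma subalgebra_prod: "(\<And>i. i \<in> I \<Longrightarrow> f i \<in> A) \<Longrightarrow> prod f I \<in> A"
  by (induction I rule: infinite_finite_induct) (auto intro: subalgebra_1 subalgebra_mult)

lemmas subalgebra_closed = subalgebra_Const subalgebra_add subalgebra_mult subalgebra_0
  subalgebra_1 subalgebra_uminus subalgebra_diff subalgebra_power subalgebra_sum subalgebra_prod

end

lemma subalgebra_Inter: "(\<And>A. A \<in> \<A> \<Longrightarrow> subalgebra A) \<Longrightarrow> subalgebra (\<Inter>\<A>)"
  by (auto simp: subalgebra_def)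

lemma subalgebra_generated: "subalgebra (generated_algebra S)"
  by (rule hull_in) (auto intro: subalgebra_Inter)

lemma polys_Const: "Const c \<in> polys n"
  by (simp add: polys_def Const_def)

lemma polys_Monom_iff: "Monom m \<in> (polys n :: 'a::field mpoly set) \<longleftrightarrow> m \<in> exps n"
  by (simp add: polys_def exps_def)

lemma polys_iff: "f \<in> polys n \<longleftrightarrow> keys f \<subseteq> exps n"
  by (auto simp: polys_def exps_def)

lemma exps_add_iff [simp]: "s + t \<in> exps n \<longleftrightarrow> s \<in> exps n \<and> t \<in> exps n"
  by (auto simp: exps_def keys_monomial_add)

lemma exps_single [simp]: "i < n \<Longrightarrow> single i k \<in> exps n"
  by (simp add: exps_def)

lemma subalgebra_polys: "subalgebra (polys n)"
  unfolding subalgebra_def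
proof (intro conjI ballI allI)
  fix f g :: "'a mpoly" assume fg: "f \<in> polys n" "g \<in> polys n"
  show "f + g \<in> polys n"
    using fg keys_add[of f g] by (auto simp: polys_iff)
  show "f * g \<in> polys n"
    using fg keys_mult[of f g] by (fastforce simp: polys_iff)
qed (rule polys_Const)

lemma polys_Var: "i < n \<Longrightarrow> Var i \<in> polys n"
  by (simp add: Var_def polys_Monom_iff)

lemma polys_subset_subalgebra:
  assumes "subalgebra A" "\<And>i. i < n \<Longrightarrow> Var i \<in> A"
  shows "polys n \<subseteq> A"
proof
  fix f :: "'a mpoly" assume f: "f \<in> polys n"
  have "Const (lookup f m) * Monom m \<in> A" if "m \<in> keys f" for m
    unfolding Monom_expand using that f assms
    by (intro subalgebra_mult[OF assms(1)] subalgebra_Const[OF assms(1)]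
        subalgebra_prod[OF assms(1)] subalgebra_power[OF assms(1)]) (auto simp: polys_def)
  thus "f \<in> A"
    by (subst mpoly_expand) (intro subalgebra_sum[OF assms(1)])
qed

text \<open>
  The image of a generated algebra is controlled by the images of its generators; this transports
  statements about \<open>F[x, h\<^sub>1, h\<^sub>2]\<close> to the plane \<open>z = 0\<close>.
\<close>

lemma alg_hom_image_generated:
  assumes h: "alg_hom h" and S: "\<And>s. s \<in> S \<Longrightarrow> h s \<in> A" and A: "subalgebra A"
    and f: "f \<in> generated_algebra S"
  shows "h f \<in> A"
proof -
  have "subalgebra {f. h f \<in> A}"
    unfolding subalgebra_def using A
    by (auto simp: alg_hom_simps[OF h] intro: subalgebra_closed)
  hence "generated_algebra S \<subseteq> {f. h f \<in> A}"
    using S by (intro hull_minimal) auto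
  thus ?thesis using f by auto
qed

section \<open>Ideals, monomial orders and lead terms\<close>

lemma generated_ideal_0: "0 \<in> generated_ideal n rs"
  unfolding generated_ideal_def
  by (rule CollectI, rule exI[of _ "\<lambda>_. 0"]) (simp add: subalgebra_0[OF subalgebra_polys])

lemma generated_ideal_add:
  assumes "f \<in> generated_ideal n rs" "g \<in> generated_ideal n rs"
  shows "f + g \<in> generated_ideal n rs"
proof -
  obtain q r where "f = (\<Sum>i<length rs. q i * rs ! i)" "\<forall>i<length rs. q i \<in> polys n"
    and "g = (\<Sum>i<length rs. r i * rs ! i)" "\<forall>i<length rs. r i \<in> polys n"
    using assms by (auto simp: generated_ideal_def)
  thus ?thesis
    unfolding generated_ideal_def
    by (intro CollectI exI[of _ "\<lambda>i. q i + r i"])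
       (auto simp: distrib_right sum.distrib intro: subalgebra_add[OF subalgebra_polys])
qed

lemma generated_ideal_mult:
  assumes "f \<in> generated_ideal n rs" "g \<in> polys n"
  shows "g * f \<in> generated_ideal n rs"
proof -
  obtain q where "f = (\<Sum>i<length rs. q i * rs ! i)" "\<forall>i<length rs. q i \<in> polys n"
    using assms by (auto simp: generated_ideal_def)
  thus ?thesis
    using assms(2) unfolding generated_ideal_def
    by (intro CollectI exI[of _ "\<lambda>i. g * q i"])
       (auto simp: sum_distrib_left mult.assoc intro: subalgebra_mult[OF subalgebra_polys])
qed

lemma generated_ideal_uminus: "f \<in> generated_ideal n rs \<Longrightarrow> - f \<in> generated_ideal n rs"
  using generated_ideal_mult[of f n rs "Const (- 1)"] polys_Const[of "- 1" n] by (simp add: Const_uminus)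

lemma generated_ideal_diff:
  "f \<in> generated_ideal n rs \<Longrightarrow> g \<in> generated_ideal n rs \<Longrightarrow> f - g \<in> generated_ideal n rs"
  using generated_ideal_add[of f n rs "- g"] generated_ideal_uminus[of g] by simp

lemma generated_ideal_sum:
  "(\<And>i. i \<in> I \<Longrightarrow> f i \<in> generated_ideal n rs) \<Longrightarrow> sum f I \<in> generated_ideal n rs"
  by (induction I rule: infinite_finite_induct) (auto intro: generated_ideal_0 generated_ideal_add)

lemma generated_ideal_member:
  assumes "R \<in> set rs" shows "R \<in> generated_ideal n rs"
proof -
  obtain i where i: "i < length rs" "rs ! i = R"
    using assms by (auto simp: in_set_conv_nth)
  have "(\<Sum>j<length rs. (if j = i then 1 else 0) * rs ! j) = (\<Sum>j<length rs. if j = i then R else 0)"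
    using i by (intro sum.cong) auto
  also have "\<dots> = R" using i by simp
  finally show ?thesis
    unfolding generated_ideal_def
    by (intro CollectI exI[of _ "\<lambda>j. if j = i then 1 else 0"])
       (auto intro: subalgebra_0[OF subalgebra_polys] subalgebra_1[OF subalgebra_polys])
qed

lemma generated_ideal_Nil: "generated_ideal n [] = {0}"
  by (auto simp: generated_ideal_def)

lemma generated_ideal_singleton: "generated_ideal n [R] = {q * R | q. q \<in> polys n}"
proof -
  have "\<exists>q. f = q 0 * R \<and> q 0 \<in> polys n" if "f = r * R" "r \<in> polys n" for f r
    using that by (intro exI[of _ "\<lambda>_. r"]) auto
  thus ?thesis by (auto simp: generated_ideal_def)
qed

lemma generated_ideal_subset:
  assumes "set rs \<subseteq> S" "0 \<in> S" "\<And>f g. f \<in> S \<Longrightarrow> g \<in> S \<Longrightarrow> f + g \<in> S"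
    "\<And>f g. f \<in> S \<Longrightarrow> g \<in> polys n \<Longrightarrow> g * f \<in> S"
  shows "generated_ideal n rs \<subseteq> S"
proof
  fix f assume "f \<in> generated_ideal n rs"
  then obtain q where f: "f = (\<Sum>i<length rs. q i * rs ! i)" and q: "\<forall>i<length rs. q i \<in> polys n"
    by (auto simp: generated_ideal_def)
  have "(\<Sum>i\<in>I. q i * rs ! i) \<in> S" if "I \<subseteq> {..<length rs}" for I
    using finite_subset[OF that finite_lessThan] that
  proof (induction I rule: finite_induct)
    case empty
    thus ?case using assms(2) by simp
  next
    case (insert i I)
    moreover have "q i * rs ! i \<in> S"
      using insert.prems q assms(1) by (intro assms(4)) (auto dest: nth_mem)
    ultimately show ?case using assms(3) by simp
  qed
  thus "f \<in> S" by (simp add: f)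
qed

lemma keys_sumD: "t \<in> keys (sum F I) \<Longrightarrow> \<exists>i\<in>I. t \<in> keys (F i)"
proof (rule ccontr)
  assume "t \<in> keys (sum F I)" "\<not> (\<exists>i\<in>I. t \<in> keys (F i))"
  thus False by (simp add: in_keys_iff lookup_sum)
qed

text \<open>
  An order on all monomials that is compatible with products and has finite initial segments among
  the monomials in \<open>n\<close> variables. It is used for the lead monomials in \<open>x, y, z\<close> and, with
  another order, for the ideal of relations in five variables.
\<close>

locale monomial_order =
  fixes n :: nat and less :: "monomial \<Rightarrow> monomial \<Rightarrow> bool" (infix "\<sqsubset>" 50)
  assumes irrefl: "\<not> s \<sqsubset> s"
    and trans: "s \<sqsubset> t \<Longrightarrow> t \<sqsubset> u \<Longrightarrow> s \<sqsubset> u"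
    and total: "s \<noteq> t \<Longrightarrow> s \<sqsubset> t \<or> t \<sqsubset> s"
    and add_mono: "s \<sqsubset> t \<Longrightarrow> s + u \<sqsubset> t + u"
    and finite_below: "t \<in> exps n \<Longrightarrow> finite {s \<in> exps n. s \<sqsubset> t}"
begin

lemma exps_induct [consumes 1, case_names less]:
  assumes "t \<in> exps n"
    and "\<And>t. t \<in> exps n \<Longrightarrow> (\<And>s. s \<in> exps n \<Longrightarrow> s \<sqsubset> t \<Longrightarrow> P s) \<Longrightarrow> P t"
  shows "P t"
  using assms(1)
proof (induction "card {s \<in> exps n. s \<sqsubset> t}" arbitrary: t rule: less_induct)
  case less
  show ?case
  proof (rule assms(2)[OF less.prems])
    fix s assume s: "s \<in> exps n" "s \<sqsubset> t"
    have "{r \<in> exps n. r \<sqsubset> s} \<subset> {s \<in> exps n. s \<sqsubset> t}"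
      using s irrefl trans by blast
    hence "card {r \<in> exps n. r \<sqsubset> s} < card {s \<in> exps n. s \<sqsubset> t}"
      using finite_below less.prems by (intro psubset_card_mono)
    thus "P s"
      using less.hyps s by blast
  qed
qed

definition is_lead :: "'a::field mpoly \<Rightarrow> monomial \<Rightarrow> bool" where
  "is_lead f m \<longleftrightarrow> m \<in> keys f \<and> (\<forall>t\<in>keys f. t \<noteq> m \<longrightarrow> t \<sqsubset> m)"

lemma finite_has_max: "finite S \<Longrightarrow> S \<noteq> {} \<Longrightarrow> \<exists>m\<in>S. \<forall>t\<in>S. t \<noteq> m \<longrightarrow> t \<sqsubset> m"
proof (induction S rule: finite_ne_induct)
  case (insert x S)
  then obtain m where m: "m \<in> S" "\<forall>t\<in>S. t \<noteq> m \<longrightarrow> t \<sqsubset> m" by blast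
  have "x \<noteq> m" using insert.hyps(3) m(1) by blast
  show ?case
  proof (cases "x \<sqsubset> m")
    case True thus ?thesis using m by blast
  next
    case False
    hence mx: "m \<sqsubset> x" using total[OF \<open>x \<noteq> m\<close>] by simp
    have "t \<sqsubset> x" if "t \<in> S" for t
      using m(2) that mx trans[of t m x] by (cases "t = m") auto
    thus ?thesis by blast
  qed
qed auto

lemma ex_lead: "f \<noteq> 0 \<Longrightarrow> \<exists>m. is_lead f m"
  unfolding is_lead_def using finite_has_max[of "keys f"] by auto

lemma lead_unique: "is_lead f m \<Longrightarrow> is_lead f k \<Longrightarrow> m = k"
  unfolding is_lead_def using irrefl[of m] trans[of m k m] by metis

lemma add_mono2: "s \<sqsubset> t \<Longrightarrow> u \<sqsubset> v \<Longrightarrow> s + u \<sqsubset> t + v"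
  using add_mono[of s t u] add_mono[of u v t] trans[of "s + u" "t + u" "t + v"]
  by (simp add: add.commute)

text \<open>
  The sum of the two lead monomials arises from no other pair of monomials, because the order is
  compatible with products; hence no cancellation occurs.
\<close>

lemma lead_mult:
  fixes f g :: "'a::field mpoly"
  assumes f: "is_lead f m" and g: "is_lead g k"
  shows "is_lead (f * g) (m + k)"
    and "lookup (f * g) (m + k) = lookup f m * lookup g k"
proof -
  have uniq: "s + t \<sqsubset> m + k" if "s \<in> keys f" "t \<in> keys g" "(s, t) \<noteq> (m, k)" for s t
  proof -
    have "s = m \<or> s \<sqsubset> m" "t = k \<or> t \<sqsubset> k"
      using that(1,2) f g by (auto simp: is_lead_def)
    thus ?thesis
      using that(3) add_mono[of t k m] add_mono[of s m k] add_mono2[of s m t k]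
      by (auto simp: add.commute)
  qed
  have "f * g = (\<Sum>s\<in>keys f. \<Sum>t\<in>keys g.
      single (s + t) (lookup f s * lookup g t))"
    by (subst mpoly_expand[of f], subst mpoly_expand[of g])
       (simp add: Const_mult_Monom sum_product mult_single)
  hence "lookup (f * g) (m + k) = (\<Sum>s\<in>keys f. \<Sum>t\<in>keys g.
      (lookup f s * lookup g t when s + t = m + k))"
    by (simp add: lookup_sum lookup_single)
  also have "\<dots> = (\<Sum>s\<in>keys f. \<Sum>t\<in>keys g.
      (if s = m then if t = k then lookup f m * lookup g k else 0 else 0))"
  proof (intro sum.cong refl)
    fix s t assume st: "s \<in> keys f" "t \<in> keys g"
    show "(lookup f s * lookup g t when s + t = m + k) =
        (if s = m then if t = k then lookup f m * lookup g k else 0 else 0)"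
    proof (cases "(s, t) = (m, k)")
      case False
      hence "s + t \<noteq> m + k" using uniq[OF st] irrefl by metis
      thus ?thesis using False by auto
    qed simp
  qed
  also have "\<dots> = (\<Sum>s\<in>keys f.
      if s = m then lookup f m * lookup g k else 0)"
    using g by (intro sum.cong refl) (auto simp: is_lead_def)
  also have "\<dots> = lookup f m * lookup g k"
    using f by (simp add: is_lead_def)
  finally show lk: "lookup (f * g) (m + k) = lookup f m * lookup g k" .
  show "is_lead (f * g) (m + k)"
    unfolding is_lead_def
  proof (intro conjI ballI impI)
    show "m + k \<in> keys (f * g)"
      using f g by (simp add: in_keys_iff lk is_lead_def)
    fix u assume u: "u \<in> keys (f * g)" "u \<noteq> m + k"
    then obtain s t where "u = s + t" "s \<in> keys f" "t \<in> keys g"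
      using keys_mult[of f g] by blast
    thus "u \<sqsubset> m + k" using uniq u(2) by auto
  qed
qed

lemma lead_add_smaller:
  assumes "is_lead f m" "\<And>t. t \<in> keys g \<Longrightarrow> t \<sqsubset> m"
  shows "is_lead (f + g) m" "lookup (f + g) m = lookup f m"
proof -
  have "m \<notin> keys g" using assms(2) irrefl by blast
  thus *: "lookup (f + g) m = lookup f m"
    by (simp add: lookup_add in_keys_iff)
  show "is_lead (f + g) m"
    using assms * keys_add[of f g] by (auto simp: is_lead_def in_keys_iff)
qed

lemma lead_Monom: "is_lead (Monom m) m"
  by (simp add: is_lead_def)

lemma lead_Const_mult: "c \<noteq> 0 \<Longrightarrow> is_lead (Const c * f) m \<longleftrightarrow> is_lead f m"
  by (simp add: is_lead_def keys_Const_mult)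

lemma lead_diff_smaller:
  assumes "is_lead f m" "is_lead g m" "lookup f m = lookup g m"
    "t \<in> keys (f - g)"
  shows "t \<sqsubset> m"
proof -
  have "t \<noteq> m" using assms by (auto simp: in_keys_iff lookup_minus)
  moreover have "t \<in> keys f \<or> t \<in> keys g"
    using assms(4) by (auto simp: in_keys_iff lookup_minus)
  ultimately show ?thesis using assms by (auto simp: is_lead_def)
qed

text \<open>
  Division with remainder. A monomial that is divisible by a lead monomial is replaced by strictly
  smaller ones, and finite initial segments make this terminate.
\<close>

lemma reduce_Monom_modulo:
  fixes rs :: "'a::field mpoly list"
  assumes rs: "set rs \<subseteq> polys n" and K: "K \<in> exps n"
  shows "\<exists>f\<in>polys n. Monom K - f \<in> generated_ideal n rs \<and>
     (\<forall>t\<in>keys f. \<forall>R\<in>set rs. \<forall>m. is_lead R m \<longrightarrow> (\<forall>L. t \<noteq> m + L))"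
  (is "\<exists>f\<in>polys n. _ \<and> ?normal f")
  using K
proof (induction K rule: exps_induct)
  case (less K)
  show ?case
  proof (cases "\<exists>R\<in>set rs. \<exists>m L. is_lead R m \<and> K = m + L")
    case False
    thus ?thesis
      using less.hyps by (intro bexI[of _ "Monom K"]) (auto simp: generated_ideal_0 polys_Monom_iff)
  next
    case True
    then obtain R m L where R: "R \<in> set rs" "is_lead R m" "K = m + L" by blast
    define c where "c = lookup R m"
    have c: "c \<noteq> 0" using R by (auto simp: c_def is_lead_def in_keys_iff)
    define S where "S = Const (inverse c) * Monom L * R"
    have S_ideal: "S \<in> generated_ideal n rs"
      unfolding S_def using less.hyps R
      by (intro generated_ideal_mult generated_ideal_member subalgebra_mult[OF subalgebra_polys])
         (auto simp: polys_Const polys_Monom_iff)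
    have S_polys: "S \<in> polys n"
      unfolding S_def using less.hyps R rs
      by (intro subalgebra_mult[OF subalgebra_polys]) (auto simp: polys_Const polys_Monom_iff)
    have lead: "is_lead S K" "lookup S K = 1"
      using lead_mult[OF lead_Monom[of L, where 'a='a] R(2)] c
      by (auto simp: S_def mult.assoc lead_Const_mult lookup_Const_mult R(3) add.commute[of L]
          lookup_Monom c_def)
    define g where "g = Monom K - S"
    have g_polys: "g \<in> polys n"
      unfolding g_def using less.hyps S_polys
      by (intro subalgebra_diff[OF subalgebra_polys]) (auto simp: polys_Monom_iff)
    have "t \<sqsubset> K" if "t \<in> keys g" for t
      using lead_diff_smaller[OF lead_Monom lead(1), of t] that lead(2)
      by (simp add: g_def lookup_Monom)
    hence "\<exists>f\<in>polys n. Monom t - f \<in> generated_ideal n rs \<and> ?normal f" if "t \<in> keys g" for t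
      using less.IH that g_polys by (auto simp: polys_iff)
    then obtain F where F: "\<And>t. t \<in> keys g \<Longrightarrow>
        F t \<in> polys n \<and> Monom t - F t \<in> generated_ideal n rs \<and> ?normal (F t)"
      by metis
    define f where "f = (\<Sum>t\<in>keys g. Const (lookup g t) * F t)"
    have "f \<in> polys n"
      unfolding f_def using F
      by (intro subalgebra_sum[OF subalgebra_polys] subalgebra_mult[OF subalgebra_polys])
         (auto simp: polys_Const)
    moreover have "?normal f"
    proof (intro ballI)
      fix t R assume t: "t \<in> keys f" and R: "R \<in> set rs"
      obtain u where "u \<in> keys g" "t \<in> keys (Const (lookup g u) * F u)"
        using t unfolding f_def by (blast dest: keys_sumD)
      thus "\<forall>m. is_lead R m \<longrightarrow> (\<forall>L. t \<noteq> m + L)"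
        using F[of u] R by (auto simp: in_keys_iff lookup_Const_mult)
    qed
    moreover have "Monom K - f \<in> generated_ideal n rs"
    proof -
      have "g - f = (\<Sum>t\<in>keys g. Const (lookup g t) * (Monom t - F t))"
        unfolding f_def by (subst (1) mpoly_expand[of g]) (simp add: sum_subtractf right_diff_distrib)
      also have "\<dots> \<in> generated_ideal n rs"
        using F by (intro generated_ideal_sum generated_ideal_mult) (auto simp: polys_Const)
      finally have "S + (g - f) \<in> generated_ideal n rs"
        using S_ideal generated_ideal_add by blast
      thus ?thesis by (simp add: g_def)
    qed
    ultimately show ?thesis by blast
  qed
qed

lemma reduce_modulo:
  fixes rs :: "'a::field mpoly list"
  assumes rs: "set rs \<subseteq> polys n" and f: "f \<in> polys n"
  shows "\<exists>r\<in>polys n. f - r \<in> generated_ideal n rs \<and>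
     (\<forall>t\<in>keys r. \<forall>R\<in>set rs. \<forall>m. is_lead R m \<longrightarrow> (\<forall>L. t \<noteq> m + L))"
  (is "\<exists>r\<in>polys n. _ \<and> ?normal r")
proof -
  have "\<exists>r\<in>polys n. Monom t - r \<in> generated_ideal n rs \<and> ?normal r" if "t \<in> keys f" for t
    using reduce_Monom_modulo[OF rs] that f by (auto simp: polys_iff)
  then obtain F where F: "\<And>t. t \<in> keys f \<Longrightarrow>
      F t \<in> polys n \<and> Monom t - F t \<in> generated_ideal n rs \<and> ?normal (F t)"
    by metis
  define r where "r = (\<Sum>t\<in>keys f. Const (lookup f t) * F t)"
  have "r \<in> polys n"
    unfolding r_def using F
    by (intro subalgebra_sum[OF subalgebra_polys] subalgebra_mult[OF subalgebra_polys])
       (auto simp: polys_Const)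
  moreover have "?normal r"
  proof (intro ballI)
    fix t R assume t: "t \<in> keys r" and R: "R \<in> set rs"
    obtain u where "u \<in> keys f" "t \<in> keys (Const (lookup f u) * F u)"
      using t unfolding r_def by (blast dest: keys_sumD)
    thus "\<forall>m. is_lead R m \<longrightarrow> (\<forall>L. t \<noteq> m + L)"
      using F[of u] R by (auto simp: in_keys_iff lookup_Const_mult)
  qed
  moreover have "f - r \<in> generated_ideal n rs"
  proof -
    have "f - r = (\<Sum>t\<in>keys f. Const (lookup f t) * (Monom t - F t))"
      unfolding r_def by (subst (1) mpoly_expand[of f]) (simp add: sum_subtractf right_diff_distrib)
    also have "\<dots> \<in> generated_ideal n rs"
      using F by (intro generated_ideal_sum generated_ideal_mult) (auto simp: polys_Const)
    finally show ?thesis .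
  qed
  ultimately show ?thesis by blast
qed

text \<open>
  If \<open>q R\<^sub>2\<close> is a multiple of \<open>R\<^sub>1\<close>, so is \<open>r R\<^sub>2\<close> for the remainder \<open>r\<close> of \<open>q\<close> modulo \<open>R\<^sub>1\<close>. For
  nonzero \<open>r\<close> the lead monomial of \<open>R\<^sub>1\<close> would divide that of \<open>r R\<^sub>2\<close>, and by coprimality that of \<open>r\<close>.
\<close>

lemma regular_sequence_coprime_leads:
  fixes R1 R2 :: "'a::field mpoly"
  assumes polys: "R1 \<in> polys n" "R2 \<in> polys n"
    and lead: "is_lead R1 m1" "is_lead R2 m2"
    and coprime: "keys m1 \<inter> keys m2 = {}"
    and proper: "1 \<notin> generated_ideal n [R1, R2]"
  shows "regular_sequence n [R1, R2]"
proof -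
  have nz: "R1 \<noteq> 0" "R2 \<noteq> 0" using lead by (auto simp: is_lead_def)
  have "q \<in> generated_ideal n [R1]" if q: "q \<in> polys n" "q * R2 \<in> generated_ideal n [R1]" for q
  proof -
    obtain r where r: "r \<in> polys n" "q - r \<in> generated_ideal n [R1]"
      and normal: "\<And>t L. t \<in> keys r \<Longrightarrow> t \<noteq> m1 + L"
      using reduce_modulo[of "[R1]" q] polys q lead by auto
    have "r = 0"
    proof (rule ccontr)
      assume "r \<noteq> 0"
      then obtain k where k: "is_lead r k" using ex_lead by blast
      have "r * R2 = q * R2 - R2 * (q - r)" by (simp add: algebra_simps)
      also have "\<dots> \<in> generated_ideal n [R1]"
        by (intro generated_ideal_diff q(2) generated_ideal_mult[OF r(2) polys(2)])
      finally obtain s where s: "r * R2 = s * R1" by (auto simp: generated_ideal_singleton)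
      have "s \<noteq> 0" using s \<open>r \<noteq> 0\<close> nz by auto
      then obtain j where j: "is_lead s j" using ex_lead by blast
      have eq: "k + m2 = j + m1"
        using lead_mult(1)[OF k lead(2)] lead_mult(1)[OF j lead(1)] s lead_unique by metis
      have "k = m1 + (k - m1)"
      proof (rule poly_mapping_eqI)
        fix i
        have "lookup k i + lookup m2 i = lookup j i + lookup m1 i"
          using arg_cong[OF eq, of "\<lambda>m. lookup m i"] by (simp add: lookup_add)
        moreover have "lookup m1 i = 0 \<or> lookup m2 i = 0"
          using coprime by (auto simp: in_keys_iff)
        ultimately show "lookup k i = lookup (m1 + (k - m1)) i"
          by (auto simp: lookup_add minus_poly_mapping.rep_eq)
      qed
      thus False using normal k by (auto simp: is_lead_def)
    qed
    thus ?thesis using r by simp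
  qed
  thus ?thesis
    unfolding regular_sequence_def using polys proper nz
    by (auto simp: less_Suc_eq generated_ideal_Nil)
qed

end

subsection \<open>The graded reverse lexicographic order\<close>

lemma total_deg_superset:
  assumes "finite A" "keys m \<subseteq> A"
  shows "total_deg m = (\<Sum>i\<in>A. lookup m i)"
  unfolding total_deg_def using assms by (intro sum.mono_neutral_left) (auto simp: in_keys_iff)

lemma total_deg_add: "total_deg (s + t) = total_deg s + total_deg t"
  by (simp add: total_deg_superset[of "keys s \<union> keys t"]
      keys_monomial_add lookup_add sum.distrib)

lemma total_deg_single [simp]: "total_deg (single i k) = k"
  by (simp add: total_deg_def)

lemma total_deg_0 [simp]: "total_deg 0 = 0"
  by (simp add: total_deg_def)

lemma lookup_le_total_deg: "lookup m i \<le> total_deg m"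
  by (subst total_deg_superset[of "insert i (keys m)"]) (auto intro!: member_le_sum)

lemma finite_exps_total_deg: "finite {m \<in> exps n. total_deg m \<le> d}"
proof -
  have "lookup ` {m \<in> exps n. total_deg m \<le> d} \<subseteq>
      {f. \<forall>x. (x \<in> {..<n} \<longrightarrow> f x \<in> {..d}) \<and> (x \<notin> {..<n} \<longrightarrow> f x = 0)}"
    using order.trans[OF lookup_le_total_deg] by (auto simp: exps_def in_keys_iff)
  hence "finite (lookup ` {m \<in> exps n. total_deg m \<le> d})"
    by (rule finite_subset) (intro finite_set_of_finite_funs; simp)
  thus ?thesis
    by (rule finite_imageD) (auto intro!: inj_onI poly_mapping_eqI)
qed

interpretation grevlex: monomial_order n grevlex_less
proof
  show "\<not> grevlex_less s s" for s by (auto simp: grevlex_less_def)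
  show "grevlex_less s u" if st: "grevlex_less s t" and tu: "grevlex_less t u" for s t u
  proof -
    have "total_deg s \<le> total_deg t" "total_deg t \<le> total_deg u"
      using st tu by (auto simp: grevlex_less_def)
    then consider "total_deg s < total_deg u"
      | "total_deg s = total_deg t" "total_deg t = total_deg u"
      by linarith
    thus ?thesis
    proof cases
      case 2
      then obtain i j where i: "lookup s i > lookup t i"
          "\<forall>k<i. lookup s k = lookup t k"
        and j: "lookup t j > lookup u j"
          "\<forall>k<j. lookup t k = lookup u k"
        using st tu by (auto simp: grevlex_less_def)
      have "lookup s (min i j) > lookup u (min i j) \<and>
          (\<forall>k<min i j. lookup s k = lookup u k)"
        using i j by (cases i j rule: linorder_cases) auto
      thus ?thesis using 2 by (auto simp: grevlex_less_def)
    qed (auto simp: grevlex_less_def)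
  qed
  show "grevlex_less s t \<or> grevlex_less t s" if "s \<noteq> t" for s t
  proof -
    define i where "i = (LEAST i. lookup s i \<noteq> lookup t i)"
    have "\<exists>i. lookup s i \<noteq> lookup t i"
      using that by (auto intro: poly_mapping_eqI)
    hence "lookup s i \<noteq> lookup t i"
      unfolding i_def by (rule LeastI_ex)
    moreover have "\<forall>j<i. lookup s j = lookup t j"
      unfolding i_def by (auto dest: not_less_Least)
    ultimately show ?thesis
      unfolding grevlex_less_def by (metis linorder_cases)
  qed
  show "grevlex_less (s + u) (t + u)" if "grevlex_less s t" for s t u
    using that by (auto simp: grevlex_less_def total_deg_add lookup_add)
  show "finite {s \<in> exps n. grevlex_less s t}" for t
    by (rule finite_subset[OF _ finite_exps_total_deg[of n "total_deg t"]])
       (auto simp: grevlex_less_def)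
qed

lemma grevlex_total_deg_le: "grevlex_less s t \<Longrightarrow> total_deg s \<le> total_deg t"
  by (auto simp: grevlex_less_def)

abbreviation is_LM :: "'a::field mpoly \<Rightarrow> monomial \<Rightarrow> bool" where
  "is_LM \<equiv> monomial_order.is_lead grevlex_less"

lemma LM_eqI: "is_LM f m \<Longrightarrow> LM f = m"
proof -
  assume m: "is_LM f m"
  have "LM f = (THE m. is_LM f m)"
    by (simp add: LM_def grevlex.is_lead_def)
  also have "\<dots> = m"
    using m by (rule the_equality) (metis m grevlex.lead_unique)
  finally show ?thesis .
qed

lemma is_LM_LM: "f \<noteq> 0 \<Longrightarrow> is_LM f (LM f)"
  using grevlex.ex_lead LM_eqI by blast

lemma LM_in_keys: "f \<noteq> 0 \<Longrightarrow> LM f \<in> keys f"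
  using is_LM_LM unfolding grevlex.is_lead_def by blast

lemma LC_nonzero: "f \<noteq> 0 \<Longrightarrow> LC f \<noteq> 0"
  using LM_in_keys[of f] by (simp add: LC_def in_keys_iff)

lemma total_deg_le_LM: "t \<in> keys f \<Longrightarrow> total_deg t \<le> total_deg (LM f)"
proof -
  assume t: "t \<in> keys f"
  hence "f \<noteq> 0" by auto
  hence "t = LM f \<or> grevlex_less t (LM f)"
    using is_LM_LM[of f] t by (auto simp: grevlex.is_lead_def)
  thus ?thesis using grevlex_total_deg_le by auto
qed

lemma LM_mult: "f \<noteq> 0 \<Longrightarrow> g \<noteq> 0 \<Longrightarrow> LM (f * g) = LM f + LM g"
  by (intro LM_eqI grevlex.lead_mult is_LM_LM)

lemma LC_mult: "f \<noteq> 0 \<Longrightarrow> g \<noteq> 0 \<Longrightarrow> LC (f * g) = LC f * LC g"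
  using grevlex.lead_mult(2)[OF is_LM_LM is_LM_LM, of f g] by (simp add: LC_def LM_mult)

lemma LM_Monom [simp]: "LM (Monom m) = m"
  by (intro LM_eqI grevlex.lead_Monom)

lemma LM_1 [simp]: "LM 1 = 0"
  using LM_Monom[of 0] by simp

lemma LC_1 [simp]: "LC 1 = 1"
  by (simp add: LC_def)

lemma LM_power: "f \<noteq> 0 \<Longrightarrow> lookup (LM (f ^ k)) i = k * lookup (LM f) i"
  by (induction k) (simp_all add: LM_mult lookup_add)

lemma LC_power: "f \<noteq> 0 \<Longrightarrow> LC (f ^ k) = LC f ^ k"
  by (induction k) (simp_all add: LC_mult)

lemma LM_Const_mult: "c \<noteq> 0 \<Longrightarrow> f \<noteq> 0 \<Longrightarrow> LM (Const c * f) = LM f"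
  by (intro LM_eqI) (simp add: grevlex.lead_Const_mult is_LM_LM)

lemma LC_Const_mult: "c \<noteq> 0 \<Longrightarrow> f \<noteq> 0 \<Longrightarrow> LC (Const c * f) = c * LC f"
  by (simp add: LC_def lookup_Const_mult LM_Const_mult)

section \<open>Minors and the action of the group\<close>

lemma freshmans_diff:
  fixes x y :: "'b::comm_ring_1"
  assumes "prime CHAR('b)"
  shows "(x - y) ^ (CHAR('b) ^ k) = x ^ (CHAR('b) ^ k) - y ^ (CHAR('b) ^ k)"
  using freshmans_dream'[OF assms refl, of "x - y" y k] by (simp add: algebra_simps)

lemma of_nat_power_CHAR:
  assumes "prime CHAR('b::comm_ring_1)"
  shows "(of_nat m :: 'b) ^ (CHAR('b) ^ k) = of_nat m"
  using prime_gt_0_nat[OF assms] by (induction m) (simp_all add: freshmans_dream'[OF assms refl] zero_power)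

lemma det_4:
  "Determinants.det (A::'b::comm_ring_1^4^4) = (let a = (\<lambda>i j. vec_nth (vec_nth A i) j);
      m = (\<lambda>i j k l. a 1 i * a 2 j * a 3 k * a 4 l) in
      m 1 2 3 4 - m 1 2 4 3 - m 1 3 2 4 + m 1 3 4 2 + m 1 4 2 3 - m 1 4 3 2
    - m 2 1 3 4 + m 2 1 4 3 + m 2 3 1 4 - m 2 3 4 1 - m 2 4 1 3 + m 2 4 3 1
    + m 3 1 2 4 - m 3 1 4 2 - m 3 2 1 4 + m 3 2 4 1 + m 3 4 1 2 - m 3 4 2 1
    - m 4 1 2 3 + m 4 1 3 2 + m 4 2 1 3 - m 4 2 3 1 - m 4 3 1 2 + m 4 3 2 1)"
proof -
  have f1234: "finite {2::4, 3, 4}" "1 \<notin> {2::4, 3, 4}"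
    and f234: "finite {3::4, 4}" "2 \<notin> {3::4, 4}"
    and f34: "finite {4::4}" "3 \<notin> {4::4}"
    by auto
  show ?thesis
    unfolding Let_def Determinants.det_def UNIV_4
    unfolding sum_over_permutations_insert[OF f1234]
    unfolding sum_over_permutations_insert[OF f234]
    unfolding sum_over_permutations_insert[OF f34]
    unfolding permutes_sing
    by (simp add: sign_swap_id permutation_swap_id permutation_compose sign_compose sign_id swap_id_eq
        algebra_simps)
qed

lemma vector_4:
  "vec_nth (vector [a, b, c, d] :: 'b::zero^4) 1 = a"
  "vec_nth (vector [a, b, c, d] :: 'b::zero^4) 2 = b"
  "vec_nth (vector [a, b, c, d] :: 'b::zero^4) 3 = c"
  "vec_nth (vector [a, b, c, d] :: 'b::zero^4) 4 = d"
  by (simp_all add: vector_def)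

text \<open>
  Five vectors in a four-dimensional space are dependent, with the minors as coefficients (expand
  the vanishing \<open>5 \<times> 5\<close> determinant in which the \<open>j\<close>-th coordinates occur twice).
\<close>

lemma five_vectors_relation:
  fixes a b c d e :: "'b::comm_ring_1^4"
  shows "vec_nth a j * Determinants.det (vector [b, c, d, e] :: 'b^4^4) - vec_nth b j * Determinants.det (vector [a, c, d, e] :: 'b^4^4)
    + vec_nth c j * Determinants.det (vector [a, b, d, e] :: 'b^4^4) - vec_nth d j * Determinants.det (vector [a, b, c, e] :: 'b^4^4)
    + vec_nth e j * Determinants.det (vector [a, b, c, d] :: 'b^4^4) = 0"
  using exhaust_4[of j] unfolding det_4 Let_def vector_4
  by (elim disjE) (simp_all add: algebra_simps)

lemma alg_hom_eqI:
  assumes "alg_hom h" "alg_hom k" "\<And>i. h (Var i) = k (Var i)"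
  shows "h f = k f"
  unfolding alg_hom_expand[OF assms(1), of f] alg_hom_expand[OF assms(2), of f]
    alg_hom_Monom[OF assms(1)] alg_hom_Monom[OF assms(2)] assms(3) ..

text \<open>
  The action of the group element with coordinates \<open>\<alpha>\<close>, \<open>\<beta>\<close>. In this parametrization composition is
  addition, see \<open>shear_add\<close>.
\<close>

definition shear :: "'a::field \<Rightarrow> 'a \<Rightarrow> 'a mpoly \<Rightarrow> 'a mpoly" where
  "shear \<alpha> \<beta> = subst (Var(1 := Y + Const \<alpha> * X, 2 := Z + Const (2 * \<alpha>) * Y + Const (\<alpha>\<^sup>2 + \<beta>) * X))"

lemma alg_hom_shear: "alg_hom (shear \<alpha> \<beta>)"
  unfolding shear_def by (rule alg_hom_subst)

lemma shear_numeral: "shear \<alpha> \<beta> (numeral k) = numeral k"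
  using alg_hom_Const[OF alg_hom_shear, of \<alpha> \<beta> "numeral k"] by (simp add: Const_numeral)

lemmas shear_simps = alg_hom_simps[OF alg_hom_shear] shear_numeral

lemma shear_Var:
  "shear \<alpha> \<beta> (Var i) = (if i = 1 then Y + Const \<alpha> * X
     else if i = 2 then Z + Const (2 * \<alpha>) * Y + Const (\<alpha>\<^sup>2 + \<beta>) * X else Var i)"
  by (simp add: shear_def)

lemma shear_add: "shear \<alpha> \<beta> (shear \<alpha>' \<beta>' f) = shear (\<alpha> + \<alpha>') (\<beta> + \<beta>') f"
  by (rule alg_hom_eqI[OF alg_hom_comp[OF alg_hom_shear alg_hom_shear] alg_hom_shear])
     (auto simp: shear_Var shear_simps Const_add Const_mult Const_numeral power2_eq_square algebra_simps)

lemma shear_0: "shear 0 0 f = f"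
  by (rule alg_hom_eqI[OF alg_hom_shear alg_hom_ident]) (simp add: shear_Var)

lemma shear_funpow: "(shear \<alpha> \<beta> ^^ k) f = shear (of_nat k * \<alpha>) (of_nat k * \<beta>) f"
  by (induction k) (simp_all add: shear_0 shear_add algebra_simps)

lemma shear_delta: "shear \<alpha> \<beta> delta = delta - Const \<beta> * X ^ 2"
  by (simp add: delta_def shear_simps shear_Var Const_add Const_mult Const_numeral power2_eq_square algebra_simps)

lemma shear_polys: "f \<in> polys 3 \<Longrightarrow> shear \<alpha> \<beta> f \<in> polys 3"
proof -
  have "polys 3 \<subseteq> {f. shear \<alpha> \<beta> f \<in> polys 3}"
  proof (rule polys_subset_subalgebra)
    show "subalgebra {f. shear \<alpha> \<beta> f \<in> polys 3}"
      by (auto simp: subalgebra_def shear_simps subalgebra_closed[OF subalgebra_polys])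
    show "Var i \<in> {f. shear \<alpha> \<beta> f \<in> polys 3}" if "i < 3" for i
      using that by (auto simp: shear_Var
        intro!: subalgebra_add[OF subalgebra_polys] subalgebra_mult[OF subalgebra_polys] polys_Const polys_Var)
  qed
  thus "f \<in> polys 3 \<Longrightarrow> shear \<alpha> \<beta> f \<in> polys 3" by auto
qed

lemma delta_polys: "delta \<in> polys 3"
  by (simp add: delta_def subalgebra_closed[OF subalgebra_polys] polys_Var)

locale rank_four =
  fixes p :: nat and M :: "'a::field^4^2"
  assumes prime_p: "prime p" and p_gt_2: "p > 2" and char_p: "CHAR('a) = p"
    and minor_1234: "minor p M 1 2 3 4 = 0"
    and minor_1235: "minor p M 1 2 3 5 \<noteq> 0"
    and minor_1357: "minor p M 1 3 5 7 \<noteq> 0"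
begin

lemma prime_CHAR: "prime CHAR('a)" "prime CHAR('a mpoly)"
  using prime_p by (simp_all add: char_p CHAR_mpoly)

lemma two_nonzero: "(2 :: 'a) \<noteq> 0"
proof
  assume "(2 :: 'a) = 0"
  hence "of_nat 2 = (0 :: 'a)" by simp
  hence "p dvd 2" by (simp only: of_nat_eq_0_iff_char_dvd char_p)
  thus False using p_gt_2 dvd_imp_le by fastforce
qed

lemma odd_p: "odd p"
  using prime_p p_gt_2 prime_odd_nat by blast

lemmas frobenius = freshmans_dream'[OF prime_CHAR(2)] freshmans_diff[OF prime_CHAR(2)]

text \<open>
  Up to signs, \<open>u, v, w\<close> are the coefficients of \<open>h\<^sub>1\<close> and \<open>a, b, c, d\<close> those of \<open>h\<^sub>2\<close>.
\<close>

definition u where "u = minor p M 1 2 4 5 / minor p M 1 2 3 5"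
definition v where "v = minor p M 1 3 4 5 / minor p M 1 2 3 5"
definition w where "w = minor p M 2 3 4 5 / minor p M 1 2 3 5"
definition a where "a = minor p M 1 3 5 7 / minor p M 1 2 3 5"
definition b where "b = minor p M 1 2 3 7 / minor p M 1 2 3 5"
definition c where "c = minor p M 1 2 5 7 / minor p M 1 2 3 5"
definition d where "d = minor p M 2 3 5 7 / minor p M 1 2 3 5"

lemma a_nonzero: "a \<noteq> 0"
  using minor_1235 minor_1357 by (simp add: a_def)

text \<open>The coordinates \<open>\<alpha>\<close>, \<open>\<beta>\<close> of the shear by which a group element acts.\<close>

definition alpha :: "(4 \<Rightarrow> int) \<Rightarrow> 'a" where
  "alpha g = (\<Sum>j\<in>UNIV. of_int (g j) * vec_nth (vec_nth M 1) j)"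
definition beta :: "(4 \<Rightarrow> int) \<Rightarrow> 'a" where
  "beta g = (\<Sum>j\<in>UNIV. of_int (g j) * vec_nth (vec_nth M 2) j)"

abbreviation E :: "(4 \<Rightarrow> int) set" where "E \<equiv> carrier (E_group p)"

lemma E_iff: "g \<in> E \<longleftrightarrow> (\<forall>j. 0 \<le> g j \<and> g j < int p)"
  using p_gt_2 by (simp add: E_group_def carrier_integer_mod_group PiE_iff)

lemma act_eq_shear: "g \<in> E \<Longrightarrow> act M g = shear (alpha g) (beta g)"
proof
  fix f assume g: "g \<in> E"
  have gen: "act_gen M j = shear (vec_nth (vec_nth M 1) j) (vec_nth (vec_nth M 2) j)" for j
    by (simp add: act_gen_def shear_def)
  have nat: "of_nat (nat (g j)) = (of_int (g j) :: 'a)" for j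
    using g by (simp add: E_iff)
  show "act M g f = shear (alpha g) (beta g) f"
    by (simp add: act_def gen shear_funpow shear_add nat alpha_def beta_def sum_4 add_ac)
qed

lemma minor_relation:
  "vec_nth (Gamma_row p M i1) j * minor p M i2 i3 i4 i5 - vec_nth (Gamma_row p M i2) j * minor p M i1 i3 i4 i5
   + vec_nth (Gamma_row p M i3) j * minor p M i1 i2 i4 i5 - vec_nth (Gamma_row p M i4) j * minor p M i1 i2 i3 i5
   + vec_nth (Gamma_row p M i5) j * minor p M i1 i2 i3 i4 = 0"
  unfolding minor_def by (rule five_vectors_relation)

lemma Gamma_row_nth:
  "vec_nth (Gamma_row p M 1) j = vec_nth (vec_nth M 1) j"
  "vec_nth (Gamma_row p M 2) j = vec_nth (vec_nth M 2) j"
  "vec_nth (Gamma_row p M 3) j = vec_nth (vec_nth M 1) j ^ p"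
  "vec_nth (Gamma_row p M 4) j = vec_nth (vec_nth M 2) j ^ p"
  "vec_nth (Gamma_row p M 5) j = vec_nth (vec_nth M 1) j ^ p\<^sup>2"
  "vec_nth (Gamma_row p M 7) j = vec_nth (vec_nth M 1) j ^ p ^ 3"
  by (simp_all add: Gamma_row_def)

lemma frobenius_alpha: "alpha g ^ p ^ k = (\<Sum>j\<in>UNIV. of_int (g j) * vec_nth (vec_nth M 1) j ^ p ^ k)"
  and frobenius_beta: "beta g ^ p ^ k = (\<Sum>j\<in>UNIV. of_int (g j) * vec_nth (vec_nth M 2) j ^ p ^ k)"
  if "g \<in> E"
proof -
  have "of_int (g j) ^ p ^ k = (of_int (g j) :: 'a)" for j
    using of_nat_power_CHAR[OF prime_CHAR(1), of "nat (g j)" k] that by (simp add: char_p E_iff)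
  thus "alpha g ^ p ^ k = (\<Sum>j\<in>UNIV. of_int (g j) * vec_nth (vec_nth M 1) j ^ p ^ k)"
    and "beta g ^ p ^ k = (\<Sum>j\<in>UNIV. of_int (g j) * vec_nth (vec_nth M 2) j ^ p ^ k)"
    unfolding alpha_def beta_def using freshmans_dream_sum'[OF prime_CHAR(1) refl, of _ "UNIV :: 4 set" k]
    by (simp_all add: power_mult_distrib char_p)
qed

text \<open>
  The relations of this and the next lemma hold for the columns of \<open>M\<close> by the five-row relation
  between minors; both sides are additive and commute with multiplication by integers modulo \<open>p\<close>.
\<close>

lemma beta_relation:
  assumes g: "g \<in> E"
  shows "beta g ^ p = u * alpha g ^ p - v * beta g + w * alpha g"
proof -
  have "vec_nth (vec_nth M 2) j ^ p = u * vec_nth (vec_nth M 1) j ^ p - v * vec_nth (vec_nth M 2) j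
      + w * vec_nth (vec_nth M 1) j" for j
    using minor_relation[of 1 j 2 3 4 5] minor_1235 unfolding Gamma_row_nth minor_1234 u_def v_def w_def
    by (simp add: field_simps)
  hence "beta g ^ p = (\<Sum>j\<in>UNIV. of_int (g j) * (u * vec_nth (vec_nth M 1) j ^ p
      - v * vec_nth (vec_nth M 2) j + w * vec_nth (vec_nth M 1) j))"
    using frobenius_beta[OF g, of 1] by (simp only: power_one_right)
  also have "\<dots> = u * alpha g ^ p - v * beta g + w * alpha g"
    using frobenius_alpha[OF g, of 1]
    by (simp add: beta_def sum.distrib sum_subtractf sum_distrib_left algebra_simps)
       (simp add: alpha_def sum_distrib_left algebra_simps)
  finally show ?thesis .
qed

lemma alpha_relation:
  assumes g: "g \<in> E"
  shows "alpha g ^ p ^ 3 = b * alpha g ^ p\<^sup>2 - c * alpha g ^ p + a * beta g - d * alpha g"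
proof -
  have "vec_nth (vec_nth M 1) j ^ p ^ 3 = b * vec_nth (vec_nth M 1) j ^ p\<^sup>2 - c * vec_nth (vec_nth M 1) j ^ p
      + a * vec_nth (vec_nth M 2) j - d * vec_nth (vec_nth M 1) j" for j
  proof -
    have "vec_nth (vec_nth M 1) j ^ p ^ 3 * minor p M 1 2 3 5 =
        minor p M 1 2 3 7 * vec_nth (vec_nth M 1) j ^ p\<^sup>2 - minor p M 1 2 5 7 * vec_nth (vec_nth M 1) j ^ p
        + minor p M 1 3 5 7 * vec_nth (vec_nth M 2) j - minor p M 2 3 5 7 * vec_nth (vec_nth M 1) j"
      using minor_relation[of 1 j 2 3 5 7] unfolding Gamma_row_nth by (simp add: algebra_simps)
    from eq_divide_imp[OF minor_1235 this] show ?thesis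
      by (simp add: a_def b_def c_def d_def add_divide_distrib diff_divide_distrib)
  qed
  hence "alpha g ^ p ^ 3 = (\<Sum>j\<in>UNIV. of_int (g j) * (b * vec_nth (vec_nth M 1) j ^ p\<^sup>2
      - c * vec_nth (vec_nth M 1) j ^ p + a * vec_nth (vec_nth M 2) j - d * vec_nth (vec_nth M 1) j))"
    using frobenius_alpha[OF g, of 3] by (simp only:)
  also have "\<dots> = b * alpha g ^ p\<^sup>2 - c * alpha g ^ p + a * beta g - d * alpha g"
    using frobenius_alpha[OF g, of 1] frobenius_alpha[OF g, of 2]
    by (simp add: beta_def sum.distrib sum_subtractf sum_distrib_left algebra_simps)
       (simp add: alpha_def sum_distrib_left algebra_simps)
  finally show ?thesis .
qed

text \<open>
  If \<open>\<alpha>\<close> vanishes on an integer vector, so do its Frobenius powers, since the integers modulo \<open>p\<close>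
  are fixed by Frobenius. The vector is then in the kernel of the matrix with rows 1, 3, 5, 7 of
  \<open>\<Gamma>(M)\<close>, whose determinant does not vanish.
\<close>

lemma alpha_inj: "inj_on alpha E"
proof (rule inj_onI)
  fix g h assume g: "g \<in> E" and h: "h \<in> E" and eq: "alpha g = alpha h"
  define A :: "'a^4^4" where
    "A = vector [Gamma_row p M 1, Gamma_row p M 3, Gamma_row p M 5, Gamma_row p M 7]"
  define x :: "'a^4" where "x = (\<chi> j. of_int (g j) - of_int (h j))"
  have "(\<Sum>j\<in>UNIV. vec_nth (vec_nth M 1) j ^ p ^ k * vec_nth x j) = 0" for k
    using frobenius_alpha[OF g, of k] frobenius_alpha[OF h, of k] eq
    by (simp add: x_def algebra_simps sum_subtractf)
  from this[of 0] this[of 1] this[of 2] this[of 3] have "A *v x = 0"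
    by (simp add: A_def Finite_Cartesian_Product.vec_eq_iff forall_4 matrix_vector_mult_def vector_4
        Gamma_row_nth Gamma_row_nth(1)[unfolded One_nat_def])
  moreover have "Determinants.det A \<noteq> 0"
    using minor_1357 by (simp add: minor_def A_def)
  hence "\<exists>B. B ** A = Finite_Cartesian_Product.mat 1"
    by (metis invertible_det_nz invertible_def)
  ultimately have "x = 0"
    by (simp add: matrix_left_invertible_ker)
  have "g j = h j" for j
  proof -
    have "of_int (g j) - of_int (h j) = (0 :: 'a)"
      using \<open>x = 0\<close> by (simp add: x_def Finite_Cartesian_Product.vec_eq_iff)
    hence "of_int (g j - h j) = (0 :: 'a)" by simp
    hence "int p dvd g j - h j"
      by (simp only: of_int_eq_0_iff_char_dvd char_p)
    hence "g j mod int p = h j mod int p"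
      by (simp add: mod_eq_dvd_iff)
    thus ?thesis using g h by (simp add: E_iff)
  qed
  thus "g = h" by blast
qed

lemma card_E: "card E = p ^ 4"
  using p_gt_2 by (simp add: E_group_def carrier_integer_mod_group card_PiE)

lemma finite_E: "finite E"
  using card_E p_gt_2 by (intro card_ge_0_finite) simp

abbreviation R :: "'a mpoly set" where "R \<equiv> invariant_ring p M"

lemma R_iff: "f \<in> R \<longleftrightarrow> f \<in> polys 3 \<and> (\<forall>g\<in>E. shear (alpha g) (beta g) f = f)"
  by (simp add: invariant_ring_def act_eq_shear)

lemma subalgebra_R: "subalgebra R"
  by (auto simp: subalgebra_def R_iff shear_simps intro: subalgebra_closed[OF subalgebra_polys])

lemma R_polys: "f \<in> R \<Longrightarrow> f \<in> polys 3"
  by (simp add: R_iff)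

lemma X_in_R: "X \<in> R"
  by (simp add: R_iff polys_Var shear_Var)

abbreviation H1 :: "'a mpoly" where "H1 \<equiv> h1 p M"
abbreviation H2 :: "'a mpoly" where "H2 \<equiv> h2 p M"
abbreviation H3 :: "'a mpoly" where "H3 \<equiv> h3 p M"
abbreviation N :: "'a mpoly" where "N \<equiv> N_z p M"

lemma H1_eq: "H1 = delta ^ p + Const u * Y ^ p * X ^ p + Const v * delta * X ^ (2 * p - 2)
    + Const w * Y * X ^ (2 * p - 1)"
  by (simp add: h1_def u_def v_def w_def)

lemma H2_eq: "H2 = Y ^ (p ^ 3) - Const b * Y ^ (p\<^sup>2) * X ^ (p ^ 3 - p\<^sup>2) + Const c * Y ^ p * X ^ (p ^ 3 - p)
     + Const a * delta * X ^ (p ^ 3 - 2) + Const d * Y * X ^ (p ^ 3 - 1)"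
  by (simp add: h2_def a_def b_def c_def d_def)

lemma p_powers: "2 < p" "p \<le> p\<^sup>2" "p\<^sup>2 \<le> p ^ 3" "p \<le> p ^ 3" "2 \<le> p ^ 3"
proof -
  show "2 < p" by (rule p_gt_2)
  show *: "p \<le> p\<^sup>2" "p\<^sup>2 \<le> p ^ 3"
    using p_gt_2 by (simp_all add: power2_eq_square power3_eq_cube)
  show "p \<le> p ^ 3" "2 \<le> p ^ 3" using * p_gt_2 by linarith+
qed

lemma H1_in_R: "H1 \<in> R"
  unfolding R_iff
proof (intro conjI ballI)
  show "H1 \<in> polys 3"
    by (simp add: H1_eq subalgebra_closed[OF subalgebra_polys] polys_Var delta_polys)
  fix g assume g: "g \<in> E"
  let ?\<alpha> = "alpha g" and ?\<beta> = "beta g"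
  have X: "X ^ 2 * X ^ (2 * p - 2) = (X ^ (2 * p) :: 'a mpoly)"
    "X * X ^ (2 * p - 1) = (X ^ (2 * p) :: 'a mpoly)" "X ^ p * X ^ p = (X ^ (2 * p) :: 'a mpoly)"
    "(X ^ 2) ^ p = (X ^ (2 * p) :: 'a mpoly)"
    using p_gt_2
    by (auto simp flip: power_add power_Suc power_mult simp: mult_2 intro!: arg_cong[of _ _ "power X"])
  have "shear ?\<alpha> ?\<beta> H1 = (delta - Const ?\<beta> * X ^ 2) ^ p + Const u * (Y + Const ?\<alpha> * X) ^ p * X ^ p
      + Const v * (delta - Const ?\<beta> * X ^ 2) * X ^ (2 * p - 2)
      + Const w * (Y + Const ?\<alpha> * X) * X ^ (2 * p - 1)"
    by (simp add: H1_eq shear_simps shear_delta shear_Var)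
  also have "\<dots> = H1 + Const (u * ?\<alpha> ^ p - v * ?\<beta> + w * ?\<alpha> - ?\<beta> ^ p) * X ^ (2 * p)"
  proof -
    have 1: "(delta - Const ?\<beta> * X ^ 2) ^ p = delta ^ p - Const (?\<beta> ^ p) * X ^ (2 * p)"
      using frobenius(2)[of delta "Const ?\<beta> * X ^ 2" 1]
      by (simp only: CHAR_mpoly char_p power_mult_distrib Const_power X power_one_right)
    have 2: "(Y + Const ?\<alpha> * X) ^ p = Y ^ p + Const (?\<alpha> ^ p) * X ^ p"
      using frobenius(1)[OF refl, of Y "Const ?\<alpha> * X" 1]
      by (simp only: CHAR_mpoly char_p power_mult_distrib Const_power power_one_right)
    have "delta ^ p - B * T + U * (Y ^ p + A * X ^ p) * X ^ p + V * (delta - B' * X ^ 2) * S + W * (Y + A' * X) * Q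
        = delta ^ p + U * Y ^ p * X ^ p + V * delta * S + W * Y * Q
          + (U * A * (X ^ p * X ^ p) - V * B' * (X ^ 2 * S) + W * A' * (X * Q) - B * T)"
      for A A' B B' U V W S T Q :: "'a mpoly"
      by (simp add: algebra_simps)
    thus ?thesis
      by (simp only: 1 2 X H1_eq Const_add Const_diff Const_mult left_diff_distrib distrib_right)
  qed
  also have "\<dots> = H1"
    by (simp add: beta_relation[OF g])
  finally show "shear ?\<alpha> ?\<beta> H1 = H1" .
qed

lemma H2_in_R: "H2 \<in> R"
  unfolding R_iff
proof (intro conjI ballI)
  show "H2 \<in> polys 3"
    by (simp add: H2_eq subalgebra_closed[OF subalgebra_polys] polys_Var delta_polys)
  fix g assume g: "g \<in> E"
  let ?\<alpha> = "alpha g" and ?\<beta> = "beta g"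
  have X: "X ^ 2 * X ^ (p ^ 3 - 2) = (X ^ (p ^ 3) :: 'a mpoly)"
    "X * X ^ (p ^ 3 - 1) = (X ^ (p ^ 3) :: 'a mpoly)"
    "X ^ p\<^sup>2 * X ^ (p ^ 3 - p\<^sup>2) = (X ^ (p ^ 3) :: 'a mpoly)"
    "X ^ p * X ^ (p ^ 3 - p) = (X ^ (p ^ 3) :: 'a mpoly)"
    using p_powers by (auto simp flip: power_add power_Suc intro!: arg_cong[of _ _ "power X"])
  have "shear ?\<alpha> ?\<beta> H2 = (Y + Const ?\<alpha> * X) ^ p ^ 3 - Const b * (Y + Const ?\<alpha> * X) ^ p\<^sup>2 * X ^ (p ^ 3 - p\<^sup>2)
      + Const c * (Y + Const ?\<alpha> * X) ^ p * X ^ (p ^ 3 - p)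
      + Const a * (delta - Const ?\<beta> * X ^ 2) * X ^ (p ^ 3 - 2)
      + Const d * (Y + Const ?\<alpha> * X) * X ^ (p ^ 3 - 1)"
    by (simp add: H2_eq shear_simps shear_delta shear_Var)
  also have "\<dots> = H2 + Const (?\<alpha> ^ p ^ 3 - b * ?\<alpha> ^ p\<^sup>2 + c * ?\<alpha> ^ p - a * ?\<beta> + d * ?\<alpha>) * X ^ (p ^ 3)"
  proof -
    have 1: "(Y + Const ?\<alpha> * X) ^ p ^ k = Y ^ p ^ k + Const (?\<alpha> ^ p ^ k) * X ^ p ^ k" for k
      using frobenius(1)[OF refl, of Y "Const ?\<alpha> * X" k]
      by (simp only: CHAR_mpoly char_p power_mult_distrib Const_power)
    have "Y ^ p ^ 3 + A3 * X ^ p ^ 3 - B * (Y ^ p\<^sup>2 + A2 * X ^ p\<^sup>2) * P + C * (Y ^ p + A1 * X ^ p) * Q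
          + A * (delta - B' * X ^ 2) * S + D * (Y + A0 * X) * T
        = Y ^ p ^ 3 - B * Y ^ p\<^sup>2 * P + C * Y ^ p * Q + A * delta * S + D * Y * T
          + (A3 * X ^ p ^ 3 - B * A2 * (X ^ p\<^sup>2 * P) + C * A1 * (X ^ p * Q) - A * B' * (X ^ 2 * S) + D * A0 * (X * T))"
      for A A0 A1 A2 A3 B B' C D P Q S T :: "'a mpoly"
      by (simp add: algebra_simps)
    thus ?thesis
      by (simp only: 1 1[of 1, unfolded power_one_right] X H2_eq Const_add Const_diff Const_mult
          left_diff_distrib distrib_right)
  qed
  also have "\<dots> = H2"
    by (simp add: alpha_relation[OF g])
  finally show "shear ?\<alpha> ?\<beta> H2 = H2" .
qed

end

section \<open>Homogeneous polynomials\<close>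

definition homogeneous :: "nat \<Rightarrow> 'a::field mpoly \<Rightarrow> bool" where
  "homogeneous n f \<longleftrightarrow> (\<forall>m\<in>keys f. total_deg m = n)"

lemma homogeneous_mult: "homogeneous m f \<Longrightarrow> homogeneous n g \<Longrightarrow> homogeneous (m + n) (f * g)"
  using keys_mult[of f g] by (fastforce simp: homogeneous_def total_deg_add)

lemma homogeneous_mult': "homogeneous m f \<Longrightarrow> homogeneous n g \<Longrightarrow> k = m + n \<Longrightarrow> homogeneous k (f * g)"
  using homogeneous_mult by blast

lemma homogeneous_add: "homogeneous n f \<Longrightarrow> homogeneous n g \<Longrightarrow> homogeneous n (f + g)"
  using keys_add[of f g] by (auto simp: homogeneous_def)

lemma homogeneous_uminus: "homogeneous n f \<Longrightarrow> homogeneous n (- f)"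
  by (simp add: homogeneous_def in_keys_iff)

lemma homogeneous_diff: "homogeneous n f \<Longrightarrow> homogeneous n g \<Longrightarrow> homogeneous n (f - g)"
  using homogeneous_add[of n f "- g"] homogeneous_uminus[of n g] by simp

lemma homogeneous_Const_mult: "homogeneous n f \<Longrightarrow> homogeneous n (Const c * f)"
  by (auto simp: homogeneous_def in_keys_iff lookup_Const_mult)

lemma homogeneous_Monom: "homogeneous (total_deg m) (Monom m)"
  by (simp add: homogeneous_def)

lemma homogeneous_Var: "homogeneous 1 (Var i)"
  using homogeneous_Monom[of "single i 1"] by (simp add: Var_def)

lemma homogeneous_power: "homogeneous n f \<Longrightarrow> homogeneous (k * n) (f ^ k)"
proof (induction k)
  case 0
  show ?case by (simp add: homogeneous_def)
qed (simp add: homogeneous_mult)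

lemma homogeneous_Var_power: "homogeneous k (Var i ^ k)"
  using homogeneous_power[OF homogeneous_Var, of k i] by simp

lemma homogeneous_cancel: "homogeneous (total_deg m + n) (Monom m * f) \<Longrightarrow> homogeneous n f"
  by (auto simp: homogeneous_def keys_Monom_mult total_deg_add)

text \<open>
  Among the monomials of a given degree a power of \<open>y\<close> exceeds all those that contain \<open>x\<close>. This
  determines the lead monomials of \<open>h\<^sub>1, h\<^sub>2, h\<^sub>3\<close> from their values modulo \<open>x\<close>.
\<close>

lemma lead_Y_power:
  assumes "homogeneous n f" "X dvd f - Y ^ n"
  shows "f \<noteq> 0" "LM f = single 1 n" "LC f = 1"
proof -
  obtain g where g: "f - Y ^ n = X * g" using assms(2) by blast
  have hom: "homogeneous n (f - Y ^ n)"
    by (intro homogeneous_diff assms(1) homogeneous_Var_power)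
  have "grevlex_less t (single 1 n)" if t: "t \<in> keys (f - Y ^ n)" for t
  proof -
    have "t \<in> keys (X * g)" using t by (simp only: g)
    then obtain k where "t = single 0 1 + k"
      unfolding Var_def keys_Monom_mult by blast
    moreover have "total_deg t = n" using hom t by (simp add: homogeneous_def)
    ultimately show ?thesis
      by (auto simp: grevlex_less_def lookup_add lookup_single intro!: exI[of _ 0])
  qed
  hence *: "is_LM (Y ^ n + (f - Y ^ n)) (single 1 n)"
    "lookup (Y ^ n + (f - Y ^ n)) (single 1 n) = 1"
    using grevlex.lead_add_smaller[OF grevlex.lead_Monom[of "single 1 n"], where g = "f - Y ^ n"]
    by (simp_all add: Var_power lookup_Monom)
  show "LM f = single 1 n" using LM_eqI[OF *(1)] by simp
  moreover from this show "LC f = 1" using * by (simp add: LC_def)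
  ultimately show "f \<noteq> 0" by (auto simp: LC_def)
qed

text \<open>
  Setting the variables with index at least \<open>n\<close> to zero fixes \<open>f\<close> and \<open>f g\<close>, hence \<open>g\<close>.
\<close>

lemma polys_cancel:
  assumes "f \<in> polys n" "f \<noteq> 0" "f * g \<in> polys n"
  shows "g \<in> polys n"
proof -
  define \<pi> where "\<pi> = subst (\<lambda>i. if i < n then Var i else (0 :: 'a mpoly))"
  have hom: "alg_hom \<pi>" unfolding \<pi>_def by (rule alg_hom_subst)
  have id: "\<pi> h = h" if "h \<in> polys n" for h
    by (rule alg_hom_eq_on_polys[OF hom alg_hom_ident _ that]) (simp add: \<pi>_def)
  have image: "\<pi> h \<in> polys n" for h
    unfolding alg_hom_expand[OF hom, of h] alg_hom_Monom[OF hom]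
    by (intro subalgebra_sum[OF subalgebra_polys] subalgebra_mult[OF subalgebra_polys]
        subalgebra_prod[OF subalgebra_polys] subalgebra_power[OF subalgebra_polys] polys_Const)
       (simp add: \<pi>_def polys_Var subalgebra_0[OF subalgebra_polys])
  have "f * \<pi> g = f * g"
    using id[OF assms(3)] id[OF assms(1)] by (simp add: alg_hom_mult[OF hom])
  hence "\<pi> g = g" using assms(2) by simp
  thus ?thesis using image by metis
qed

lemma diff_dvd_diff_power: "(x - y :: 'b::comm_ring_1) dvd x ^ k - y ^ k"
proof (induction k)
  case (Suc k)
  have "x ^ Suc k - y ^ Suc k = x * (x ^ k - y ^ k) + (x - y) * y ^ k" by (simp add: algebra_simps)
  thus ?case using Suc by (metis dvd_add dvd_mult dvd_triv_left)
qed simp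

lemma dvd_diff_power: "m dvd x - (y :: 'b::comm_ring_1) \<Longrightarrow> m dvd x ^ k - y ^ k"
  using diff_dvd_diff_power dvd_trans by blast

section \<open>The special invariants\<close>

context rank_four
begin

lemma homogeneous_delta: "homogeneous 2 (delta :: 'a mpoly)"
  unfolding delta_def
  by (intro homogeneous_diff homogeneous_Var_power homogeneous_mult'[OF homogeneous_Var homogeneous_Var]) simp

lemma homogeneous_H1: "homogeneous (2 * p) H1"
  unfolding H1_eq using p_gt_2
  by (intro homogeneous_add homogeneous_mult'[OF homogeneous_Const_mult[OF homogeneous_Var_power] homogeneous_Var_power]
      homogeneous_mult'[OF homogeneous_Const_mult[OF homogeneous_Var] homogeneous_Var_power]
      homogeneous_mult'[OF homogeneous_Const_mult[OF homogeneous_delta] homogeneous_Var_power])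
     (use homogeneous_power[OF homogeneous_delta, of p] in \<open>simp_all add: mult.commute\<close>)

lemma homogeneous_H2: "homogeneous (p ^ 3) H2"
  unfolding H2_eq using p_powers
  by (intro homogeneous_add homogeneous_diff homogeneous_Var_power
      homogeneous_mult'[OF homogeneous_Const_mult[OF homogeneous_Var_power] homogeneous_Var_power]
      homogeneous_mult'[OF homogeneous_Const_mult[OF homogeneous_Var] homogeneous_Var_power]
      homogeneous_mult'[OF homogeneous_Const_mult[OF homogeneous_delta] homogeneous_Var_power]) linarith+

lemma H1_mod_X: "X ^ p dvd H1 - Y ^ (2 * p)"
proof -
  have "(delta :: 'a mpoly) ^ p = Y ^ (2 * p) - X ^ p * Z ^ p"
    using frobenius(2)[of "Y\<^sup>2" "X * Z" 1]
    by (simp add: delta_def CHAR_mpoly char_p power_mult_distrib flip: power_mult)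
  hence "H1 - Y ^ (2 * p) = - (X ^ p * Z ^ p) + Const u * Y ^ p * X ^ p
      + Const v * delta * X ^ (2 * p - 2) + Const w * Y * X ^ (2 * p - 1)"
    by (simp add: H1_eq)
  moreover have "X ^ p dvd (X ^ (2 * p - 2) :: 'a mpoly)" "X ^ p dvd (X ^ (2 * p - 1) :: 'a mpoly)"
    using p_gt_2 by (auto intro!: le_imp_power_dvd)
  ultimately show ?thesis
    by (simp add: dvd_add dvd_mult)
qed

lemma H2_mod_X: "X dvd H2 - Y ^ p ^ 3"
proof -
  have "p\<^sup>2 < p ^ 3" using p_gt_2 by (simp add: power2_eq_square power3_eq_cube)
  moreover have "p < p ^ 3" "2 < p ^ 3" using calculation p_powers by linarith+
  ultimately have "X dvd (X ^ (p ^ 3 - p\<^sup>2) :: 'a mpoly)" "X dvd (X ^ (p ^ 3 - p) :: 'a mpoly)"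
    "X dvd (X ^ (p ^ 3 - 2) :: 'a mpoly)" "X dvd (X ^ (p ^ 3 - 1) :: 'a mpoly)"
    by (simp_all add: dvd_power)
  thus ?thesis
    by (simp add: H2_eq dvd_add dvd_diff dvd_mult)
qed

lemma lead_H1: "H1 \<noteq> 0" "LM H1 = single 1 (2 * p)" "LC H1 = 1"
proof -
  have "X dvd (X ^ p :: 'a mpoly)" using p_gt_2 by (simp add: dvd_power)
  hence "X dvd H1 - Y ^ (2 * p)" using H1_mod_X dvd_trans by blast
  from lead_Y_power[OF homogeneous_H1 this]
  show "H1 \<noteq> 0" "LM H1 = single 1 (2 * p)" "LC H1 = 1" by auto
qed

lemmas lead_H2 = lead_Y_power[OF homogeneous_H2 H2_mod_X]

lemma half_p: "p * (p + 1) div 2 = p * ((p + 1) div 2)" "2 * ((p + 1) div 2) = p + 1"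
    "2 * ((p\<^sup>2 + 1) div 2) = p\<^sup>2 + 1"
  using odd_p by (auto elim!: oddE simp: power2_eq_square algebra_simps)

lemma h3_tilde_eq: "h3_tilde p M = H2\<^sup>2 - H1 ^ p\<^sup>2
     + Const (2 * b) * H1 ^ (p * ((p + 1) div 2)) * X ^ (p ^ 3 - p\<^sup>2)
     - Const (2 * c) * H1 ^ ((p\<^sup>2 + 1) div 2) * X ^ (p ^ 3 - p)"
  by (simp only: h3_tilde_def b_def c_def half_p(1))

lemma homogeneous_h3_tilde: "homogeneous (2 * p ^ 3) (h3_tilde p M)"
proof -
  have 1: "homogeneous (2 * p ^ 3) (H2\<^sup>2)"
    by (rule homogeneous_power[OF homogeneous_H2])
  have 2: "homogeneous (2 * p ^ 3) (H1 ^ p\<^sup>2)"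
    using homogeneous_power[OF homogeneous_H1, of "p\<^sup>2"]
    by (simp add: power2_eq_square power3_eq_cube algebra_simps)
  have "p * ((p + 1) div 2) * (2 * p) = p\<^sup>2 * (2 * ((p + 1) div 2))"
    by (simp add: power2_eq_square algebra_simps)
  also have "\<dots> = p ^ 3 + p\<^sup>2"
    unfolding half_p by (simp add: power2_eq_square power3_eq_cube algebra_simps)
  finally have "p * ((p + 1) div 2) * (2 * p) + (p ^ 3 - p\<^sup>2) = 2 * p ^ 3"
    using p_powers by simp
  with homogeneous_mult[OF homogeneous_Const_mult[OF homogeneous_power[OF homogeneous_H1, of "p * ((p + 1) div 2)"]]
      homogeneous_Var_power[of "p ^ 3 - p\<^sup>2" 0], of "2 * b"]
  have 3: "homogeneous (2 * p ^ 3) (Const (2 * b) * H1 ^ (p * ((p + 1) div 2)) * X ^ (p ^ 3 - p\<^sup>2))"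
    by simp
  have "(p\<^sup>2 + 1) div 2 * (2 * p) = p * (2 * ((p\<^sup>2 + 1) div 2))"
    by (simp add: algebra_simps)
  also have "\<dots> = p ^ 3 + p"
    unfolding half_p by (simp add: power2_eq_square power3_eq_cube algebra_simps)
  finally have "(p\<^sup>2 + 1) div 2 * (2 * p) + (p ^ 3 - p) = 2 * p ^ 3"
    using p_powers by simp
  with homogeneous_mult[OF homogeneous_Const_mult[OF homogeneous_power[OF homogeneous_H1, of "(p\<^sup>2 + 1) div 2"]]
      homogeneous_Var_power[of "p ^ 3 - p" 0], of "2 * c"]
  have 4: "homogeneous (2 * p ^ 3) (Const (2 * c) * H1 ^ ((p\<^sup>2 + 1) div 2) * X ^ (p ^ 3 - p))"
    by simp
  show ?thesis
    unfolding h3_tilde_eq by (intro homogeneous_add homogeneous_diff 1 2 3 4)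
qed

text \<open>
  In characteristic \<open>p\<close> a high power of \<open>h\<^sub>1\<close> is a power of \<open>y\<close> up to a high power of \<open>x\<close>. The
  powers of \<open>h\<^sub>1\<close> in \<open>h3_tilde\<close> therefore cancel all terms of \<open>h\<^sub>2\<^sup>2\<close> of order below \<open>p^3 - 1\<close> in \<open>x\<close>, except for
  the cross term of the summands \<open>y^(p^3)\<close> and \<open>a\<delta>x^(p^3 - 2)\<close> of \<open>h\<^sub>2\<close>.
\<close>

lemma h3_tilde_mod_X:
  "X ^ (p ^ 3 - 1) dvd h3_tilde p M - Const (2 * a) * delta * Y ^ p ^ 3 * X ^ (p ^ 3 - 2)"
proof -
  define e where "e = p ^ 3"
  define P where "P = (X ^ (e - p\<^sup>2) :: 'a mpoly)"
  define Q where "Q = (X ^ (e - p) :: 'a mpoly)"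
  define S where "S = (X ^ (e - 2) :: 'a mpoly)"
  define T where "T = (X ^ (e - 1) :: 'a mpoly)"
  have e: "p\<^sup>2 \<le> e" "p \<le> e" "2 \<le> e" "p \<le> p\<^sup>2" "2 < p" using p_powers by (simp_all add: e_def)
  have "3 * p\<^sup>2 \<le> e" using p_gt_2 by (simp add: e_def power2_eq_square power3_eq_cube)
  hence T_PP: "T dvd P * P"
    using e by (auto simp: T_def P_def simp flip: power_add intro!: le_imp_power_dvd)
  have P_dvd: "P dvd Q" "P dvd S" "P dvd T"
    using e by (auto simp: P_def Q_def S_def T_def intro!: le_imp_power_dvd)
  have T_e: "T dvd X ^ e" by (simp add: T_def le_imp_power_dvd)
  have PQ: "X ^ p\<^sup>2 * P = X ^ e" "X ^ p * Q = X ^ e"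
    using e by (simp_all add: P_def Q_def flip: power_add)

  define D where "D = - (Const b * Y ^ p\<^sup>2 * P) + Const c * Y ^ p * Q + Const a * delta * S + Const d * Y * T"
  have H2: "H2 = Y ^ e + D"
    by (simp add: H2_eq D_def e_def P_def Q_def S_def T_def)
  have "P dvd D" unfolding D_def using P_dvd by (intro dvd_add) (simp_all add: dvd_mult)
  hence "P * P dvd D ^ 2" by (simp add: power2_eq_square mult_dvd_mono)
  hence T_D: "T dvd D ^ 2" using T_PP dvd_trans by blast

  \<comment> \<open>the three powers of \<open>h\<^sub>1\<close> modulo powers of \<open>x\<close>\<close>
  obtain g where "H1 - Y ^ (2 * p) = X ^ p * g"
    using H1_mod_X by (elim dvdE)
  hence g: "H1 = Y ^ (2 * p) + X ^ p * g" by (simp add: algebra_simps)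
  have pow: "H1 ^ p ^ k = Y ^ (2 * p * p ^ k) + X ^ (p * p ^ k) * g ^ p ^ k" for k
    using frobenius(1)[OF refl, of "Y ^ (2 * p)" "X ^ p * g" k]
    by (simp add: g CHAR_mpoly char_p power_mult_distrib flip: power_mult)
  have 1: "T dvd H1 ^ p\<^sup>2 - Y ^ (2 * e)"
    using pow[of 2] T_e by (simp add: e_def power3_eq_cube power2_eq_square mult.assoc)
  have "X ^ p\<^sup>2 dvd H1 ^ p - Y ^ (2 * p\<^sup>2)"
    using pow[of 1] by (simp add: power2_eq_square mult.assoc)
  hence "X ^ p\<^sup>2 dvd (H1 ^ p) ^ ((p + 1) div 2) - (Y ^ (2 * p\<^sup>2)) ^ ((p + 1) div 2)"
    by (rule dvd_diff_power)
  moreover have "(Y ^ (2 * p\<^sup>2)) ^ ((p + 1) div 2) = (Y ^ (e + p\<^sup>2) :: 'a mpoly)"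
  proof -
    have "2 * p\<^sup>2 * ((p + 1) div 2) = p\<^sup>2 * (2 * ((p + 1) div 2))" by simp
    also have "\<dots> = e + p\<^sup>2"
      unfolding half_p by (simp add: e_def power2_eq_square power3_eq_cube algebra_simps)
    finally show ?thesis by (simp flip: power_mult)
  qed
  ultimately have "X ^ p\<^sup>2 * P dvd (H1 ^ (p * ((p + 1) div 2)) - Y ^ (e + p\<^sup>2)) * P"
    by (simp add: power_mult)
  hence 2: "T dvd (H1 ^ (p * ((p + 1) div 2)) - Y ^ (e + p\<^sup>2)) * P"
    unfolding PQ by (rule dvd_trans[OF T_e])
  have "X ^ p dvd H1 ^ ((p\<^sup>2 + 1) div 2) - (Y ^ (2 * p)) ^ ((p\<^sup>2 + 1) div 2)"
    by (intro dvd_diff_power H1_mod_X)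
  moreover have "(Y ^ (2 * p)) ^ ((p\<^sup>2 + 1) div 2) = (Y ^ (e + p) :: 'a mpoly)"
  proof -
    have "2 * p * ((p\<^sup>2 + 1) div 2) = p * (2 * ((p\<^sup>2 + 1) div 2))" by simp
    also have "\<dots> = e + p"
      unfolding half_p by (simp add: e_def power2_eq_square power3_eq_cube algebra_simps)
    finally show ?thesis by (simp flip: power_mult)
  qed
  ultimately have "X ^ p * Q dvd (H1 ^ ((p\<^sup>2 + 1) div 2) - Y ^ (e + p)) * Q"
    by simp
  hence 3: "T dvd (H1 ^ ((p\<^sup>2 + 1) div 2) - Y ^ (e + p)) * Q"
    unfolding PQ by (rule dvd_trans[OF T_e])

  have "h3_tilde p M - Const (2 * a) * delta * Y ^ e * S =
      D ^ 2 + Const (2 * d) * Y ^ e * Y * T - (H1 ^ p\<^sup>2 - Y ^ (2 * e))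
      + Const (2 * b) * ((H1 ^ (p * ((p + 1) div 2)) - Y ^ (e + p\<^sup>2)) * P)
      - Const (2 * c) * ((H1 ^ ((p\<^sup>2 + 1) div 2) - Y ^ (e + p)) * Q)"
  proof -
    have "(E + D)\<^sup>2 - U + 2 * B * V * P - 2 * C * W * Q - 2 * F * E =
        D\<^sup>2 + 2 * G * E - (U - E * E) + 2 * B * ((V - E * Y2) * P) - 2 * C * ((W - E * Y1) * Q)"
      if "D = - (B * Y2 * P) + C * Y1 * Q + F + G"
      for B C D E F G P Q U V W Y1 Y2 :: "'a mpoly"
      unfolding that by (simp add: power2_eq_square algebra_simps)
    note identity = this[OF D_def, of "Y ^ e" "H1 ^ p\<^sup>2" "H1 ^ (p * ((p + 1) div 2))" "H1 ^ ((p\<^sup>2 + 1) div 2)"]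
    have Y_2e: "Y ^ (2 * e) = (Y ^ e * Y ^ e :: 'a mpoly)"
      by (simp add: mult_2 power_add)
    have Const_double: "Const (2 * r) = 2 * Const r" for r :: 'a
      by (simp add: Const_mult Const_numeral)
    have h3_tilde: "h3_tilde p M = (Y ^ e + D)\<^sup>2 - H1 ^ p\<^sup>2 + Const (2 * b) * H1 ^ (p * ((p + 1) div 2)) * P
        - Const (2 * c) * H1 ^ ((p\<^sup>2 + 1) div 2) * Q"
      unfolding h3_tilde_eq H2 by (simp only: P_def Q_def e_def)
    show ?thesis
      unfolding h3_tilde Const_double Y_2e power_add[of Y e]
      by (rule trans[OF _ trans[OF identity]]) (simp_all only: mult_ac)
  qed
  also have "T dvd \<dots>"
    by (rule dvd_diff, rule dvd_add, rule dvd_diff, rule dvd_add)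
       (rule T_D dvd_triv_right 1 dvd_mult[OF 2] dvd_mult[OF 3])+
  finally show ?thesis by (simp add: T_def S_def e_def)
qed

lemma H3_properties:
  "Const (2 * minor p M 1 3 5 7) * X ^ (p ^ 3 - 2) * H3 = Const (minor p M 1 2 3 5) * h3_tilde p M"
  "X dvd H3 - Y ^ (p ^ 3 + 2)"
proof -
  have "p ^ 3 - 1 = Suc (p ^ 3 - 2)"
    using p_powers(5) by simp
  hence X_Suc: "X ^ (p ^ 3 - 1) = X * (X ^ (p ^ 3 - 2) :: 'a mpoly)"
    by (simp only: power_Suc)
  obtain g where g: "h3_tilde p M - Const (2 * a) * delta * Y ^ p ^ 3 * X ^ (p ^ 3 - 2) = X * X ^ (p ^ 3 - 2) * g"
    using h3_tilde_mod_X[unfolded X_Suc] by (elim dvdE)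
  define q where "q = delta * Y ^ p ^ 3 + Const (1 / (2 * a)) * X * g"
  have a2: "2 * a \<noteq> 0" using a_nonzero two_nonzero by simp
  have "Const (2 * a) * q = Const (2 * a) * delta * Y ^ p ^ 3 + Const (2 * a * (1 / (2 * a))) * X * g"
    unfolding Const_mult[of "2 * a"] by (simp only: q_def algebra_simps)
  also have "2 * a * (1 / (2 * a)) = 1" using a2 by simp
  finally have "X ^ (p ^ 3 - 2) * (Const (2 * a) * q) = h3_tilde p M"
    using g by (simp add: algebra_simps)
  moreover have "Const (2 * minor p M 1 3 5 7) = Const (minor p M 1 2 3 5) * Const (2 * a)"
    using minor_1235 by (simp add: a_def flip: Const_mult)
  ultimately have q: "Const (2 * minor p M 1 3 5 7) * X ^ (p ^ 3 - 2) * q = Const (minor p M 1 2 3 5) * h3_tilde p M"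
    by (simp add: algebra_simps)
  have nz: "Const (2 * minor p M 1 3 5 7) * X ^ (p ^ 3 - 2) \<noteq> (0 :: 'a mpoly)"
    using minor_1357 two_nonzero by simp
  have "H3 = q"
    unfolding h3_def
  proof (rule the_equality)
    fix r assume "Const (2 * minor p M 1 3 5 7) * X ^ (p ^ 3 - 2) * r = Const (minor p M 1 2 3 5) * h3_tilde p M"
    hence "Const (2 * minor p M 1 3 5 7) * X ^ (p ^ 3 - 2) * r = Const (2 * minor p M 1 3 5 7) * X ^ (p ^ 3 - 2) * q"
      by (simp only: q)
    thus "r = q" using nz mult_left_cancel by blast
  qed (rule q)
  thus "Const (2 * minor p M 1 3 5 7) * X ^ (p ^ 3 - 2) * H3 = Const (minor p M 1 2 3 5) * h3_tilde p M"
    using q by simp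
  have "H3 - Y ^ (p ^ 3 + 2) = X * (Const (1 / (2 * a)) * g - Z * Y ^ p ^ 3)"
    unfolding \<open>H3 = q\<close> q_def delta_def by (simp add: power_add power2_eq_square algebra_simps)
  thus "X dvd H3 - Y ^ (p ^ 3 + 2)" by simp
qed

lemma h3_tilde_eq_H3: "h3_tilde p M = Const (2 * a) * X ^ (p ^ 3 - 2) * H3"
proof -
  have "Const (2 * minor p M 1 3 5 7) = Const (minor p M 1 2 3 5) * Const (2 * a)"
    using minor_1235 by (simp add: a_def flip: Const_mult)
  hence "Const (minor p M 1 2 3 5) * (Const (2 * a) * X ^ (p ^ 3 - 2) * H3) = Const (minor p M 1 2 3 5) * h3_tilde p M"
    using H3_properties(1) by (simp add: mult.assoc)
  thus ?thesis using minor_1235 by simp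
qed

lemma homogeneous_H3: "homogeneous (p ^ 3 + 2) H3"
proof (rule homogeneous_cancel)
  have "homogeneous (2 * p ^ 3) (Const (1 / (2 * a)) * h3_tilde p M)"
    by (intro homogeneous_Const_mult homogeneous_h3_tilde)
  moreover have "Const (1 / (2 * a)) * h3_tilde p M = Const (1 / (2 * a) * (2 * a)) * (X ^ (p ^ 3 - 2) * H3)"
    by (simp only: h3_tilde_eq_H3 Const_mult mult.assoc)
  moreover have "1 / (2 * a) * (2 * a) = 1"
    using a_nonzero two_nonzero by simp
  moreover have "2 * p ^ 3 = (p ^ 3 - 2) + (p ^ 3 + 2)"
    using p_powers(5) by linarith
  ultimately show "homogeneous (total_deg (single 0 (p ^ 3 - 2)) + (p ^ 3 + 2))
      (Monom (single 0 (p ^ 3 - 2)) * H3)"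
    by (simp only: Var_power total_deg_single Const_1 mult_1_left)
qed

lemmas lead_H3 = lead_Y_power[OF homogeneous_H3 H3_properties(2)]

text \<open>
  Invariance of a product and of a nonzero factor forces invariance of the quotient.
\<close>

lemma R_cancel:
  assumes "f \<in> R" "f \<noteq> 0" "f * g \<in> R"
  shows "g \<in> R"
  unfolding R_iff
proof (intro conjI ballI)
  show "g \<in> polys 3" using assms polys_cancel R_polys by blast
  fix h assume "h \<in> E"
  hence "f * shear (alpha h) (beta h) g = f * g"
    using assms(1,3) unfolding R_iff shear_simps by metis
  thus "shear (alpha h) (beta h) g = g" using assms(2) by simp
qed

lemma H3_in_R: "H3 \<in> R"
proof (rule R_cancel)
  show "Const (2 * a) * X ^ (p ^ 3 - 2) \<in> R"
    by (intro subalgebra_closed[OF subalgebra_R] X_in_R)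
  show "Const (2 * a) * X ^ (p ^ 3 - 2) \<noteq> 0"
    using a_nonzero two_nonzero by simp
  show "Const (2 * a) * X ^ (p ^ 3 - 2) * H3 \<in> R"
    unfolding h3_tilde_eq_H3[symmetric] h3_tilde_eq
    by (intro subalgebra_closed[OF subalgebra_R] X_in_R H1_in_R H2_in_R)
qed

end

definition set_z_to :: "'a::field mpoly \<Rightarrow> 'a mpoly \<Rightarrow> 'a mpoly" where
  "set_z_to r = subst (Var(2 := r))"

lemma alg_hom_set_z_to: "alg_hom (set_z_to r)"
  unfolding set_z_to_def by (rule alg_hom_subst)

lemmas set_z_to_simps = alg_hom_simps[OF alg_hom_set_z_to]

lemma set_z_to_Var: "set_z_to r (Var i) = (if i = 2 then r else Var i)"
  by (simp add: set_z_to_def)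

text \<open>
  The remainder theorem for \<open>z\<close>: a polynomial is congruent to its value at \<open>z = r\<close> modulo \<open>z - r\<close>.
\<close>

lemma dvd_set_z_to: "Z - r dvd f - set_z_to r f"
proof -
  have step: "Z - r dvd f * g - set_z_to r (f * g)"
    if "Z - r dvd f - set_z_to r f" "Z - r dvd g - set_z_to r g" for f g
  proof -
    have "f * g - set_z_to r (f * g) = f * (g - set_z_to r g) + set_z_to r g * (f - set_z_to r f)"
      by (simp add: set_z_to_simps algebra_simps)
    thus ?thesis
      using dvd_add[OF dvd_mult[OF that(2)] dvd_mult[OF that(1)]] by simp
  qed
  have pow: "Z - r dvd f ^ k - set_z_to r (f ^ k)" if "Z - r dvd f - set_z_to r f" for f k
  proof (induction k)
    case (Suc k)
    show ?case unfolding power_Suc by (rule step[OF that Suc])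
  qed (simp add: set_z_to_simps)
  have prod: "Z - r dvd prod F I - set_z_to r (prod F I)"
    if "\<And>i. i \<in> I \<Longrightarrow> Z - r dvd F i - set_z_to r (F i)" for I :: "nat set" and F
    using that
  proof (induction I rule: infinite_finite_induct)
    case (insert i I)
    show ?case
      unfolding prod.insert[OF insert.hyps] using insert by (intro step) auto
  qed (simp_all add: set_z_to_simps)
  have "Z - r dvd Monom m - set_z_to r (Monom m)" for m
    unfolding Monom_expand by (intro prod pow) (simp add: set_z_to_Var)
  hence "Z - r dvd (\<Sum>m\<in>keys f. Const (lookup f m) * (Monom m - set_z_to r (Monom m)))"
    by (intro dvd_sum dvd_mult)
  also have "\<dots> = (\<Sum>m\<in>keys f. Const (lookup f m) * Monom m) -
      (\<Sum>m\<in>keys f. Const (lookup f m) * set_z_to r (Monom m))"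
    by (simp only: right_diff_distrib sum_subtractf)
  also have "\<dots> = f - set_z_to r f"
    unfolding mpoly_expand[of f, symmetric] alg_hom_expand[OF alg_hom_set_z_to, of r f, symmetric] ..
  finally show ?thesis .
qed

context rank_four
begin

section \<open>The orbit product\<close>

definition z_conj :: "(4 \<Rightarrow> int) \<Rightarrow> 'a mpoly" where
  "z_conj g = shear (alpha g) (beta g) Z"

lemma z_conj_eq: "z_conj g = Z + Const (2 * alpha g) * Y + Const ((alpha g)\<^sup>2 + beta g) * X"
  by (simp add: z_conj_def shear_Var)

lemma inj_z_conj: "inj_on z_conj E"
proof (rule inj_onI)
  fix g h assume gh: "g \<in> E" "h \<in> E" "z_conj g = z_conj h"
  have "lookup (z_conj k) (single 1 1) = 2 * alpha k" for k
    by (simp add: z_conj_eq Var_def lookup_add lookup_Const_mult lookup_Monom when_def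
        single_one_eq_iff)
  hence "2 * alpha g = 2 * alpha h" using gh(3) by metis
  thus "g = h" using gh(1,2) two_nonzero alpha_inj by (simp add: inj_on_eq_iff)
qed

lemma orbit_Z: "orbit (E_group p) (act M) Z = z_conj ` E"
proof -
  have "orbit (E_group p) (act M) Z = (\<lambda>g. act M g Z) ` E"
    by (auto simp: orbit_def)
  also have "\<dots> = z_conj ` E"
    by (intro image_cong) (simp_all add: act_eq_shear z_conj_def)
  finally show ?thesis .
qed

lemma N_eq: "N = (\<Prod>g\<in>E. z_conj g)"
  unfolding N_z_def orbit_Z by (simp add: prod.reindex inj_z_conj)

lemma lead_z_conj: "z_conj g \<noteq> 0" "LM (z_conj g) = single 2 1" "LC (z_conj g) = 1"
proof -
  let ?r = "Const (2 * alpha g) * Y + Const ((alpha g)\<^sup>2 + beta g) * X :: 'a mpoly"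
  have "grevlex_less t (single 2 1)" if t: "t \<in> keys ?r" for t
  proof -
    have "t \<in> keys (Const (2 * alpha g) * Y :: 'a mpoly) \<or>
        t \<in> keys (Const ((alpha g)\<^sup>2 + beta g) * X :: 'a mpoly)"
      using t keys_add[of "Const (2 * alpha g) * Y" "Const ((alpha g)\<^sup>2 + beta g) * X"] by blast
    hence "t = single 1 1 \<or> t = single 0 1"
      by (auto simp: Var_def in_keys_iff lookup_Const_mult lookup_Monom when_def split: if_splits)
    moreover have "grevlex_less (single 1 1) (single 2 1)"
      by (auto simp: grevlex_less_def lookup_single intro!: exI[of _ 1])
    moreover have "grevlex_less (single 0 1) (single 2 1)"
      by (auto simp: grevlex_less_def lookup_single intro!: exI[of _ 0])
    ultimately show ?thesis by auto
  qed
  from grevlex.lead_add_smaller[OF grevlex.lead_Monom this]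
  have *: "is_LM (Z + ?r) (single 2 1)" "lookup (Z + ?r) (single 2 1) = 1"
    by (simp_all add: Var_def lookup_Monom)
  have eq: "z_conj g = Z + ?r" by (simp add: z_conj_eq add.assoc)
  show "LM (z_conj g) = single 2 1" using LM_eqI[OF *(1)] by (simp add: eq)
  moreover from this show "LC (z_conj g) = 1" using *(2) by (simp only: LC_def eq)
  ultimately show "z_conj g \<noteq> 0" by (auto simp: LC_def)
qed

lemma lead_prod_z_conj:
  assumes "finite A"
  shows "prod z_conj A \<noteq> 0" "LM (prod z_conj A) = single 2 (card A)" "LC (prod z_conj A) = 1"
proof -
  show nz: "prod z_conj B \<noteq> 0" for B
    using lead_z_conj(1) by (cases "finite B") simp_all
  show "LM (prod z_conj A) = single 2 (card A)"
    using assms by (induction A) (simp_all add: LM_mult nz lead_z_conj flip: single_add)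
  show "LC (prod z_conj A) = 1"
    using assms by (induction A) (simp_all add: LC_mult nz lead_z_conj)
qed

lemma lead_N: "N \<noteq> 0" "LM N = single 2 (p ^ 4)" "LC N = 1"
  using lead_prod_z_conj[OF finite_E] by (simp_all add: N_eq card_E)

lemma E_closed:
  assumes "g \<in> E" "h \<in> E"
  shows "\<exists>k\<in>E. alpha k = alpha g + alpha h \<and> beta k = beta g + beta h"
proof
  let ?k = "\<lambda>j. (g j + h j) mod int p"
  show "?k \<in> E" using p_gt_2 by (simp add: E_iff)
  have "of_int (m mod int p) = (of_int m :: 'a)" for m
  proof -
    have "int CHAR('a) dvd m - m mod int p" by (simp add: char_p mod_eq_dvd_iff[symmetric])
    hence "of_int (m - m mod int p) = (0 :: 'a)" by (simp only: of_int_eq_0_iff_char_dvd)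
    thus ?thesis by simp
  qed
  thus "alpha ?k = alpha g + alpha h \<and> beta ?k = beta g + beta h"
    by (simp add: alpha_def beta_def distrib_right sum.distrib)
qed

lemma shear_inj: "inj (shear \<alpha> \<beta>)"
  by (rule inj_on_inverseI[of _ "shear (- \<alpha>) (- \<beta>)"]) (simp add: shear_add shear_0)

text \<open>
  The group permutes the orbit of \<open>z\<close>.
\<close>

lemma N_in_R: "N \<in> R"
  unfolding R_iff
proof (intro conjI ballI)
  show "N \<in> polys 3"
    unfolding N_eq z_conj_def
    by (intro subalgebra_prod[OF subalgebra_polys] shear_polys) (simp add: polys_Var)
  fix g assume g: "g \<in> E"
  let ?\<sigma> = "shear (alpha g) (beta g)"
  have "?\<sigma> ` z_conj ` E \<subseteq> z_conj ` E"
  proof safe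
    fix h assume h: "h \<in> E"
    obtain k where k: "k \<in> E" "alpha k = alpha g + alpha h" "beta k = beta g + beta h"
      using E_closed[OF g h] by blast
    have "?\<sigma> (z_conj h) = z_conj k" by (simp add: z_conj_def shear_add k)
    thus "?\<sigma> (z_conj h) \<in> z_conj ` E" using k(1) by simp
  qed
  moreover have inj: "inj_on ?\<sigma> (z_conj ` E)"
    using shear_inj inj_on_subset by blast
  ultimately have image: "?\<sigma> ` z_conj ` E = z_conj ` E"
    using finite_E by (intro endo_inj_surj) auto
  have "N = prod (\<lambda>f. f) (z_conj ` E)"
    by (simp add: N_eq prod.reindex inj_z_conj)
  also have "\<dots> = prod (\<lambda>f. f) (?\<sigma> ` z_conj ` E)"
    by (simp only: image)
  also have "\<dots> = prod ?\<sigma> (z_conj ` E)"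
    using inj by (simp only: prod.reindex comp_def)
  also have "\<dots> = ?\<sigma> N"
    by (simp add: N_eq shear_simps prod.reindex inj_z_conj)
  finally show "?\<sigma> N = N" by simp
qed

text \<open>
  The value of \<open>z\<close> at which the conjugate of \<open>z\<close> vanishes.
\<close>

definition z_root :: "(4 \<Rightarrow> int) \<Rightarrow> 'a mpoly" where
  "z_root g = - (Const (2 * alpha g) * Y + Const ((alpha g)\<^sup>2 + beta g) * X)"

lemma z_conj_z_root: "z_conj g = Z - z_root g"
  by (simp add: z_conj_eq z_root_def add.assoc)

lemma set_z_root_z_conj: "set_z_to (z_root h) (z_conj g) = z_root h - z_root g"
  by (simp add: z_conj_z_root z_root_def set_z_to_simps set_z_to_Var)

lemma z_conj_dvd_iff: "z_conj g dvd f \<longleftrightarrow> set_z_to (z_root g) f = 0"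
proof
  assume "z_conj g dvd f"
  then obtain q where "f = z_conj g * q" by (elim dvdE)
  thus "set_z_to (z_root g) f = 0"
    by (simp add: set_z_to_simps set_z_root_z_conj)
next
  assume "set_z_to (z_root g) f = 0"
  thus "z_conj g dvd f"
    using dvd_set_z_to[of "z_root g" f] by (simp add: z_conj_z_root)
qed

text \<open>
  Invariance carries the factor \<open>z\<close> to all its conjugates. They are distinct and linear in \<open>z\<close> with
  lead coefficient one, so their product divides as well.
\<close>

lemma N_dvd:
  assumes f: "f \<in> R" and z: "set_z_to 0 f = 0"
  shows "N dvd f"
proof -
  have dvd: "z_conj g dvd f" if g: "g \<in> E" for g
  proof -
    have "Z dvd f" using dvd_set_z_to[of 0 f] z by simp
    then obtain q where "f = Z * q" by (elim dvdE)
    hence "shear (alpha g) (beta g) f = z_conj g * shear (alpha g) (beta g) q"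
      by (simp add: shear_simps z_conj_def)
    thus ?thesis using f g by (simp add: R_iff)
  qed
  have "prod z_conj A dvd f" if "A \<subseteq> E" for A
    using finite_subset[OF that finite_E] that
  proof (induction A)
    case (insert g A)
    then obtain q where q: "f = prod z_conj A * q" by (auto elim: dvdE)
    have "set_z_to (z_root g) (prod z_conj A) \<noteq> 0"
    proof -
      have "z_root g - z_root h \<noteq> 0" if "h \<in> A" for h
        using that insert inj_z_conj by (auto simp: z_conj_z_root inj_on_def)
      thus ?thesis using insert.hyps(1) by (simp add: set_z_to_simps set_z_root_z_conj)
    qed
    moreover have "set_z_to (z_root g) f = 0"
      using dvd insert.prems by (simp add: z_conj_dvd_iff)
    ultimately have "z_conj g dvd q"
      by (simp add: q set_z_to_simps z_conj_dvd_iff)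
    thus ?case
      using insert.hyps by (simp add: q mult.commute[of "z_conj g"] mult_dvd_mono)
  qed simp
  thus ?thesis unfolding N_eq by blast
qed

end

section \<open>Finite extensions by powers of one element\<close>

definition power_span :: "'a::field mpoly set \<Rightarrow> 'a mpoly \<Rightarrow> nat \<Rightarrow> 'a mpoly set" where
  "power_span C y n = {(\<Sum>i<n. s i * y ^ i) | s. \<forall>i<n. s i \<in> C}"

context
  fixes C :: "'a::field mpoly set" and y :: "'a mpoly" and n :: nat
  assumes C: "subalgebra C"
begin

lemma power_span_0: "0 \<in> power_span C y n"
  unfolding power_span_def by (rule CollectI, rule exI[of _ "\<lambda>_. 0"]) (simp add: subalgebra_0[OF C])

lemma power_span_add: "f \<in> power_span C y n \<Longrightarrow> g \<in> power_span C y n \<Longrightarrow> f + g \<in> power_span C y n"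
proof -
  assume "f \<in> power_span C y n" "g \<in> power_span C y n"
  then obtain s t where "f = (\<Sum>i<n. s i * y ^ i)" "\<forall>i<n. s i \<in> C"
    "g = (\<Sum>i<n. t i * y ^ i)" "\<forall>i<n. t i \<in> C"
    by (auto simp: power_span_def)
  thus ?thesis
    unfolding power_span_def
    by (intro CollectI exI[of _ "\<lambda>i. s i + t i"]) (auto simp: sum.distrib distrib_right subalgebra_add[OF C])
qed

lemma power_span_mult: "c \<in> C \<Longrightarrow> f \<in> power_span C y n \<Longrightarrow> c * f \<in> power_span C y n"
proof -
  assume c: "c \<in> C" and "f \<in> power_span C y n"
  then obtain s where "f = (\<Sum>i<n. s i * y ^ i)" "\<forall>i<n. s i \<in> C"
    by (auto simp: power_span_def)
  thus ?thesis
    unfolding power_span_def using c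
    by (intro CollectI exI[of _ "\<lambda>i. c * s i"]) (auto simp: sum_distrib_left mult.assoc subalgebra_mult[OF C])
qed

lemma power_span_uminus: "f \<in> power_span C y n \<Longrightarrow> - f \<in> power_span C y n"
  using power_span_mult[of "Const (- 1)" f] subalgebra_Const[OF C, of "- 1"] by (simp add: Const_uminus)

lemma power_span_diff: "f \<in> power_span C y n \<Longrightarrow> g \<in> power_span C y n \<Longrightarrow> f - g \<in> power_span C y n"
  using power_span_add[of f "- g"] power_span_uminus[of g] by simp

lemma power_span_sum: "(\<And>i. i \<in> I \<Longrightarrow> F i \<in> power_span C y n) \<Longrightarrow> sum F I \<in> power_span C y n"
  by (induction I rule: infinite_finite_induct) (auto intro: power_span_0 power_span_add)

lemma power_span_power: "i < n \<Longrightarrow> y ^ i \<in> power_span C y n"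
proof -
  assume i: "i < n"
  have "(\<Sum>j<n. (if j = i then 1 else 0) * y ^ j) = (\<Sum>j<n. if j = i then y ^ i else 0)"
    by (intro sum.cong) auto
  also have "\<dots> = y ^ i" using i by simp
  finally show ?thesis
    unfolding power_span_def
    by (intro CollectI exI[of _ "\<lambda>j. if j = i then 1 else 0"]) (auto simp: subalgebra_0[OF C] subalgebra_1[OF C])
qed

lemma power_span_scaled_power: "c \<in> C \<Longrightarrow> i < n \<Longrightarrow> c * y ^ i \<in> power_span C y n"
  by (intro power_span_mult power_span_power)

context
  assumes integral: "y ^ n \<in> power_span C y n" and n_pos: "n > 0"
begin

text \<open>
  If \<open>y\<^sup>n\<close> is a \<open>C\<close>-combination of lower powers, so are all higher powers of \<open>y\<close>, and the combinations of the
  powers below \<open>n\<close> form an algebra.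
\<close>

lemma power_span_times_base: "f \<in> power_span C y n \<Longrightarrow> y * f \<in> power_span C y n"
proof -
  assume "f \<in> power_span C y n"
  then obtain s where f: "f = (\<Sum>i<n. s i * y ^ i)" and s: "\<forall>i<n. s i \<in> C"
    by (auto simp: power_span_def)
  have "y * f = (\<Sum>i<n. s i * y ^ Suc i)"
    by (simp add: f sum_distrib_left algebra_simps)
  also have "\<dots> \<in> power_span C y n"
  proof (intro power_span_sum power_span_mult)
    fix i assume i: "i \<in> {..<n}"
    thus "s i \<in> C" using s by simp
    show "y ^ Suc i \<in> power_span C y n"
      using i integral power_span_power[of "Suc i"] by (cases "Suc i = n") auto
  qed
  finally show ?thesis .
qed

lemma power_span_times_power: "f \<in> power_span C y n \<Longrightarrow> y ^ k * f \<in> power_span C y n"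
  by (induction k) (auto simp: mult.assoc power_span_times_base)

lemma power_span_all_powers: "c \<in> C \<Longrightarrow> c * y ^ k \<in> power_span C y n"
  using power_span_times_power[of 1 k] power_span_power[of 0] n_pos by (intro power_span_mult) auto

lemma subalgebra_power_span: "subalgebra (power_span C y n)"
  unfolding subalgebra_def
proof (intro conjI ballI allI)
  show "Const c \<in> power_span C y n" for c
    using power_span_all_powers[of "Const c" 0] subalgebra_Const[OF C] by simp
  fix f g assume f: "f \<in> power_span C y n" and g: "g \<in> power_span C y n"
  show "f + g \<in> power_span C y n" by (rule power_span_add[OF f g])
  obtain s where s: "f = (\<Sum>i<n. s i * y ^ i)" "\<forall>i<n. s i \<in> C"
    using f by (auto simp: power_span_def)
  have "f * g = (\<Sum>i<n. s i * (y ^ i * g))"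
    by (simp add: s sum_distrib_right mult.assoc)
  also have "\<dots> \<in> power_span C y n"
    using s by (intro power_span_sum power_span_mult power_span_times_power g) auto
  finally show "f * g \<in> power_span C y n" .
qed

lemma power_span_base: "y \<in> power_span C y n"
  using power_span_all_powers[of 1 1] subalgebra_1[OF C] by simp

lemma power_span_coeffs: "C \<subseteq> power_span C y n"
  using power_span_all_powers[of _ 0] by auto

end

end

section \<open>The invariants after inverting x\<close>

context rank_four
begin

definition S :: "'a mpoly set" where "S = generated_algebra {X, H1, H2}"

lemma subalgebra_S: "subalgebra S"
  unfolding S_def by (rule subalgebra_generated)

lemma generators_S: "X \<in> S" "H1 \<in> S" "H2 \<in> S"
  unfolding S_def by (auto intro: hull_inc)

lemma S_subset_R: "S \<subseteq> R"
  unfolding S_def using subalgebra_R X_in_R H1_in_R H2_in_R by (intro hull_minimal) auto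

definition L :: "'a mpoly" where
  "L = Y ^ p ^ 3 - Const b * Y ^ p\<^sup>2 * X ^ (p ^ 3 - p\<^sup>2) + Const c * Y ^ p * X ^ (p ^ 3 - p)
     + Const d * Y * X ^ (p ^ 3 - 1)"

lemma H2_eq_L: "H2 = L + Const a * delta * X ^ (p ^ 3 - 2)"
  by (simp add: H2_eq L_def algebra_simps)

lemma p_power_less: "i < j \<Longrightarrow> p ^ i < p ^ j"
  using p_gt_2 by (intro power_strict_increasing) auto

abbreviation "\<Lambda> \<equiv> power_span S Y (p ^ 4)"

lemmas S_closed = subalgebra_closed[OF subalgebra_S] generators_S

lemma L_in_span: "L \<in> \<Lambda>"
proof -
  have "Y ^ p ^ k \<in> \<Lambda>" if "k < 4" for k
    using p_power_less[OF that] by (intro power_span_power subalgebra_S)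
  from this[of 3] this[of 2] this[of 1] this[of 0]
  have Y: "Y ^ p ^ 3 \<in> \<Lambda>" "Y ^ p\<^sup>2 \<in> \<Lambda>" "Y ^ p \<in> \<Lambda>" "Y \<in> \<Lambda>" by simp_all
  have "L = Y ^ p ^ 3 - (Const b * X ^ (p ^ 3 - p\<^sup>2)) * Y ^ p\<^sup>2 + (Const c * X ^ (p ^ 3 - p)) * Y ^ p
     + (Const d * X ^ (p ^ 3 - 1)) * Y"
    by (simp add: L_def algebra_simps)
  also have "\<dots> \<in> \<Lambda>"
    by (intro power_span_add power_span_diff power_span_mult subalgebra_S Y S_closed)
  finally show ?thesis .
qed

text \<open>
  Eliminating \<open>\<delta>\<close> between \<open>h\<^sub>1\<close> and \<open>h\<^sub>2\<close> leaves an additive polynomial in \<open>y\<close> of degree \<open>p\<^sup>4\<close>.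
\<close>

lemma Y_integral: "Y ^ p ^ 4 \<in> \<Lambda>"
proof -
  define e where "e = p ^ 3"
  have p4: "p ^ 4 = p * e" by (simp add: e_def power_numeral_reduce)
  define P where "P = Const b * X ^ (e - p\<^sup>2)"
  define Q where "Q = Const c * X ^ (e - p)"
  define T where "T = Const d * X ^ (e - 1)"
  have PQT: "P \<in> S" "Q \<in> S" "T \<in> S"
    unfolding P_def Q_def T_def by (intro S_closed)+
  have frob: "(f + g) ^ p = f ^ p + g ^ p" "(f - g) ^ p = f ^ p - g ^ p" for f g :: "'a mpoly"
    using frobenius(1)[OF refl, of f g 1] frobenius(2)[of f g 1] by (simp_all add: CHAR_mpoly char_p)
  have L: "L = Y ^ p ^ 3 - P * Y ^ p\<^sup>2 + Q * Y ^ p + T * Y"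
    by (simp add: L_def P_def Q_def T_def e_def algebra_simps)
  have Lp: "L ^ p = Y ^ p ^ 4 - P ^ p * Y ^ p ^ 3 + Q ^ p * Y ^ p\<^sup>2 + T ^ p * Y ^ p"
    unfolding L frob power_mult_distrib
    by (simp add: power_numeral_reduce mult.commute flip: power_mult)
  have delta: "Const a * delta * X ^ (e - 2) = H2 - L"
    using H2_eq_L by (simp add: e_def)
  hence "(Const a * delta * X ^ (e - 2)) ^ p = H2 ^ p - L ^ p"
    by (simp add: frob)
  hence delta_p: "Const a ^ p * delta ^ p * X ^ (p * (e - 2)) = H2 ^ p - L ^ p"
    by (simp add: power_mult_distrib mult.commute[of p] flip: power_mult)
  \<comment> \<open>with this factor the term \<open>\<delta>^p\<close> of \<open>h\<^sub>1\<close> becomes the left-hand side of \<open>delta_p\<close>\<close>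
  define K where "K = Const a ^ p * X ^ (p * (e - 2))"
  have "2 \<le> e" using p_powers by (simp add: e_def)
  hence "p * (e - 2) + (2 * p - 2) = (p * e - e) + (e - 2)"
    using p_gt_2 by (auto simp: diff_mult_distrib2 algebra_simps)
  hence X_pow: "X ^ (p * (e - 2)) * X ^ (2 * p - 2) = (X ^ (p * e - e) * X ^ (e - 2) :: 'a mpoly)"
    by (simp flip: power_add)
  have "K * H1 = Const a ^ p * delta ^ p * X ^ (p * (e - 2)) + K * Const u * X ^ p * Y ^ p
      + Const a ^ p * Const v * delta * (X ^ (p * (e - 2)) * X ^ (2 * p - 2)) + K * Const w * X ^ (2 * p - 1) * Y"
    by (simp add: H1_eq K_def algebra_simps)
  also have "Const a ^ p = Const a ^ (p - 1) * Const a"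
    using p_gt_2 by (simp flip: power_Suc2)
  also have "Const a ^ (p - 1) * Const a * Const v * delta * (X ^ (p * (e - 2)) * X ^ (2 * p - 2))
      = Const a ^ (p - 1) * Const v * X ^ (p * e - e) * (H2 - L)"
    unfolding X_pow delta[symmetric] by (simp add: algebra_simps)
  also have "Const a ^ (p - 1) * Const a * delta ^ p * X ^ (p * (e - 2)) = H2 ^ p - L ^ p"
    using delta_p \<open>Const a ^ p = Const a ^ (p - 1) * Const a\<close> by simp
  finally have "Y ^ p ^ 4 = H2 ^ p + P ^ p * Y ^ p ^ 3 - Q ^ p * Y ^ p\<^sup>2 - T ^ p * Y ^ p - K * H1
      + K * Const u * X ^ p * Y ^ p + Const a ^ (p - 1) * Const v * X ^ (p * e - e) * (H2 - L)
      + K * Const w * X ^ (2 * p - 1) * Y"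
    unfolding Lp by (simp add: algebra_simps)
  also have "\<dots> \<in> \<Lambda>"
  proof -
    have Y: "Y ^ p ^ k \<in> \<Lambda>" if "k < 4" for k
      using p_power_less[OF that] by (intro power_span_power subalgebra_S)
    from Y[of 3] Y[of 2] Y[of 1] Y[of 0]
    have Y': "Y ^ p ^ 3 \<in> \<Lambda>" "Y ^ p\<^sup>2 \<in> \<Lambda>" "Y ^ p \<in> \<Lambda>" "Y \<in> \<Lambda>" by simp_all
    have const: "f \<in> \<Lambda>" if "f \<in> S" for f
      using power_span_scaled_power[OF subalgebra_S that, of 0 "p ^ 4" Y] p_gt_2 by simp
    have K: "K \<in> S" unfolding K_def by (intro S_closed)
    show ?thesis
      by (intro power_span_add power_span_diff power_span_mult subalgebra_S Y' L_in_span const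
          S_closed K PQT)
  qed
  finally show ?thesis .
qed

lemma p4_pos: "p ^ 4 > 0"
  using p_gt_2 by simp

lemmas subalgebra_\<Lambda> = subalgebra_power_span[OF subalgebra_S Y_integral p4_pos]

lemma S_subset_\<Lambda>: "S \<subseteq> \<Lambda>"
  by (rule power_span_coeffs[OF subalgebra_S Y_integral p4_pos])

lemma Y_in_\<Lambda>: "Y \<in> \<Lambda>"
  by (rule power_span_base[OF subalgebra_S Y_integral p4_pos])

text \<open>
  The variable \<open>z\<close> is recovered from \<open>h\<^sub>2\<close>, in which it occurs linearly with coefficient
  \<open>- a x^(p^3 - 1)\<close>.
\<close>

lemma polys_localized:
  assumes "f \<in> polys 3"
  shows "\<exists>m. X ^ m * f \<in> \<Lambda>"
proof -
  note closed = subalgebra_closed[OF subalgebra_\<Lambda>]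
  have X: "X \<in> \<Lambda>" using S_subset_\<Lambda> generators_S by blast
  have "subalgebra {f. \<exists>m. X ^ m * f \<in> \<Lambda>}"
    unfolding subalgebra_def
  proof (intro conjI ballI allI; (elim CollectE exE)?; intro CollectI)
    show "\<exists>m. X ^ m * Const r \<in> \<Lambda>" for r
      using closed(1) by (intro exI[of _ 0]) simp
    fix f g m k assume f: "X ^ m * f \<in> \<Lambda>" and g: "X ^ k * g \<in> \<Lambda>"
    have "X ^ (m + k) * (f + g) = X ^ k * (X ^ m * f) + X ^ m * (X ^ k * g)"
      by (simp add: power_add algebra_simps)
    also have "\<dots> \<in> \<Lambda>" by (intro closed X f g)
    finally show "\<exists>m. X ^ m * (f + g) \<in> \<Lambda>" ..
    have "X ^ (m + k) * (f * g) = (X ^ m * f) * (X ^ k * g)"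
      by (simp add: power_add algebra_simps)
    also have "\<dots> \<in> \<Lambda>" by (intro closed f g)
    finally show "\<exists>m. X ^ m * (f * g) \<in> \<Lambda>" ..
  qed
  moreover have "Var i \<in> {f. \<exists>m. X ^ m * f \<in> \<Lambda>}" if i: "i < 3" for i
  proof -
    consider "i = 0" | "i = 1" | "i = 2" using i by linarith
    thus ?thesis
    proof cases
      case 3
      have "Suc (p ^ 3 - 2) = p ^ 3 - 1" using p_powers(5) by linarith
      hence "X * X ^ (p ^ 3 - 2) = (X ^ (p ^ 3 - 1) :: 'a mpoly)" by (simp only: flip: power_Suc)
      hence "Const a * X ^ (p ^ 3 - 1) * Z = L - H2 + Const a * Y\<^sup>2 * X ^ (p ^ 3 - 2)"
        unfolding H2_eq_L delta_def by (simp add: algebra_simps)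
      also have "\<dots> \<in> \<Lambda>"
        using S_subset_\<Lambda> generators_S by (intro closed X L_in_span Y_in_\<Lambda>) auto
      finally have "Const (inverse a) * (Const a * X ^ (p ^ 3 - 1) * Z) \<in> \<Lambda>"
        by (rule closed(3)[OF closed(1)])
      also have "Const (inverse a) * (Const a * X ^ (p ^ 3 - 1) * Z) = X ^ (p ^ 3 - 1) * Z"
        using Const_inverse[OF a_nonzero] by (simp flip: mult.assoc)
      finally show ?thesis using 3 by blast
    qed (use X Y_in_\<Lambda> in \<open>auto intro!: exI[of _ 0]\<close>)
  qed
  ultimately show ?thesis
    using polys_subset_subalgebra assms by blast
qed

text \<open>
  Write \<open>x\<^sup>m f = \<Sum> s\<^sub>i y\<^sup>i\<close> with invariant \<open>s\<^sub>i\<close> and \<open>i < p\<^sup>4\<close>. Applying the group shows that the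
  polynomial \<open>\<Sum> s\<^sub>i T\<^sup>i - x\<^sup>m f\<close> in \<open>T\<close> has the \<open>p\<^sup>4\<close> roots \<open>y + \<alpha>x\<close>, more than its degree permits.
\<close>

theorem R_localized:
  assumes f: "f \<in> R"
  shows "\<exists>m. X ^ m * f \<in> S"
proof -
  obtain m where "X ^ m * f \<in> \<Lambda>" using polys_localized R_polys[OF f] by blast
  then obtain s where s: "X ^ m * f = (\<Sum>i<p ^ 4. s i * Y ^ i)" "\<forall>i<p ^ 4. s i \<in> S"
    by (auto simp: power_span_def)
  define G where "G = (\<Sum>i<p ^ 4. Polynomial.monom (s i) i) - [:X ^ m * f:]"
  have root: "poly G (Y + Const (alpha g) * X) = 0" if g: "g \<in> E" for g
  proof -
    have "X ^ m * f = shear (alpha g) (beta g) (X ^ m * f)"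
      using f g by (simp add: R_iff shear_simps shear_Var)
    also have "\<dots> = (\<Sum>i<p ^ 4. s i * (Y + Const (alpha g) * X) ^ i)"
      unfolding s(1) using s(2) S_subset_R g by (auto simp: shear_simps shear_Var R_iff intro!: sum.cong)
    finally show ?thesis by (simp add: G_def poly_sum poly_monom)
  qed
  have "G = 0"
  proof (rule ccontr)
    assume nz: "G \<noteq> 0"
    have "inj_on (\<lambda>g. Y + Const (alpha g) * X) E"
      using alpha_inj by (auto simp: inj_on_def Const_eq_iff)
    hence "p ^ 4 = card ((\<lambda>g. Y + Const (alpha g) * X) ` E)"
      by (simp add: card_image card_E)
    also have "\<dots> \<le> card {x. poly G x = 0}"
      using root nz by (intro card_mono poly_roots_finite) auto
    also have "\<dots> \<le> degree G"
      by (rule card_poly_roots_bound[OF nz])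
    also have "degree G \<le> p ^ 4 - 1"
      using p4_pos by (intro degree_le) (auto simp: G_def coeff_sum coeff_pCons split: nat.split)
    finally show False using p4_pos by linarith
  qed
  hence "coeff G 0 = 0" by simp
  moreover have "coeff G 0 = s 0 - X ^ m * f"
    using p4_pos by (simp add: G_def coeff_sum)
  moreover have "s 0 \<in> S" using s(2) p4_pos by blast
  ultimately show ?thesis by (intro exI[of _ m]) simp
qed

end

section \<open>Integrality by the characteristic polynomial\<close>

text \<open>
  If multiplication by \<open>z\<close> preserves the \<open>C\<close>-module spanned by the powers of \<open>y\<close> below \<open>n\<close>, it is given
  there by an \<open>n \<times> n\<close> matrix \<open>A\<close> over \<open>C\<close>. The matrix \<open>z - A\<close> annihilates the vector of powers of \<open>y\<close>, whose
  first entry is 1, so its determinant vanishes; hence \<open>z\<close> is a root of the characteristic polynomial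
  of \<open>A\<close>, which is monic of degree \<open>n\<close> with coefficients in \<open>C\<close>.
\<close>

lemma power_span_integral:
  assumes C: "subalgebra C" and n: "n > 0"
    and mult: "\<And>i. i < n \<Longrightarrow> z * y ^ i \<in> power_span C y n"
  shows "z ^ n \<in> power_span C z n"
proof -
  have "\<exists>m. \<forall>i<n. (\<forall>j<n. m i j \<in> C) \<and> z * y ^ i = (\<Sum>j<n. m i j * y ^ j)"
  proof -
    have "\<forall>i. \<exists>r. i < n \<longrightarrow> (\<forall>j<n. r j \<in> C) \<and> z * y ^ i = (\<Sum>j<n. r j * y ^ j)"
      using mult by (auto simp: power_span_def)
    thus ?thesis by metis
  qed
  then obtain m where m: "\<And>i j. i < n \<Longrightarrow> j < n \<Longrightarrow> m i j \<in> C"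
    and zy: "\<And>i. i < n \<Longrightarrow> z * y ^ i = (\<Sum>j<n. m i j * y ^ j)"
    by blast
  define A where "A = mat n n (\<lambda>(i, j). m i j)"
  define B where "B = mat n n (\<lambda>(i, j). (if i = j then z else 0) - m i j)"
  define x where "x = vec n (\<lambda>j. y ^ j)"
  have A: "A \<in> carrier_mat n n" and B: "B \<in> carrier_mat n n" and x: "x \<in> carrier_vec n"
    by (simp_all add: A_def B_def x_def)
  have "B *\<^sub>v x = 0\<^sub>v n"
  proof (rule eq_vecI)
    fix i assume i: "i < dim_vec (0\<^sub>v n :: 'a mpoly Matrix.vec)"
    have "vec_index (B *\<^sub>v x) i = (\<Sum>j<n. ((if i = j then z else 0) - m i j) * y ^ j)"
      using i by (simp add: B_def x_def scalar_prod_def atLeast0LessThan)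
    also have "\<dots> = (\<Sum>j<n. if i = j then z * y ^ i else 0) - (\<Sum>j<n. m i j * y ^ j)"
      unfolding sum_subtractf[symmetric] by (intro sum.cong) (auto simp: left_diff_distrib)
    also have "\<dots> = 0" using i zy by simp
    finally show "vec_index (B *\<^sub>v x) i = vec_index (0\<^sub>v n) i" using i by simp
  qed (simp add: B_def)
  moreover have "adj_mat B *\<^sub>v 0\<^sub>v n = 0\<^sub>v n"
    using adj_mat(1)[OF B] by (intro eq_vecI) auto
  ultimately have "adj_mat B *\<^sub>v (B *\<^sub>v x) = 0\<^sub>v n"
    by simp
  moreover have "adj_mat B *\<^sub>v (B *\<^sub>v x) = det B \<cdot>\<^sub>v x"
  proof -
    have "adj_mat B *\<^sub>v (B *\<^sub>v x) = (det B \<cdot>\<^sub>m 1\<^sub>m n) *\<^sub>v x"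
      using adj_mat[OF B] B x by (simp flip: assoc_mult_mat_vec)
    also have "\<dots> = det B \<cdot>\<^sub>v x"
    proof (rule eq_vecI)
      fix i assume "i < dim_vec (det B \<cdot>\<^sub>v x)"
      hence i: "i < n" using x by simp
      have "vec_index ((det B \<cdot>\<^sub>m 1\<^sub>m n) *\<^sub>v x) i = (\<Sum>j<n. det B * (if j = i then 1 else 0) * vec_index x j)"
        using x i by (simp add: scalar_prod_def atLeast0LessThan)
      also have "\<dots> = (\<Sum>j<n. if i = j then det B * vec_index x i else 0)"
        by (intro sum.cong) auto
      finally show "vec_index ((det B \<cdot>\<^sub>m 1\<^sub>m n) *\<^sub>v x) i = vec_index (det B \<cdot>\<^sub>v x) i"
        using x i by simp
    qed (use x in simp)
    finally show ?thesis .
  qed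
  ultimately have "vec_index (det B \<cdot>\<^sub>v x) 0 = 0" using n by simp
  hence det_B: "det B = 0" using n by (simp add: x_def)

  have char_poly_z: "poly (char_poly A) z = 0"
    unfolding char_poly_def det_B[symmetric]
    by (rule poly_det_cong[OF B]) (auto simp: char_poly_matrix_def A_def B_def)
  have deg: "degree (char_poly A) = n" "coeff (char_poly A) n = 1"
    using degree_monic_char_poly[OF A] by auto

  \<comment> \<open>the polynomials with coefficients in \<open>C\<close> form a ring, so the determinant stays among them\<close>
  define Q where "Q = {q. \<forall>k. coeff q k \<in> C}"
  have Q_mult: "q * r \<in> Q" if "q \<in> Q" "r \<in> Q" for q r
    using that by (auto simp: Q_def coeff_mult intro!: subalgebra_closed[OF C])
  have Q_1: "1 \<in> Q" by (auto simp: Q_def subalgebra_closed[OF C])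
  have Q_prod: "prod F I \<in> Q" if "\<And>i. i \<in> I \<Longrightarrow> F i \<in> Q" for F and I :: "nat set"
    using that by (induction I rule: infinite_finite_induct) (auto simp: Q_1 intro: Q_mult)
  have entry: "char_poly_matrix A $$ (i, j) \<in> Q" if "i < n" "j < n" for i j
    using that m by (auto simp: char_poly_matrix_def A_def Q_def coeff_pCons subalgebra_closed[OF C] split: nat.split)
  have "char_poly A \<in> Q"
  proof -
    have "signof \<sigma> * q \<in> Q" if "q \<in> Q" for \<sigma> :: "nat \<Rightarrow> nat" and q
      using that by (cases \<sigma> rule: sign_cases) (auto simp: Q_def subalgebra_closed[OF C])
    moreover have "(\<Prod>i = 0..<n. char_poly_matrix A $$ (i, \<sigma> i)) \<in> Q" if "\<sigma> permutes {0..<n}" for \<sigma>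
      using permutes_in_image[OF that] by (intro Q_prod entry) auto
    ultimately have "signof \<sigma> * (\<Prod>i = 0..<n. char_poly_matrix A $$ (i, \<sigma> i)) \<in> Q" if "\<sigma> permutes {0..<n}" for \<sigma>
      using that by blast
    thus ?thesis
      unfolding char_poly_def det_def'[OF char_poly_matrix_closed[OF A]]
      by (auto simp: Q_def coeff_sum intro!: subalgebra_sum[OF C])
  qed
  have "0 = (\<Sum>k\<le>n. coeff (char_poly A) k * z ^ k)"
    using char_poly_z by (simp add: poly_altdef deg)
  also have "\<dots> = (\<Sum>k<n. coeff (char_poly A) k * z ^ k) + z ^ n"
    by (simp add: deg flip: lessThan_Suc_atMost)
  finally have "z ^ n = - (\<Sum>k<n. coeff (char_poly A) k * z ^ k)"
    by (simp add: eq_neg_iff_add_eq_0 add.commute)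
  also have "\<dots> \<in> power_span C z n"
    using \<open>char_poly A \<in> Q\<close>
    by (intro power_span_uminus[OF C] power_span_sum[OF C] power_span_scaled_power[OF C]) (auto simp: Q_def)
  finally show ?thesis .
qed

section \<open>Linear combinations of products\<close>

text \<open>
  The linear combinations of the values \<open>ev (Monom K)\<close> for \<open>K\<close> in \<open>A\<close>. Their coefficients are kept as a
  polynomial, so that linear independence of the values is injectivity of \<open>ev\<close>.
\<close>

definition combinations :: "('a::field mpoly \<Rightarrow> 'a mpoly) \<Rightarrow> monomial set \<Rightarrow> 'a mpoly set" where
  "combinations ev A = ev ` {f. keys f \<subseteq> A}"

context
  fixes ev :: "'a::field mpoly \<Rightarrow> 'a mpoly"
  assumes ev: "alg_hom ev"
begin

lemma combinations_0: "0 \<in> combinations ev A"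
  unfolding combinations_def by (rule image_eqI[of _ _ 0]) (simp_all add: alg_hom_0[OF ev])

lemma combinations_Monom: "I \<in> A \<Longrightarrow> ev (Monom I) \<in> combinations ev A"
  unfolding combinations_def by (rule imageI) simp

lemma combinations_add: "f \<in> combinations ev A \<Longrightarrow> g \<in> combinations ev A \<Longrightarrow> f + g \<in> combinations ev A"
proof -
  assume "f \<in> combinations ev A" "g \<in> combinations ev A"
  then obtain f' g' where fg: "f = ev f'" "g = ev g'" "keys f' \<subseteq> A" "keys g' \<subseteq> A"
    by (auto simp: combinations_def)
  have "ev (f' + g') \<in> combinations ev A"
    unfolding combinations_def using fg keys_add[of f' g'] by (intro imageI) auto
  thus ?thesis by (simp add: fg alg_hom_add[OF ev])
qed

lemma combinations_Const_mult: "f \<in> combinations ev A \<Longrightarrow> Const c * f \<in> combinations ev A"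
proof -
  assume "f \<in> combinations ev A"
  then obtain f' where f: "f = ev f'" "keys f' \<subseteq> A"
    by (auto simp: combinations_def)
  have "ev (Const c * f') \<in> combinations ev A"
    unfolding combinations_def using f
    by (intro imageI) (auto simp: in_keys_iff lookup_Const_mult)
  thus ?thesis by (simp add: f alg_hom_mult[OF ev] alg_hom_Const[OF ev])
qed

lemma combinations_Monom_mult:
  assumes "f \<in> combinations ev A" "\<And>K. K \<in> A \<Longrightarrow> I + K \<in> B"
  shows "ev (Monom I) * f \<in> combinations ev B"
proof -
  obtain f' where f: "f = ev f'" "keys f' \<subseteq> A"
    using assms(1) by (auto simp: combinations_def)
  have "ev (Monom I * f') \<in> combinations ev B"
    unfolding combinations_def using f assms(2) by (intro imageI) (auto simp: keys_Monom_mult)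
  thus ?thesis by (simp add: f alg_hom_mult[OF ev])
qed

lemma combinations_mono: "A \<subseteq> B \<Longrightarrow> combinations ev A \<subseteq> combinations ev B"
  by (auto simp: combinations_def)

lemma combinations_sum: "(\<And>i. i \<in> I \<Longrightarrow> F i \<in> combinations ev A) \<Longrightarrow> sum F I \<in> combinations ev A"
  by (induction I rule: infinite_finite_induct) (auto intro: combinations_0 combinations_add)

text \<open>
  Values with distinct lead monomials cannot cancel each other's lead terms.
\<close>

lemma lead_of_combination:
  assumes nz: "f \<noteq> 0" and keys: "keys f \<subseteq> A"
    and lead: "\<And>K. K \<in> A \<Longrightarrow> ev (Monom K) \<noteq> 0 \<and> LM (ev (Monom K)) = \<phi> K"
    and inj: "inj_on \<phi> A"
  shows "\<exists>K\<in>keys f. is_LM (ev f) (\<phi> K) \<and>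
    (\<forall>J\<in>keys f. J \<noteq> K \<longrightarrow> grevlex_less (\<phi> J) (\<phi> K))"
proof -
  obtain K where K: "K \<in> keys f"
    and max: "\<forall>t\<in>\<phi> ` keys f. t \<noteq> \<phi> K \<longrightarrow> grevlex_less t (\<phi> K)"
    using grevlex.finite_has_max[of "\<phi> ` keys f"] nz by auto
  have smaller: "grevlex_less (\<phi> J) (\<phi> K)" if "J \<in> keys f" "J \<noteq> K" for J
    using that max K keys inj by (metis imageI inj_on_contraD subsetD)
  let ?t = "\<lambda>J. Const (lookup f J) * ev (Monom J)"
  have ev_f: "ev f = ?t K + (\<Sum>J\<in>keys f - {K}. ?t J)"
    unfolding alg_hom_expand[OF ev, of f] using K by (simp add: sum.remove)
  have t: "is_LM (?t J) (\<phi> J)" if "J \<in> keys f" for J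
    using that lead[of J] keys is_LM_LM[of "ev (Monom J)"]
    by (auto simp: grevlex.lead_Const_mult in_keys_iff)
  have "is_LM (ev f) (\<phi> K)"
    unfolding ev_f
  proof (rule grevlex.lead_add_smaller(1)[OF t[OF K]])
    fix m assume "m \<in> keys (\<Sum>J\<in>keys f - {K}. ?t J)"
    then obtain J where J: "J \<in> keys f" "J \<noteq> K" "m \<in> keys (?t J)"
      by (blast dest: keys_sumD)
    hence "m = \<phi> J \<or> grevlex_less m (\<phi> J)"
      using t[of J] by (auto simp: grevlex.is_lead_def)
    thus "grevlex_less m (\<phi> K)"
      using smaller[OF J(1,2)] grevlex.trans by blast
  qed
  thus ?thesis using K smaller by blast
qed

lemma combination_eq_0:
  assumes "ev f = 0" "keys f \<subseteq> A"
    and "\<And>K. K \<in> A \<Longrightarrow> ev (Monom K) \<noteq> 0 \<and> LM (ev (Monom K)) = \<phi> K" "inj_on \<phi> A"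
  shows "f = 0"
  using lead_of_combination[OF _ assms(2-4)] assms(1) by (auto simp: grevlex.is_lead_def)

end

lemma split_polynomial:
  "\<exists>g h. f = g + h \<and> keys g \<subseteq> keys f \<inter> A \<and>
     keys h \<subseteq> keys (f :: 'a::field mpoly) - A"
proof -
  let ?t = "\<lambda>m. Const (lookup f m) * Monom m"
  have "f = (\<Sum>m\<in>keys f \<inter> A. ?t m) + (\<Sum>m\<in>keys f - A. ?t m)"
    by (subst mpoly_expand) (rule sum.Int_Diff[OF finite_keys])
  moreover have "keys (sum ?t B) \<subseteq> B" for B
    by (auto simp: Const_mult_Monom dest!: keys_sumD split: if_splits)
  ultimately show ?thesis by blast
qed

lemma Var_dvd:
  assumes "\<And>m. m \<in> keys f \<Longrightarrow> lookup m i > 0"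
  shows "Var i dvd f"
proof -
  have "Var i dvd Const (lookup f m) * Monom m" if "m \<in> keys f" for m
  proof -
    have "m = single i 1 + (m - single i 1)"
      using assms[OF that] by (intro poly_mapping_eqI)
        (auto simp: lookup_add minus_poly_mapping.rep_eq lookup_single when_def)
    hence "Monom m = Var i * Monom (m - single i 1)"
      unfolding Var_def by (metis Monom_add)
    hence "Var i dvd Monom m" by (rule dvdI)
    thus ?thesis by (rule dvd_mult)
  qed
  thus ?thesis by (subst mpoly_expand) (intro dvd_sum)
qed

lemma keys_set_z_to_0: "keys (set_z_to 0 f) \<subseteq> keys f"
proof
  fix t assume "t \<in> keys (set_z_to 0 f)"
  then obtain m where m: "m \<in> keys f"
      "t \<in> keys (Const (lookup f m) * set_z_to 0 (Monom m))"
    unfolding alg_hom_expand[OF alg_hom_set_z_to, of 0 f] by (blast dest: keys_sumD)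
  have "set_z_to 0 (Monom m) = (if 2 \<in> keys m then 0 else Monom m :: 'a mpoly)"
  proof (cases "2 \<in> keys m")
    case True
    thus ?thesis
      unfolding alg_hom_Monom[OF alg_hom_set_z_to] by (auto simp: set_z_to_Var in_keys_iff intro!: bexI[of _ 2])
  next
    case False
    thus ?thesis
      unfolding alg_hom_Monom[OF alg_hom_set_z_to] unfolding Monom_expand[of m]
      by (auto simp: set_z_to_Var intro!: prod.cong)
  qed
  thus "t \<in> keys f" using m by (auto simp: Const_mult_Monom split: if_splits)
qed

section \<open>Restriction to the curve z = 0\<close>

text \<open>
  Modulo \<open>p\<close> the sum is \<open>2j\<close>, which determines \<open>j\<close>; as \<open>p\<close> is odd, the parity of the rest determines \<open>e\<close>.
\<close>

lemma exponent_unique: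
  fixes p :: nat
  assumes p: "prime p" "p > 2"
    and eq: "2 * p * i + p ^ 3 * e + (p ^ 3 + 2) * j = 2 * p * i' + p ^ 3 * e' + (p ^ 3 + 2) * j'"
    and bounds: "e < 2" "e' < 2" "j < p" "j' < p"
  shows "i = i' \<and> e = e' \<and> j = j'"
proof -
  have odd: "odd p" using p prime_odd_nat by blast
  have "int p dvd 2 * (int j - int j')"
  proof -
    have "2 * (int j - int j') = int p * (2 * (int i' - int i) + int p ^ 2 * (int e' - int e)
        + int p ^ 2 * (int j' - int j))"
      using arg_cong[OF eq, of int] by (simp add: power2_eq_square power3_eq_cube algebra_simps)
    thus ?thesis by (metis dvd_triv_left)
  qed
  moreover have "\<not> int p dvd 2"
    using p(2) by (auto dest!: zdvd_imp_le)
  moreover have "prime (int p)" using p(1) by simp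
  ultimately have "int p dvd int j - int j'"
    by (blast dest: prime_dvd_multD)
  hence "int j mod int p = int j' mod int p"
    by (simp add: mod_eq_dvd_iff)
  hence j: "j = j'" using bounds by simp
  hence eq': "2 * p * i + p ^ 3 * e = 2 * p * i' + p ^ 3 * e'" using eq by simp
  hence "even (2 * p * i + p ^ 3 * e) = even (2 * p * i' + p ^ 3 * e')" by simp
  hence "even e = even e'" using odd by simp
  hence e: "e = e'" using bounds by (auto simp: less_2_cases_iff)
  thus ?thesis using eq' j p(2) by simp
qed

context rank_four
begin

definition B :: "'a mpoly list" where "B = [X, H1, H2, H3, N]"

abbreviation \<epsilon> :: "'a mpoly \<Rightarrow> 'a mpoly" where "\<epsilon> \<equiv> eval_at B"

lemma alg_hom_eval: "alg_hom \<epsilon>"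
  unfolding eval_at_def by (rule alg_hom_subst)

lemma eval_Var: "\<epsilon> (Var 0) = X" "\<epsilon> (Var 1) = H1" "\<epsilon> (Var 2) = H2" "\<epsilon> (Var 3) = H3" "\<epsilon> (Var 4) = N"
  by (simp_all add: eval_at_def B_def)

lemma lessThan_5: "{..<5} = {0, 1, 2, 3, 4 :: nat}"
  by auto

lemma alg_hom_Monom5:
  assumes "alg_hom h" "K \<in> exps 5"
  shows "h (Monom K) = h (Var 0) ^ lookup K 0 * h (Var 1) ^ lookup K 1 * h (Var 2) ^ lookup K 2 *
    h (Var 3) ^ lookup K 3 * h (Var 4) ^ lookup K 4"
proof -
  have "h (Monom K) = (\<Prod>i\<in>{..<5}. h (Var i) ^ lookup K i)"
    unfolding alg_hom_Monom[OF assms(1)] using assms(2)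
    by (intro prod_powers_superset) (auto simp: exps_def)
  thus ?thesis by (simp add: lessThan_5 mult.assoc)
qed

lemma eval_Monom:
  "K \<in> exps 5 \<Longrightarrow> \<epsilon> (Monom K) = X ^ lookup K 0 * H1 ^ lookup K 1 * H2 ^ lookup K 2 * H3 ^ lookup K 3 * N ^ lookup K 4"
  using alg_hom_Monom5[OF alg_hom_eval] unfolding eval_Var .

text \<open>
  The lead monomial of the product of the five generators with exponents \<open>K\<close>.
\<close>

definition \<phi> :: "monomial \<Rightarrow> monomial" where
  "\<phi> K = single 0 (lookup K 0)
     + single 1 (2 * p * lookup K 1 + p ^ 3 * lookup K 2 + (p ^ 3 + 2) * lookup K 3)
     + single 2 (p ^ 4 * lookup K 4)"

lemma lookup_\<phi>:
  "lookup (\<phi> K) 0 = lookup K 0"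
  "lookup (\<phi> K) (Suc 0) = 2 * p * lookup K 1 + p ^ 3 * lookup K 2 + (p ^ 3 + 2) * lookup K 3"
  "lookup (\<phi> K) 2 = p ^ 4 * lookup K 4"
  by (simp_all add: \<phi>_def lookup_add lookup_single)

lemma lead_X: "X \<noteq> (0 :: 'a mpoly)" "LM (X :: 'a mpoly) = single 0 1" "LC (X :: 'a mpoly) = 1"
  by (simp_all add: Var_def LC_def lookup_Monom)

lemma lead_eval_Monom:
  assumes K: "K \<in> exps 5"
  shows "\<epsilon> (Monom K) \<noteq> 0" "LM (\<epsilon> (Monom K)) = \<phi> K" "LC (\<epsilon> (Monom K)) = 1"
proof -
  note nz = lead_X(1) lead_H1(1) lead_H2(1) lead_H3(1) lead_N(1)
  note lm = lead_X(2) lead_H1(2) lead_H2(2) lead_H3(2) lead_N(2)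
  note lc = lead_X(3) lead_H1(3) lead_H2(3) lead_H3(3) lead_N(3)
  show "\<epsilon> (Monom K) \<noteq> 0"
    unfolding eval_Monom[OF K] using nz by simp
  show "LM (\<epsilon> (Monom K)) = \<phi> K"
    unfolding eval_Monom[OF K] \<phi>_def
    by (rule poly_mapping_eqI) (simp add: LM_mult LM_power nz lm lookup_add lookup_single when_def algebra_simps)
  show "LC (\<epsilon> (Monom K)) = 1"
    unfolding eval_Monom[OF K] by (simp add: LC_mult LC_power nz lc)
qed

text \<open>
  The exponents of the products in the generators that are not divisible by \<open>h\<^sub>2\<^sup>2\<close> or \<open>h\<^sub>3\<^sup>p\<close>.
\<close>

definition normal :: "monomial set" where
  "normal = {K \<in> exps 5. lookup K 2 < 2 \<and> lookup K 3 < p}"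

text \<open>
  The normal exponents without \<open>N\<close>, filtered by the exponent of \<open>h\<^sub>3\<close>. The bound \<open>k\<close> is the induction
  parameter in \<open>s0_power_in_normal_span0\<close>; for \<open>k = p - 1\<close> all normal exponents without \<open>N\<close> are covered.
\<close>

definition normal0 :: "nat \<Rightarrow> monomial set" where
  "normal0 k = {K \<in> exps 4. lookup K 2 < 2 \<and> lookup K 3 \<le> k}"

lemma exps4: "exps 4 = {K \<in> exps 5. lookup K 4 = 0}"
proof -
  have "{..<5} = insert (4 :: nat) {..<4}" by auto
  hence "K \<in> exps 4 \<longleftrightarrow> K \<in> exps 5 \<and> 4 \<notin> keys K" for K
    unfolding exps_def by auto
  thus ?thesis by (auto simp: in_keys_iff)
qed

lemma normal0_subset: "k < p \<Longrightarrow> normal0 k \<subseteq> normal"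
  by (auto simp: normal0_def normal_def exps4)

lemma exps5_eqI:
  assumes "K \<in> exps 5" "J \<in> exps 5" "lookup K 0 = lookup J 0" "lookup K 1 = lookup J 1" "lookup K 2 = lookup J 2"
    "lookup K 3 = lookup J 3" "lookup K 4 = lookup J 4"
  shows "K = J"
proof (rule poly_mapping_eqI)
  fix i
  show "lookup K i = lookup J i"
  proof (cases "i < 5")
    case True
    hence "i \<in> {..<5}" by simp
    thus ?thesis unfolding lessThan_5 using assms by auto
  next
    case False
    hence "i \<notin> keys K" "i \<notin> keys J"
      using assms(1,2) by (auto simp: exps_def)
    thus ?thesis by (simp add: in_keys_iff)
  qed
qed

lemma inj_\<phi>: "inj_on \<phi> normal"
proof (rule inj_onI)
  fix K J assume K: "K \<in> normal" and J: "J \<in> normal" and eq: "\<phi> K = \<phi> J"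
  have "lookup K 0 = lookup J 0" "lookup K 4 = lookup J 4"
    using lookup_\<phi>[of K] lookup_\<phi>[of J] p4_pos by (simp_all add: eq)
  moreover have "lookup K 1 = lookup J 1 \<and> lookup K 2 = lookup J 2 \<and> lookup K 3 = lookup J 3"
    using lookup_\<phi>(2)[of K] lookup_\<phi>(2)[of J] K J
    by (intro exponent_unique[OF prime_p p_gt_2]) (auto simp: normal_def eq)
  ultimately show "K = J"
    using K J by (intro exps5_eqI) (auto simp: normal_def)
qed

abbreviation q0 where "q0 \<equiv> set_z_to 0 H1"
abbreviation s0 where "s0 \<equiv> set_z_to 0 H2"
abbreviation r0 where "r0 \<equiv> set_z_to 0 H3"

definition C where "C = generated_algebra {X, q0}"

lemma subalgebra_C: "subalgebra C"
  unfolding C_def by (rule subalgebra_generated)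

lemma generators_C: "X \<in> C" "q0 \<in> C"
  unfolding C_def by (auto intro: hull_inc)

lemmas C_closed = subalgebra_closed[OF subalgebra_C] generators_C

lemma delta_at_0: "set_z_to 0 delta = Y\<^sup>2"
  by (simp add: delta_def set_z_to_simps set_z_to_Var)

lemma two_p_pos: "2 * p > 0" using p_gt_2 by simp

lemma Y_integral_over_C: "Y ^ (2 * p) \<in> power_span C Y (2 * p)"
proof -
  have "q0 = Y ^ (2 * p) + Const u * X ^ p * Y ^ p + Const v * X ^ (2 * p - 2) * Y ^ 2
      + Const w * X ^ (2 * p - 1) * Y ^ 1"
    by (simp add: H1_eq set_z_to_simps set_z_to_Var delta_at_0 algebra_simps flip: power_mult)
  hence "Y ^ (2 * p) = q0 * Y ^ 0 - Const u * X ^ p * Y ^ p - Const v * X ^ (2 * p - 2) * Y ^ 2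
      - Const w * X ^ (2 * p - 1) * Y ^ 1"
    by (simp add: algebra_simps)
  also have "\<dots> \<in> power_span C Y (2 * p)"
    using p_gt_2 by (intro power_span_diff power_span_scaled_power subalgebra_C C_closed) auto
  finally show ?thesis .
qed

lemmas subalgebra_CY = subalgebra_power_span[OF subalgebra_C Y_integral_over_C two_p_pos]

lemma s0_in_CY: "s0 \<in> power_span C Y (2 * p)"
proof -
  have "s0 = Y ^ (p ^ 3) - Const b * Y ^ (p\<^sup>2) * X ^ (p ^ 3 - p\<^sup>2) + Const c * Y ^ p * X ^ (p ^ 3 - p)
     + Const a * Y\<^sup>2 * X ^ (p ^ 3 - 2) + Const d * Y * X ^ (p ^ 3 - 1)"
    by (simp add: H2_eq set_z_to_simps set_z_to_Var delta_at_0)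
  also have "\<dots> \<in> power_span C Y (2 * p)"
    using power_span_base[OF subalgebra_C Y_integral_over_C two_p_pos]
      power_span_coeffs[OF subalgebra_C Y_integral_over_C two_p_pos] generators_C(1)
    by (intro subalgebra_closed[OF subalgebra_CY]) auto
  finally show ?thesis .
qed

text \<open>
  The degree \<open>2p\<close> equals the number of products \<open>h\<^sub>2\<^sup>e h\<^sub>3\<^sup>j\<close> with \<open>e < 2\<close> and \<open>j < p\<close>.
\<close>

lemma s0_integral: "s0 ^ (2 * p) \<in> power_span C s0 (2 * p)"
  by (intro power_span_integral[OF subalgebra_C two_p_pos, of s0 Y] subalgebra_mult[OF subalgebra_CY] s0_in_CY
      power_span_power[OF subalgebra_C])

lemma S_at_0: "f \<in> S \<Longrightarrow> set_z_to 0 f \<in> power_span C s0 (2 * p)"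
proof -
  note span = subalgebra_C s0_integral two_p_pos
  assume "f \<in> S"
  thus ?thesis
    unfolding S_def
  proof (rule alg_hom_image_generated[OF alg_hom_set_z_to, rotated 2])
    show "subalgebra (power_span C s0 (2 * p))"
      by (rule subalgebra_power_span[OF span])
    fix g assume "g \<in> {X, H1, H2}"
    moreover have "set_z_to 0 X = (X :: 'a mpoly)" by (simp add: set_z_to_Var)
    ultimately show "set_z_to 0 g \<in> power_span C s0 (2 * p)"
      using power_span_base[OF span] power_span_coeffs[OF span] generators_C by auto
  qed
qed

abbreviation \<epsilon>0 :: "'a mpoly \<Rightarrow> 'a mpoly" where "\<epsilon>0 f \<equiv> set_z_to 0 (\<epsilon> f)"

lemma alg_hom_eval0: "alg_hom \<epsilon>0"
  by (rule alg_hom_comp[OF alg_hom_set_z_to alg_hom_eval])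

lemma eval0_Var: "\<epsilon>0 (Var 0) = X" "\<epsilon>0 (Var 1) = q0" "\<epsilon>0 (Var 2) = s0" "\<epsilon>0 (Var 3) = r0"
  unfolding eval_Var by (simp_all add: set_z_to_Var)

abbreviation normal_span0 :: "nat \<Rightarrow> 'a mpoly set" where
  "normal_span0 k \<equiv> combinations \<epsilon>0 (normal0 k)"

lemma normal_span0_C_mult:
  assumes "f \<in> C" "g \<in> normal_span0 k"
  shows "f * g \<in> normal_span0 k"
proof -
  let ?M = "{f. \<forall>g\<in>normal_span0 k. f * g \<in> normal_span0 k}"
  have "subalgebra ?M"
    unfolding subalgebra_def
    by (auto simp: distrib_right mult.assoc combinations_add[OF alg_hom_eval0]
        combinations_Const_mult[OF alg_hom_eval0])
  moreover have "X \<in> ?M"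
    using combinations_Monom_mult[OF alg_hom_eval0, of _ "normal0 k" "single 0 1" "normal0 k"]
    unfolding Var_def[symmetric] eval0_Var by (auto simp: normal0_def lookup_add lookup_single)
  moreover have "q0 \<in> ?M"
    using combinations_Monom_mult[OF alg_hom_eval0, of _ "normal0 k" "single 1 1" "normal0 k"]
    unfolding Var_def[symmetric] eval0_Var by (auto simp: normal0_def lookup_add lookup_single)
  ultimately have "C \<subseteq> ?M"
    unfolding C_def by (intro hull_minimal) auto
  thus ?thesis using assms by blast
qed

text \<open>
  The definition of \<open>h\<^sub>3\<close> trades \<open>h\<^sub>2\<^sup>2\<close> for \<open>h\<^sub>3\<close>, so that the powers \<open>h\<^sub>2\<^sup>k\<close> with \<open>k < 2 p\<close>
  are combinations of the products \<open>h\<^sub>2\<^sup>\<epsilon> h\<^sub>3\<^sup>j\<close> with \<open>\<epsilon> < 2\<close> and \<open>j < p\<close>.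
\<close>

lemma s0_power_in_normal_span0:
  "e < 2 \<Longrightarrow> s0 ^ (2 * k + e) \<in> normal_span0 k"
proof (induction k)
  case 0
  have "\<epsilon>0 (Monom (single 2 e)) \<in> normal_span0 0"
    using 0 by (intro combinations_Monom[OF alg_hom_eval0]) (simp add: normal0_def lookup_single)
  thus ?case
    unfolding Var_power[symmetric] alg_hom_power[OF alg_hom_eval0] eval0_Var by simp
next
  case (Suc k)
  define \<Phi> where "\<Phi> = q0 ^ p\<^sup>2
     - Const (2 * b) * q0 ^ (p * ((p + 1) div 2)) * X ^ (p ^ 3 - p\<^sup>2)
     + Const (2 * c) * q0 ^ ((p\<^sup>2 + 1) div 2) * X ^ (p ^ 3 - p)"
  have \<Phi>: "\<Phi> \<in> C" unfolding \<Phi>_def by (intro C_closed)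
  have "set_z_to 0 (Const (2 * a) * X ^ (p ^ 3 - 2) * H3) = set_z_to 0 (h3_tilde p M)"
    by (simp only: h3_tilde_eq_H3)
  hence "s0\<^sup>2 = \<Phi> + Const (2 * a) * X ^ (p ^ 3 - 2) * r0"
    unfolding h3_tilde_eq by (simp add: set_z_to_simps set_z_to_Var \<Phi>_def algebra_simps)
  moreover have "s0 ^ (2 * Suc k + e) = s0\<^sup>2 * s0 ^ (2 * k + e)"
    by (simp flip: power_add)
  ultimately have "s0 ^ (2 * Suc k + e) = \<Phi> * s0 ^ (2 * k + e) + (Const (2 * a) * X ^ (p ^ 3 - 2)) * (r0 * s0 ^ (2 * k + e))"
    by (simp only: distrib_right mult.assoc)
  also have "\<dots> \<in> normal_span0 (Suc k)"
  proof (rule combinations_add[OF alg_hom_eval0 normal_span0_C_mult normal_span0_C_mult])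
    have IH: "s0 ^ (2 * k + e) \<in> normal_span0 k" using Suc by blast
    have "normal_span0 k \<subseteq> normal_span0 (Suc k)"
      by (intro combinations_mono[OF alg_hom_eval0]) (auto simp: normal0_def)
    thus "s0 ^ (2 * k + e) \<in> normal_span0 (Suc k)" using IH by blast
    have "\<epsilon>0 (Monom (single 3 1)) * s0 ^ (2 * k + e) \<in> normal_span0 (Suc k)"
      by (rule combinations_Monom_mult[OF alg_hom_eval0 IH]) (auto simp: normal0_def lookup_add lookup_single)
    thus "r0 * s0 ^ (2 * k + e) \<in> normal_span0 (Suc k)"
      unfolding Var_def[symmetric] eval0_Var .
    show "\<Phi> \<in> C" by (rule \<Phi>)
    show "Const (2 * a) * X ^ (p ^ 3 - 2) \<in> C" by (intro C_closed)
  qed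
  finally show ?case .
qed

lemma S_at_0_in_normal_span0:
  assumes "f \<in> S" shows "set_z_to 0 f \<in> normal_span0 (p - 1)"
proof -
  obtain t where t: "set_z_to 0 f = (\<Sum>i<2 * p. t i * s0 ^ i)" "\<forall>i<2 * p. t i \<in> C"
    using S_at_0[OF assms] by (auto simp: power_span_def)
  have "s0 ^ i \<in> normal_span0 (p - 1)" if "i < 2 * p" for i
  proof -
    have "s0 ^ i \<in> normal_span0 (i div 2)"
      using s0_power_in_normal_span0[of "i mod 2" "i div 2"] by simp
    moreover have "normal_span0 (i div 2) \<subseteq> normal_span0 (p - 1)"
      using that by (intro combinations_mono[OF alg_hom_eval0]) (auto simp: normal0_def)
    ultimately show ?thesis by blast
  qed
  thus ?thesis
    unfolding t(1) using t(2)
    by (intro combinations_sum[OF alg_hom_eval0] normal_span0_C_mult) auto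
qed

lemma mod_X_at_0:
  assumes "X dvd f - Y ^ n"
  shows "X dvd set_z_to 0 f - Y ^ n"
proof -
  obtain g where "f - Y ^ n = X * g" using assms by (elim dvdE)
  hence "set_z_to 0 (f - Y ^ n) = set_z_to 0 (X * g)" by simp
  hence "set_z_to 0 f - Y ^ n = X * set_z_to 0 g"
    by (simp add: set_z_to_simps set_z_to_Var)
  thus ?thesis by simp
qed

lemma homogeneous_at_0: "homogeneous n f \<Longrightarrow> homogeneous n (set_z_to 0 f)"
  using keys_set_z_to_0[of f] by (auto simp: homogeneous_def)

lemma H1_mod_X': "X dvd H1 - Y ^ (2 * p)"
proof -
  have "X dvd (X ^ p :: 'a mpoly)" using p_gt_2 by (simp add: dvd_power)
  thus ?thesis using H1_mod_X by (rule dvd_trans)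
qed

lemmas q0_mod_X = mod_X_at_0[OF H1_mod_X']
lemmas s0_mod_X = mod_X_at_0[OF H2_mod_X]
lemmas r0_mod_X = mod_X_at_0[OF H3_properties(2)]
lemmas lead_q0 = lead_Y_power[OF homogeneous_at_0[OF homogeneous_H1] q0_mod_X]
lemmas lead_s0 = lead_Y_power[OF homogeneous_at_0[OF homogeneous_H2] s0_mod_X]
lemmas lead_r0 = lead_Y_power[OF homogeneous_at_0[OF homogeneous_H3] r0_mod_X]

lemma lead_eval0_Monom:
  assumes "K \<in> normal0 k"
  shows "\<epsilon>0 (Monom K) \<noteq> 0 \<and> LM (\<epsilon>0 (Monom K)) = \<phi> K"
proof -
  note nz = lead_X(1) lead_q0(1) lead_s0(1) lead_r0(1)
  note lm = lead_X(2) lead_q0(2) lead_s0(2) lead_r0(2)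
  have K: "K \<in> exps 5" "lookup K 4 = 0" using assms by (auto simp: normal0_def exps4)
  have eq: "\<epsilon>0 (Monom K) = X ^ lookup K 0 * q0 ^ lookup K 1 * s0 ^ lookup K 2 * r0 ^ lookup K 3"
    unfolding alg_hom_Monom5[OF alg_hom_eval0 K(1)] eval0_Var K(2) by simp
  have "LM (X ^ lookup K 0 * q0 ^ lookup K 1 * s0 ^ lookup K 2 * r0 ^ lookup K 3) = \<phi> K"
    unfolding \<phi>_def K(2)
    by (rule poly_mapping_eqI) (simp add: LM_mult LM_power nz lm lookup_add lookup_single when_def algebra_simps)
  thus ?thesis unfolding eq using nz by simp
qed

definition set_x_to_0 :: "'a mpoly \<Rightarrow> 'a mpoly" where
  "set_x_to_0 = subst (Var(0 := 0))"

lemma alg_hom_set_x_to_0: "alg_hom set_x_to_0"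
  unfolding set_x_to_0_def by (rule alg_hom_subst)

lemma set_x_to_0_Var: "set_x_to_0 (Var i) = (if i = 0 then 0 else Var i)"
  by (simp add: set_x_to_0_def)

lemma set_x_to_0_eqI: "X dvd f - Y ^ n \<Longrightarrow> set_x_to_0 f = Y ^ n"
proof -
  assume "X dvd f - Y ^ n"
  then obtain g where "f - Y ^ n = X * g" by (elim dvdE)
  hence "set_x_to_0 (f - Y ^ n) = set_x_to_0 (X * g)" by simp
  thus ?thesis
    by (simp add: alg_hom_diff[OF alg_hom_set_x_to_0] alg_hom_mult[OF alg_hom_set_x_to_0]
        alg_hom_power[OF alg_hom_set_x_to_0] set_x_to_0_Var)
qed

text \<open>
  Modulo \<open>x\<close> the normal products without \<open>x\<close> become distinct powers of \<open>y\<close>; so a combination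
  of normal products that is divisible by \<open>x\<close> involves only products that contain \<open>x\<close>.
\<close>

lemma normal_span0_divide_X:
  assumes "X * g \<in> normal_span0 (p - 1)"
  shows "g \<in> normal_span0 (p - 1)"
proof -
  let ?A = "{K. lookup K 0 = 0}"
  obtain f where f: "X * g = \<epsilon>0 f" "keys f \<subseteq> normal0 (p - 1)"
    using assms by (auto simp: combinations_def)
  obtain f1 f2 where split: "f = f1 + f2" "keys f1 \<subseteq> keys f \<inter> ?A"
      "keys f2 \<subseteq> keys f - ?A"
    using split_polynomial[of f ?A] by blast
  \<comment> \<open>\<open>f1\<close> collects the products without \<open>x\<close>, which remain independent at \<open>x = 0\<close>\<close>
  have "Var 0 dvd f2"
    using split(3) by (intro Var_dvd) auto
  then obtain f3 where f3: "f2 = Var 0 * f3" by (elim dvdE)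
  define \<eta> where "\<eta> = (\<lambda>f. set_x_to_0 (\<epsilon>0 f))"
  have hom: "alg_hom \<eta>"
    unfolding \<eta>_def by (intro alg_hom_comp[OF alg_hom_set_x_to_0] alg_hom_eval0)
  have X0: "set_x_to_0 (X * h) = 0" for h
    by (simp add: alg_hom_mult[OF alg_hom_set_x_to_0] set_x_to_0_Var)
  have "\<eta> f1 + \<eta> f2 = set_x_to_0 (\<epsilon>0 f)"
    unfolding \<eta>_def split(1)
    by (simp only: alg_hom_add[OF alg_hom_eval0] alg_hom_add[OF alg_hom_set_x_to_0])
  hence "\<eta> f1 + \<eta> f2 = 0"
    using X0[of g] f(1) by simp
  moreover have "\<eta> f2 = 0"
    unfolding \<eta>_def f3 alg_hom_mult[OF alg_hom_eval0] eval0_Var by (rule X0)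
  ultimately have "\<eta> f1 = 0" by simp
  hence "f1 = 0"
  proof (rule combination_eq_0[OF hom])
    show "keys f1 \<subseteq> normal0 (p - 1) \<inter> ?A" using split(2) f(2) by blast
    have "p - 1 < p" using p_gt_2 by simp
    thus "inj_on \<phi> (normal0 (p - 1) \<inter> ?A)"
      using inj_on_subset[OF inj_\<phi>] normal0_subset by blast
    fix K assume K: "K \<in> normal0 (p - 1) \<inter> ?A"
    hence K5: "K \<in> exps 5" "lookup K 4 = 0" "lookup K 0 = 0" by (auto simp: normal0_def exps4)
    have \<eta>: "\<eta> (Var 1) = Y ^ (2 * p)" "\<eta> (Var 2) = Y ^ p ^ 3" "\<eta> (Var 3) = Y ^ (p ^ 3 + 2)"
      unfolding \<eta>_def eval0_Var
      by (intro set_x_to_0_eqI q0_mod_X s0_mod_X r0_mod_X)+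
    have "\<eta> (Monom K) = Y ^ (2 * p * lookup K 1 + p ^ 3 * lookup K 2 + (p ^ 3 + 2) * lookup K 3)"
      unfolding alg_hom_Monom5[OF hom K5(1)] \<eta> K5(2,3)
      by (simp only: power_0 mult_1_left mult_1_right power_mult[symmetric] power_add[symmetric])
    also have "\<dots> = Monom (\<phi> K)"
      unfolding Var_power by (simp add: \<phi>_def K5)
    finally show "\<eta> (Monom K) \<noteq> 0 \<and> LM (\<eta> (Monom K)) = \<phi> K" by simp
  qed
  hence "X * g = X * \<epsilon>0 f3"
    unfolding f(1) split(1) f3 by (simp add: alg_hom_mult[OF alg_hom_eval0] eval0_Var)
  hence "g = \<epsilon>0 f3" by simp
  moreover have "keys f3 \<subseteq> normal0 (p - 1)"
  proof
    fix K assume "K \<in> keys f3"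
    hence "single 0 1 + K \<in> keys f2"
      unfolding f3 Var_def keys_Monom_mult by blast
    hence "single 0 1 + K \<in> normal0 (p - 1)"
      using split(3) f(2) by blast
    thus "K \<in> normal0 (p - 1)" by (simp add: normal0_def lookup_add lookup_single)
  qed
  ultimately show ?thesis by (auto simp: combinations_def)
qed

text \<open>
  Some \<open>x\<^sup>m f\<close> lies in \<open>F[x, h\<^sub>1, h\<^sub>2]\<close>, whose restriction consists of combinations of normal products, and the
  factor \<open>x\<^sup>m\<close> can be cancelled.
\<close>

lemma R_at_0:
  assumes "f \<in> R" shows "set_z_to 0 f \<in> normal_span0 (p - 1)"
proof -
  obtain m where "X ^ m * f \<in> S" using R_localized[OF assms] by blast
  hence "set_z_to 0 (X ^ m * f) \<in> normal_span0 (p - 1)" by (rule S_at_0_in_normal_span0)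
  hence "X ^ m * set_z_to 0 f \<in> normal_span0 (p - 1)"
    by (simp add: set_z_to_simps set_z_to_Var)
  thus ?thesis
  proof (induction m)
    case (Suc m)
    have "X * (X ^ m * set_z_to 0 f) \<in> normal_span0 (p - 1)"
      using Suc.prems by (simp only: power_Suc mult.assoc)
    thus ?case by (rule Suc.IH[OF normal_span0_divide_X])
  qed simp
qed

lemma eval_in_R: "\<epsilon> f \<in> R" if "f \<in> polys 5"
proof -
  have "polys 5 \<subseteq> {f. \<epsilon> f \<in> R}"
  proof (rule polys_subset_subalgebra)
    show "subalgebra {f. \<epsilon> f \<in> R}"
      by (auto simp: subalgebra_def alg_hom_simps[OF alg_hom_eval] intro: subalgebra_closed[OF subalgebra_R])
    fix i :: nat assume "i < 5"
    hence "i \<in> {..<5}" by simp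
    thus "Var i \<in> {f. \<epsilon> f \<in> R}"
      unfolding lessThan_5
      by (auto simp: eval_Var eval_Var(2)[unfolded One_nat_def] X_in_R H1_in_R H2_in_R H3_in_R N_in_R)
  qed
  thus ?thesis using that by auto
qed

text \<open>
  The restriction of \<open>f\<close> to \<open>z = 0\<close> is the restriction of a combination \<open>h\<close> of normal products, and \<open>f - h\<close>
  is a multiple \<open>N q\<close>. The lead monomials of normal products without \<open>N\<close> survive the restriction and
  are distinct, so the degree of \<open>h\<close> does not exceed that of \<open>f\<close>, and \<open>q\<close> has smaller degree than \<open>f\<close>.
\<close>

theorem R_normal_combinations: "f \<in> R \<Longrightarrow> f \<in> combinations \<epsilon> normal"
proof (induction "total_deg (LM f)" arbitrary: f rule: less_induct)
  case less
  have "p - 1 < p" using p_gt_2 by simp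
  note sub = normal0_subset[OF this]
  obtain h where h: "set_z_to 0 f = \<epsilon>0 h" "keys h \<subseteq> normal0 (p - 1)"
    using R_at_0[OF less.prems] by (auto simp: combinations_def)
  have h_normal: "keys h \<subseteq> normal" using h(2) sub by blast
  have h_comb: "\<epsilon> h \<in> combinations \<epsilon> normal"
    using h_normal by (auto simp: combinations_def)
  have h_R: "\<epsilon> h \<in> R"
    using h_normal by (intro eval_in_R) (auto simp: polys_iff normal_def)
  have diff_R: "f - \<epsilon> h \<in> R"
    by (intro subalgebra_diff[OF subalgebra_R] less.prems h_R)
  have "set_z_to 0 (f - \<epsilon> h) = 0"
    by (simp add: set_z_to_simps h(1))
  with diff_R have "N dvd f - \<epsilon> h" by (rule N_dvd)
  then obtain q where q: "f - \<epsilon> h = N * q" by (elim dvdE)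
  have q_R: "q \<in> R"
    using R_cancel[OF N_in_R lead_N(1)] diff_R q by simp
  have "N * q \<in> combinations \<epsilon> normal"
  proof (cases "q = 0")
    case True
    thus ?thesis by (simp add: combinations_0[OF alg_hom_eval])
  next
    case False
    note f_deg = total_deg_le_LM[of _ f]
    have h_deg: "total_deg t \<le> total_deg (LM f)" if t: "t \<in> keys (\<epsilon> h)" for t
    proof -
      have "h \<noteq> 0" using t by (auto simp: alg_hom_0[OF alg_hom_eval])
      from lead_of_combination[OF alg_hom_eval0 this h(2) lead_eval0_Monom[of _ "p - 1"] inj_on_subset[OF inj_\<phi> sub]]
      obtain K where K: "is_LM (\<epsilon>0 h) (\<phi> K)"
          "\<forall>J\<in>keys h. J \<noteq> K \<longrightarrow> grevlex_less (\<phi> J) (\<phi> K)" by blast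
      have "\<phi> K \<in> keys f"
        using K(1) keys_set_z_to_0[of f] by (auto simp: grevlex.is_lead_def h(1))
      hence \<phi>_K: "total_deg (\<phi> K) \<le> total_deg (LM f)" by (rule f_deg)
      obtain J where J: "J \<in> keys h" "t \<in> keys (\<epsilon> (Monom J))"
        using t unfolding alg_hom_expand[OF alg_hom_eval, of h]
        by (auto simp: in_keys_iff lookup_Const_mult dest!: keys_sumD[unfolded in_keys_iff])
      have "J \<in> exps 5" using J(1) h_normal by (auto simp: normal_def)
      hence "total_deg t \<le> total_deg (\<phi> J)"
        using total_deg_le_LM[OF J(2)] by (simp add: lead_eval_Monom)
      also have "\<dots> \<le> total_deg (\<phi> K)"
        using K(2) J(1) grevlex_total_deg_le by (cases "J = K") auto
      also note \<phi>_K
      finally show ?thesis .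
    qed
    have "LM (N * q) \<in> keys (f - \<epsilon> h)"
      using q False lead_N(1) LM_in_keys[of "N * q"] by simp
    hence "LM (N * q) \<in> keys f \<or> LM (N * q) \<in> keys (\<epsilon> h)"
      by (auto simp: in_keys_iff lookup_minus)
    hence "total_deg (LM (N * q)) \<le> total_deg (LM f)"
      using f_deg h_deg by blast
    moreover have "total_deg (LM (N * q)) = p ^ 4 + total_deg (LM q)"
      by (simp add: LM_mult lead_N False total_deg_add)
    ultimately have "total_deg (LM q) < total_deg (LM f)" using p4_pos by linarith
    hence "q \<in> combinations \<epsilon> normal" using less.hyps q_R by blast
    hence "\<epsilon> (Monom (single 4 1)) * q \<in> combinations \<epsilon> normal"
      by (rule combinations_Monom_mult[OF alg_hom_eval]) (auto simp: normal_def lookup_add lookup_single)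
    thus ?thesis unfolding Var_def[symmetric] eval_Var .
  qed
  hence "N * q + \<epsilon> h \<in> combinations \<epsilon> normal"
    using h_comb by (intro combinations_add[OF alg_hom_eval])
  thus ?case using q by (simp add: algebra_simps)
qed

end

text \<open>
  The module structure in which the spans of lead monomials are taken.
\<close>

lemma module_mpoly: "Modules.module (\<lambda>(r::'a::field) f. Const r * (f :: 'a mpoly))"
  by unfold_locales (simp_all add: Const_add Const_mult algebra_simps)

interpretation mpoly: Modules.module "\<lambda>(r::'a::field) f. Const r * (f :: 'a mpoly)"
  by (rule module_mpoly)

lemma lead_monom_mult: "f \<noteq> 0 \<Longrightarrow> g \<noteq> 0 \<Longrightarrow> lead_monom (f * g) = lead_monom f * lead_monom g"
  by (simp add: lead_monom_def LM_mult Monom_add)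

lemma lead_monom_power: "f \<noteq> 0 \<Longrightarrow> lead_monom (f ^ k) = lead_monom f ^ k"
  by (induction k) (simp_all add: lead_monom_mult lead_monom_def[of 1])

lemma LT_eq: "LT f = single (LM f) (LC f)"
  by (simp add: LT_def Const_mult_Monom)

lemma LT_eq_iff:
  assumes "f \<noteq> 0"
  shows "LT f = LT g \<longleftrightarrow> g \<noteq> 0 \<and> LM f = LM g \<and> LC f = LC g"
proof
  assume eq: "LT f = LT g"
  have "LC g \<noteq> 0"
  proof
    assume "LC g = 0"
    hence "LT f = 0" using eq by (simp add: LT_eq[of g])
    hence "lookup (LT f) (LM f) = 0" by simp
    thus False using LC_nonzero[OF assms] by (simp add: LT_eq)
  qed
  hence "g \<noteq> 0" by (auto simp: LC_def)
  moreover have "keys (LT f) = keys (LT g)" using eq by simp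
  hence LM: "LM f = LM g"
    using LC_nonzero[OF assms] \<open>LC g \<noteq> 0\<close> by (simp add: LT_eq)
  moreover have "lookup (LT f) (LM f) = lookup (LT g) (LM f)" using eq by simp
  hence "LC f = LC g" by (simp add: LT_eq LM)
  ultimately show "g \<noteq> 0 \<and> LM f = LM g \<and> LC f = LC g" by blast
qed (simp add: LT_def)

lemma keys_diff_LT_smaller:
  assumes "f \<noteq> 0" "LT f = LT g" "t \<in> keys (f - g)"
  shows "grevlex_less t (LM f)"
proof -
  have g: "g \<noteq> 0" "LM f = LM g" "LC f = LC g"
    using assms(1,2) LT_eq_iff by blast+
  show ?thesis
    using grevlex.lead_diff_smaller[of f "LM f" g t] is_LM_LM[OF assms(1)] is_LM_LM[OF g(1)] assms(3) g
    by (simp add: LC_def)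
qed

context rank_four
begin

lemma R_eq: "R = \<epsilon> ` polys 5"
proof -
  have "\<epsilon> ` {f. keys f \<subseteq> normal} \<subseteq> \<epsilon> ` polys 5"
    by (intro image_mono) (auto simp: polys_iff normal_def)
  thus ?thesis
    using R_normal_combinations eval_in_R by (auto simp: combinations_def)
qed

lemma LM_of_invariant:
  assumes "f \<in> R" "f \<noteq> 0"
  shows "\<exists>K\<in>exps 5. LM f = \<phi> K"
proof -
  obtain h where h: "f = \<epsilon> h" "keys h \<subseteq> normal"
    using R_normal_combinations[OF assms(1)] by (auto simp: combinations_def)
  have "h \<noteq> 0" using assms(2) h(1) by (auto simp: alg_hom_0[OF alg_hom_eval])
  have "\<epsilon> (Monom K) \<noteq> 0 \<and> LM (\<epsilon> (Monom K)) = \<phi> K" if "K \<in> normal" for K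
    using that lead_eval_Monom[of K] by (simp add: normal_def)
  from lead_of_combination[OF alg_hom_eval \<open>h \<noteq> 0\<close> h(2) this inj_\<phi>]
  obtain K where "K \<in> normal" "is_LM f (\<phi> K)" using h by blast
  thus ?thesis using LM_eqI by (auto simp: normal_def)
qed

section \<open>The SAGBI property\<close>

lemma set_B_nonzero: "f \<in> set B \<Longrightarrow> f \<noteq> 0"
  using lead_X(1) lead_H1(1) lead_H2(1) lead_H3(1) lead_N(1) by (auto simp: B_def)

lemma set_B_R: "set B \<subseteq> R"
  using X_in_R H1_in_R H2_in_R H3_in_R N_in_R by (simp add: B_def)

lemma generated_B: "generated_algebra (set B) = R"
proof
  show "generated_algebra (set B) \<subseteq> R"
    using set_B_R subalgebra_R by (intro hull_minimal)
  let ?G = "generated_algebra (set B)"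
  have G: "subalgebra ?G" by (rule subalgebra_generated)
  have "X \<in> ?G" "H1 \<in> ?G" "H2 \<in> ?G" "H3 \<in> ?G" "N \<in> ?G"
    by (auto intro: hull_inc simp: B_def)
  hence monom: "\<epsilon> (Monom K) \<in> ?G" if "K \<in> exps 5" for K
    unfolding eval_Monom[OF that] by (intro subalgebra_mult[OF G] subalgebra_power[OF G])
  show "R \<subseteq> ?G"
  proof
    fix f assume "f \<in> R"
    then obtain h where h: "h \<in> polys 5" "f = \<epsilon> h" unfolding R_eq by blast
    show "f \<in> ?G"
      unfolding h(2) alg_hom_expand[OF alg_hom_eval, of h] using h(1)
      by (intro subalgebra_sum[OF G] subalgebra_mult[OF G] subalgebra_Const[OF G] monom) (auto simp: polys_iff)
  qed
qed

text \<open>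
  The span of the lead monomials of \<open>R\<close> is an algebra since lead monomials multiply; conversely each lead
  monomial of \<open>R\<close> is that of a product of generators.
\<close>

lemma sagbi: "sagbi_basis (set B) R"
proof -
  let ?T = "lead_monom ` (R - {0})"
  let ?G = "generated_algebra (lead_monom ` set B)"
  have span: "linear_span ?T = mpoly.span ?T" by (simp add: linear_span_def)
  have T_mult: "f * g \<in> ?T" if fg: "f \<in> ?T" "g \<in> ?T" for f g
  proof -
    obtain f' g' where "f' \<in> R" "f' \<noteq> 0" "f = lead_monom f'" "g' \<in> R" "g' \<noteq> 0" "g = lead_monom g'"
      using fg by auto
    thus ?thesis
      by (intro image_eqI[of _ _ "f' * g'"]) (auto simp: lead_monom_mult subalgebra_mult[OF subalgebra_R])
  qed
  have span_mult: "f * g \<in> mpoly.span ?T" if f: "f \<in> mpoly.span ?T" and g: "g \<in> mpoly.span ?T" for f g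
  proof -
    have T_span: "h * g \<in> mpoly.span ?T" if h: "h \<in> ?T" for h
      using g
    proof (induction rule: mpoly.span_induct)
      case base
      show ?case
        unfolding mpoly.subspace_def
        by (auto simp: distrib_left mult.left_commute[of h "Const _"] mpoly.span_zero mpoly.span_add mpoly.span_scale)
    next
      case (step k)
      show ?case using T_mult[OF h step] by (rule mpoly.span_base)
    qed
    from f show ?thesis
    proof (induction rule: mpoly.span_induct)
      case base
      show ?case
        unfolding mpoly.subspace_def
        by (auto simp: distrib_right mult.assoc mpoly.span_zero mpoly.span_add mpoly.span_scale)
    next
      case (step h)
      thus ?case by (rule T_span)
    qed
  qed
  have "1 \<in> ?T"
    by (intro image_eqI[of _ _ 1]) (auto simp: lead_monom_def subalgebra_1[OF subalgebra_R])
  hence "Const r * 1 \<in> mpoly.span ?T" for r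
    by (intro mpoly.span_scale mpoly.span_base)
  hence "subalgebra (mpoly.span ?T)"
    unfolding subalgebra_def using span_mult by (auto intro: mpoly.span_add)
  moreover have "lead_monom ` set B \<subseteq> mpoly.span ?T"
    using set_B_R set_B_nonzero by (auto intro!: mpoly.span_base)
  ultimately have 1: "?G \<subseteq> mpoly.span ?T"
    by (intro hull_minimal)
  have G: "subalgebra ?G" by (rule subalgebra_generated)
  have "?T \<subseteq> ?G"
  proof
    fix t assume "t \<in> ?T"
    then obtain f where f: "f \<in> R" "f \<noteq> 0" "t = lead_monom f" by auto
    then obtain K where K: "K \<in> exps 5" "LM f = \<phi> K" using LM_of_invariant by blast
    have "t = lead_monom (\<epsilon> (Monom K))"
      using f K by (simp add: lead_monom_def lead_eval_Monom)
    also have "\<dots> = lead_monom X ^ lookup K 0 * lead_monom H1 ^ lookup K 1 * lead_monom H2 ^ lookup K 2 *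
        lead_monom H3 ^ lookup K 3 * lead_monom N ^ lookup K 4"
      unfolding eval_Monom[OF K(1)]
      using lead_X(1) lead_H1(1) lead_H2(1) lead_H3(1) lead_N(1)
      by (simp add: lead_monom_mult lead_monom_power)
    also have "\<dots> \<in> ?G"
      by (intro subalgebra_mult[OF G] subalgebra_power[OF G] hull_inc) (auto simp: B_def)
    finally show "t \<in> ?G" .
  qed
  moreover have "mpoly.subspace ?G"
    unfolding mpoly.subspace_def using subalgebra_closed[OF G] by auto
  ultimately have 2: "mpoly.span ?T \<subseteq> ?G"
    by (intro mpoly.span_minimal)
  show ?thesis
    unfolding sagbi_basis_def span
    using subalgebra_R set_B_R set_B_nonzero 1 2 by auto
qed

section \<open>Subduction\<close>

lemma length_B: "length B = 5"
  by (simp add: B_def)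

lemma prod_of_B: "prod_of B K = \<epsilon> (Monom K)"
  by (simp add: prod_of_def)

lemma LC_Const_eval: "r \<noteq> 0 \<Longrightarrow> K \<in> exps 5 \<Longrightarrow> LT (Const r * \<epsilon> (Monom K)) = single (\<phi> K) r"
  by (simp add: LT_eq LM_Const_mult LC_Const_mult lead_eval_Monom)

text \<open>
  Each remainder is again an invariant, so its lead monomial is again that of a product of generators.
\<close>

lemma invariant_subducts:
  assumes "f \<in> R" shows "\<exists>P. subducts B f P"
proof (cases "f = 0")
  case True
  thus ?thesis using subducts.zero by blast
next
  case False
  have "LM f \<in> exps 3"
    using LM_in_keys[OF False] R_polys[OF assms] by (auto simp: polys_iff)
  thus ?thesis
    using assms False
  proof (induction "LM f" arbitrary: f rule: grevlex.exps_induct)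
    case (less f)
    obtain K where K: "K \<in> exps 5" "LM f = \<phi> K"
      using LM_of_invariant less.prems by blast
    have LT: "LT f = LT (Const (LC f) * prod_of B K)"
      unfolding prod_of_B LC_Const_eval[OF LC_nonzero[OF less.prems(2)] K(1)] by (simp add: LT_eq K(2))
    let ?f' = "f - Const (LC f) * prod_of B K"
    have f'_R: "?f' \<in> R"
      unfolding prod_of_B using less.prems(1) K(1)
      by (intro subalgebra_closed[OF subalgebra_R] eval_in_R) (simp_all add: polys_Monom_iff)
    have "\<exists>P. subducts B ?f' P"
    proof (cases "?f' = 0")
      case True
      thus ?thesis using subducts.zero by auto
    next
      case False
      have "grevlex_less (LM ?f') (LM f)"
        by (rule keys_diff_LT_smaller[OF less.prems(2) LT LM_in_keys[OF False]])
      moreover have "LM ?f' \<in> exps 3"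
        using LM_in_keys[OF False] R_polys[OF f'_R] by (auto simp: polys_iff)
      ultimately show ?thesis
        using less.hyps f'_R False by blast
    qed
    then obtain P where P: "subducts B ?f' P" ..
    show ?case
      using subducts.cancel[OF less.prems(2) _ LT P] K(1) length_B by auto
  qed
qed

text \<open>
  The products used in a subduction have lead monomials at most that of the start, because the lead
  monomials of the successive remainders decrease.
\<close>

lemma subducts_sound:
  assumes "subducts B f P"
  shows "P \<in> polys 5 \<and> \<epsilon> P = f \<and>
    (\<forall>K\<in>keys P. f \<noteq> 0 \<and> (\<phi> K = LM f \<or> grevlex_less (\<phi> K) (LM f)))"
  using assms
proof (induction rule: subducts.induct)
  case zero
  show ?case by (simp add: subalgebra_0[OF subalgebra_polys] alg_hom_0[OF alg_hom_eval])
next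
  case (cancel f K r P)
  have K: "K \<in> exps 5" using cancel.hyps by (simp add: length_B)
  let ?g = "Const r * prod_of B K"
  have "?g \<noteq> 0" "LM f = LM ?g" using LT_eq_iff[OF cancel.hyps(1)] cancel.hyps(3) by blast+
  hence LM: "LM f = \<phi> K"
    using K by (cases "r = 0") (auto simp: prod_of_B LM_Const_mult lead_eval_Monom)
  have "Const r * Monom K + P \<in> polys 5"
    using cancel.IH K by (intro subalgebra_closed[OF subalgebra_polys]) (simp_all add: polys_Monom_iff)
  moreover have "\<epsilon> (Const r * Monom K + P) = f"
    using cancel.IH by (simp add: alg_hom_simps[OF alg_hom_eval] prod_of_B)
  moreover have "f \<noteq> 0 \<and> (\<phi> J = LM f \<or> grevlex_less (\<phi> J) (LM f))"
    if J: "J \<in> keys (Const r * Monom K + P)" for J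
  proof -
    have "J = K \<or> J \<in> keys P"
      using J by (auto simp: Const_mult_Monom in_keys_iff lookup_add lookup_single when_def split: if_splits)
    thus ?thesis
    proof
      assume "J \<in> keys P"
      hence "f - ?g \<noteq> 0" and J: "\<phi> J = LM (f - ?g) \<or> grevlex_less (\<phi> J) (LM (f - ?g))"
        using cancel.IH by auto
      have "grevlex_less (LM (f - ?g)) (LM f)"
        by (rule keys_diff_LT_smaller[OF cancel.hyps(1,3) LM_in_keys[OF \<open>f - ?g \<noteq> 0\<close>]])
      thus ?thesis using J cancel.hyps(1) grevlex.trans[of "\<phi> J" "LM (f - ?g)" "LM f"] by auto
    qed (use LM cancel.hyps(1) in simp)
  qed
  ultimately show ?case by blast
qed

lemma subduction_relation_exists:
  assumes "I \<in> exps 5" "J \<in> exps 5" "\<phi> I = \<phi> J"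
  shows "\<exists>Q. subduction_relation B I J Q"
proof -
  have "prod_of B I - Const 1 * prod_of B J \<in> R"
    unfolding prod_of_B using assms
    by (intro subalgebra_closed[OF subalgebra_R] eval_in_R) (simp_all add: polys_Monom_iff)
  then obtain P where "subducts B (prod_of B I - Const 1 * prod_of B J) P"
    using invariant_subducts by blast
  moreover have "LT (prod_of B I) = LT (Const 1 * prod_of B J)"
    using assms by (simp add: LT_eq prod_of_B lead_eval_Monom)
  moreover have "tete_a_tete B I J"
    using assms by (simp add: tete_a_tete_def length_B prod_of_B lead_eval_Monom)
  ultimately show ?thesis
    unfolding subduction_relation_def by blast
qed

lemma subduction_relation_form:
  assumes "subduction_relation B I J Q"
  obtains r P where "Q = Monom I - Const r * Monom J - P" "Q \<in> polys 5" "\<epsilon> Q = 0"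
    "\<And>K. K \<in> keys P \<Longrightarrow> grevlex_less (\<phi> K) (\<phi> I)"
proof -
  obtain r P where IJ: "I \<in> exps 5" "J \<in> exps 5"
    and LT: "LT (prod_of B I) = LT (Const r * prod_of B J)"
    and sub: "subducts B (prod_of B I - Const r * prod_of B J) P"
    and Q: "Q = Monom I - Const r * Monom J - P"
    using assms by (auto simp: subduction_relation_def tete_a_tete_def length_B)
  let ?f = "prod_of B I - Const r * prod_of B J"
  note P = subducts_sound[OF sub]
  have "Q \<in> polys 5"
    unfolding Q using P IJ by (intro subalgebra_closed[OF subalgebra_polys]) (simp_all add: polys_Monom_iff)
  moreover have "\<epsilon> Q = 0"
    using P by (simp add: Q alg_hom_simps[OF alg_hom_eval] prod_of_B)
  moreover have "grevlex_less (\<phi> K) (\<phi> I)" if "K \<in> keys P" for K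
  proof -
    have "?f \<noteq> 0" and K: "\<phi> K = LM ?f \<or> grevlex_less (\<phi> K) (LM ?f)"
      using P that by auto
    have "grevlex_less (LM ?f) (LM (prod_of B I))"
      by (rule keys_diff_LT_smaller[OF _ LT LM_in_keys[OF \<open>?f \<noteq> 0\<close>]])
         (simp add: prod_of_B lead_eval_Monom IJ)
    hence "grevlex_less (LM ?f) (\<phi> I)"
      by (simp add: prod_of_B lead_eval_Monom IJ)
    thus ?thesis using K grevlex.trans[of "\<phi> K" "LM ?f" "\<phi> I"] by auto
  qed
  ultimately show ?thesis using that Q by blast
qed

section \<open>The ideal of relations\<close>

text \<open>
  Monomials are compared by the lead monomials of their values. Among monomials of equal weight the exponents of
  \<open>h\<^sub>3\<close> and \<open>h\<^sub>2\<close> decide, so that in both pairs the first product is the larger one: \<open>h\<^sub>3\<^sup>p\<close> against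
  \<open>h\<^sub>1 h\<^sub>2\<^sup>p\<close> requires that \<open>h\<^sub>3\<close> comes first. The last clause only makes the order total.
\<close>

definition weight_less :: "monomial \<Rightarrow> monomial \<Rightarrow> bool" where
  "weight_less K J \<longleftrightarrow> grevlex_less (\<phi> K) (\<phi> J) \<or> \<phi> K = \<phi> J \<and>
     (lookup K 3 < lookup J 3 \<or> lookup K 3 = lookup J 3 \<and>
       (lookup K 2 < lookup J 2 \<or> lookup K 2 = lookup J 2 \<and> grevlex_less K J))"

lemma \<phi>_add: "\<phi> (K + J) = \<phi> K + \<phi> J"
  by (rule poly_mapping_eqI) (simp add: \<phi>_def lookup_add lookup_single when_def algebra_simps)

lemma total_deg_le_\<phi>:
  assumes "K \<in> exps 5" shows "total_deg K \<le> total_deg (\<phi> K)"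
proof -
  have "total_deg K = (\<Sum>i\<in>{..<5}. lookup K i)"
    using assms by (intro total_deg_superset) (auto simp: exps_def)
  also have "\<dots> = lookup K 0 + lookup K 1 + lookup K 2 + lookup K 3 + lookup K 4"
    by (simp add: lessThan_5)
  also have "\<dots> \<le> lookup K 0 + (2 * p * lookup K 1 + p ^ 3 * lookup K 2 + (p ^ 3 + 2) * lookup K 3) + p ^ 4 * lookup K 4"
  proof -
    have "lookup K 1 \<le> 2 * p * lookup K 1" "lookup K 2 \<le> p ^ 3 * lookup K 2" "lookup K 3 \<le> (p ^ 3 + 2) * lookup K 3"
        "lookup K 4 \<le> p ^ 4 * lookup K 4"
      using p_gt_2 by simp_all
    thus ?thesis by linarith
  qed
  also have "\<dots> = total_deg (\<phi> K)"
    by (simp add: \<phi>_def total_deg_add)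
  finally show ?thesis .
qed

sublocale weight: monomial_order 5 weight_less
proof
  show "\<not> weight_less s s" for s
    by (simp add: weight_less_def grevlex.irrefl)
  show "weight_less s t" if st: "weight_less s r" and rt: "weight_less r t" for s r t
    using st rt grevlex.trans[of "\<phi> s" "\<phi> r" "\<phi> t"] grevlex.trans[of s r t]
    unfolding weight_less_def by (elim disjE conjE) simp_all
  show "weight_less s t \<or> weight_less t s" if "s \<noteq> t" for s t
    using that grevlex.total[of s t] grevlex.total[of "\<phi> s" "\<phi> t"]
    by (cases "\<phi> s = \<phi> t"; cases "lookup s 3" "lookup t 3" rule: linorder_cases;
        cases "lookup s 2" "lookup t 2" rule: linorder_cases) (auto simp: weight_less_def)
  show "weight_less (s + r) (t + r)" if "weight_less s t" for s t r
    using that grevlex.add_mono[of "\<phi> s" "\<phi> t" "\<phi> r"] grevlex.add_mono[of s t r]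
    unfolding weight_less_def \<phi>_add lookup_add by auto
  show "finite {s \<in> exps 5. weight_less s t}" for t
  proof (rule finite_subset[OF _ finite_exps_total_deg[of 5 "total_deg (\<phi> t)"]])
    have "total_deg (\<phi> s) \<le> total_deg (\<phi> t)" if "weight_less s t" for s
      using that grevlex_total_deg_le unfolding weight_less_def by auto
    thus "{s \<in> exps 5. weight_less s t} \<subseteq> {s \<in> exps 5. total_deg s \<le> total_deg (\<phi> t)}"
      using total_deg_le_\<phi> order.trans by blast
  qed
qed

text \<open>
  This holds for every subduction of the pair, since all products that a subduction uses have smaller weight.
\<close>

lemma weight_lead_subduction_relation:
  assumes Q: "subduction_relation B I J Q" and JI: "weight_less J I"
  shows "weight.is_lead Q I" "Q \<in> polys 5" "\<epsilon> Q = 0"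
proof -
  obtain r P where *: "Q = Monom I - Const r * Monom J - P" "Q \<in> polys 5" "\<epsilon> Q = 0"
    and P: "\<And>K. K \<in> keys P \<Longrightarrow> grevlex_less (\<phi> K) (\<phi> I)"
    using subduction_relation_form[OF Q] by blast
  show "Q \<in> polys 5" "\<epsilon> Q = 0" using * by auto
  have "weight_less t I" if "t \<in> keys (- (Const r * Monom J) - P)" for t
  proof -
    have "t = J \<or> t \<in> keys P"
      using that by (auto simp: Const_mult_Monom in_keys_iff lookup_minus lookup_single when_def split: if_splits)
    thus ?thesis using JI P by (auto simp: weight_less_def)
  qed
  from weight.lead_add_smaller(1)[OF weight.lead_Monom this]
  have "weight.is_lead (Monom I + (- (Const r * Monom J) - P)) I" .
  moreover have "Monom I + (- (Const r * Monom J) - P) = Q" by (simp add: *(1))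
  ultimately show "weight.is_lead Q I" by (simp only:)
qed

abbreviation "I1 \<equiv> single 2 2 :: monomial"
abbreviation "J1 \<equiv> single 1 (p\<^sup>2) :: monomial"
abbreviation "I2 \<equiv> single 3 p :: monomial"
abbreviation "J2 \<equiv> single 1 1 + single 2 p :: monomial"

lemma \<phi>_pairs: "\<phi> I1 = \<phi> J1" "\<phi> I2 = \<phi> J2"
proof -
  have "\<phi> I1 = single 1 (p ^ 3 * 2)" "\<phi> J1 = single 1 (2 * p * p\<^sup>2)"
    by (simp_all add: \<phi>_def lookup_single)
  moreover have "p ^ 3 * 2 = 2 * p * p\<^sup>2"
    by (simp add: power2_eq_square power3_eq_cube)
  ultimately show "\<phi> I1 = \<phi> J1" by (simp only:)
  have "\<phi> I2 = single 1 ((p ^ 3 + 2) * p)" "\<phi> J2 = single 1 (2 * p + p ^ 3 * p)"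
    by (simp_all add: \<phi>_def lookup_add lookup_single)
  moreover have "(p ^ 3 + 2) * p = 2 * p + p ^ 3 * p"
    by (simp add: algebra_simps)
  ultimately show "\<phi> I2 = \<phi> J2" by (simp only:)
qed

lemma weight_pairs: "weight_less J1 I1" "weight_less J2 I2"
  using p_gt_2 by (simp_all add: weight_less_def \<phi>_pairs lookup_add lookup_single)

text \<open>
  Reduction modulo \<open>R\<^sub>1\<close> and \<open>R\<^sub>2\<close> leaves a polynomial in normal monomials. If its value is zero it
  vanishes, as normal products have distinct lead monomials.
\<close>

lemma relations:
  assumes R1: "subduction_relation B I1 J1 R1" and R2: "subduction_relation B I2 J2 R2"
  shows "relation_ideal B = generated_ideal 5 [R1, R2]" "regular_sequence 5 [R1, R2]"
proof -
  note R1' = weight_lead_subduction_relation[OF R1 weight_pairs(1)]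
  note R2' = weight_lead_subduction_relation[OF R2 weight_pairs(2)]
  have sub: "generated_ideal 5 [R1, R2] \<subseteq> relation_ideal B"
    unfolding relation_ideal_def length_B using R1' R2'
    by (intro generated_ideal_subset) (auto simp: alg_hom_simps[OF alg_hom_eval] subalgebra_closed[OF subalgebra_polys])
  show "relation_ideal B = generated_ideal 5 [R1, R2]"
  proof
    show "relation_ideal B \<subseteq> generated_ideal 5 [R1, R2]"
    proof
      fix f assume "f \<in> relation_ideal B"
      hence f: "f \<in> polys 5" "\<epsilon> f = 0" by (auto simp: relation_ideal_def length_B)
      have "set [R1, R2] \<subseteq> polys 5" using R1'(2) R2'(2) by simp
      from weight.reduce_modulo[OF this f(1)]
      obtain r where r: "r \<in> polys 5" "f - r \<in> generated_ideal 5 [R1, R2]"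
        and "\<forall>t\<in>keys r. \<forall>Q\<in>set [R1, R2]. \<forall>m. weight.is_lead Q m \<longrightarrow> (\<forall>J. t \<noteq> m + J)"
        by blast
      hence reduced: "t \<noteq> I1 + J" "t \<noteq> I2 + J" if "t \<in> keys r" for t J
        using that R1'(1) R2'(1) by simp_all
      have "keys r \<subseteq> normal"
      proof
        fix t assume t: "t \<in> keys r"
        have divides: "t = single i k + (t - single i k)" if "lookup t i \<ge> k" for i k
          using that by (intro poly_mapping_eqI)
            (auto simp: lookup_add minus_poly_mapping.rep_eq lookup_single when_def)
        have "lookup t 2 < 2"
        proof (rule ccontr)
          assume "\<not> lookup t 2 < 2"
          hence "t = I1 + (t - I1)" by (intro divides) simp
          thus False using reduced(1)[OF t] by blast
        qed
        moreover have "lookup t 3 < p"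
        proof (rule ccontr)
          assume "\<not> lookup t 3 < p"
          hence "t = I2 + (t - I2)" by (intro divides) simp
          thus False using reduced(2)[OF t] by blast
        qed
        ultimately show "t \<in> normal" using t r(1) by (auto simp: normal_def polys_iff)
      qed
      moreover have "\<epsilon> r = 0"
      proof -
        have "f - r \<in> relation_ideal B" using sub r(2) by blast
        hence "\<epsilon> (f - r) = 0" by (simp add: relation_ideal_def)
        thus ?thesis using f(2) by (simp add: alg_hom_diff[OF alg_hom_eval])
      qed
      moreover have "\<epsilon> (Monom K) \<noteq> 0 \<and> LM (\<epsilon> (Monom K)) = \<phi> K" if "K \<in> normal" for K
        using that lead_eval_Monom[of K] by (simp add: normal_def)
      ultimately have "r = 0"
        using combination_eq_0[OF alg_hom_eval _ _ _ inj_\<phi>] by blast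
      thus "f \<in> generated_ideal 5 [R1, R2]" using r(2) by simp
    qed
  qed (rule sub)
  show "regular_sequence 5 [R1, R2]"
  proof (rule weight.regular_sequence_coprime_leads[OF R1'(2) R2'(2) R1'(1) R2'(1)])
    show "keys I1 \<inter> keys I2 = {}" by simp
    show "1 \<notin> generated_ideal 5 [R1, R2]"
      using sub by (auto simp: relation_ideal_def alg_hom_1[OF alg_hom_eval])
  qed
qed

lemma pairs_have_relations: "\<exists>R1. subduction_relation B I1 J1 R1" "\<exists>R2. subduction_relation B I2 J2 R2"
  by (intro subduction_relation_exists \<phi>_pairs; simp)+

lemma complete_intersection_R: "complete_intersection R"
proof -
  obtain R1 R2 where R12: "subduction_relation B I1 J1 R1" "subduction_relation B I2 J2 R2"
    using pairs_have_relations by blast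
  show ?thesis
    unfolding complete_intersection_def
    using relations[OF R12] R_eq by (intro exI[of _ B] exI[of _ "[R1, R2]"]) (simp add: length_B)
qed

end

theorem theorem4p4:
  fixes p :: nat and M :: "'a::field^4^2"
  assumes "prime p" and "p > 2" and "CHAR('a) = p"
    and "minor p M 1 2 3 4 = 0" and "minor p M 1 2 3 5 \<noteq> 0" and "minor p M 1 3 5 7 \<noteq> 0"
  defines "B \<equiv> {X, h1 p M, h2 p M, h3 p M, N_z p M}"
    and "b \<equiv> [X, h1 p M, h2 p M, h3 p M, N_z p M]"
  defines "I1 \<equiv> Poly_Mapping.single 2 2" and "J1 \<equiv> Poly_Mapping.single 1 (p\<^sup>2)"
  defines "I2 \<equiv> Poly_Mapping.single 3 p"
    and "J2 \<equiv> Poly_Mapping.single 1 1 + Poly_Mapping.single 2 p"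
  shows "sagbi_basis B (invariant_ring p M)
    \<and> generated_algebra B = invariant_ring p M
    \<and> complete_intersection (invariant_ring p M)
    \<and> (\<exists>R1. subduction_relation b I1 J1 R1)
    \<and> (\<exists>R2. subduction_relation b I2 J2 R2)
    \<and> (\<forall>R1 R2. subduction_relation b I1 J1 R1 \<longrightarrow> subduction_relation b I2 J2 R2 \<longrightarrow>
          relation_ideal b = generated_ideal 5 [R1, R2] \<and> regular_sequence 5 [R1, R2])"
proof -
  interpret inv: rank_four p M
    using assms(1-6) by unfold_locales
  have b: "b = inv.B" and B: "B = set inv.B"
    by (simp_all add: b_def B_def inv.B_def)
  show ?thesis
    unfolding b B I1_def J1_def I2_def J2_def
    by (intro conjI allI impI inv.sagbi inv.generated_B inv.complete_intersection_R inv.pairs_have_relations;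
        rule inv.relations; assumption)
qed

end
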